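(* With the vector space $V$, the vertex operator map $Y$ and the vacuum $\mathbf 1$ defined in the context (and $V$ graded by weights as there), the triple $(V,Y,\mathbf 1)$ is a $\frac{\mathbb Z}{2}$-graded meromorphic open-string vertex algebra.
   Context: **Definition of a $\frac{\mathbb Z}{2}$-graded meromorphic open-string vertex algebra (MOSVA).** It is a $\frac{\mathbb Z}2$-graded complex vector space $V=\coprod_{n\in\frac{\mathbb Z}2}V_{(n)}$ (graded by weights) with a linear map $Y_V:V\otimes V\to V[[x,x^{-1}]]$, $u\otimes v\mapsto Y_V(u,x)v$, and a vector $\mathbf 1\in V$ (the vacuum) such that: (1a) $V_{(n)}=0$ for $n$ sufficiently negative. (1b) With $\mathbf d_V v=nv$ for $v\in V_{(n)}$, for all $v\in V$: $[\mathbf d_V,Y_V(v,x)]=x\frac{d}{dx}Y_V(v,x)+Y_V(\mathbf d_Vv,x)$. (2a) $Y_V(\mathbf 1,x)=1_V$ (identity operator). (2b) For $u\in V$, $Y_V(u,x)\mathbf 1\in V[[x]]$ and $\lim_{x\to0}Y_V(u,x)\mathbf 1=u$. (3) With $D_V:V\to V$, $D_Vv=\lim_{x\to 0}\frac{d}{dx}Y_V(v,x)\mathbf 1$, for all $v\in V$: $\frac{d}{dx}Y_V(v,x)=Y_V(D_Vv,x)=[D_V,Y_V(v,x)]$. (4) For every $u_1,v\in V$ there exists $p\in\mathbb N$ such that for every $u_2\in V$, $(x_0+x_2)^pY_V(u_1,x_0+x_2)Y_V(u_2,x_2)v=(x_0+x_2)^pY_V(Y_V(u_1,x_0)u_2,x_2)v$.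 Here powers of $x_0+x_2$ are expanded in nonnegative powers of the second variable $x_2$. **Construction of $V$.** $\mathbb N=\{0,1,2,\dots\}$. Let $\mathfrak h=\mathbb C^{2M}$ with a nondegenerate symmetric bilinear form $(\cdot,\cdot)$ and $\mathfrak h=\mathfrak p\oplus\mathfrak q$ a decomposition into maximal isotropic subspaces $\mathfrak p,\mathfrak q\simeq\mathbb C^M$. Put $\hat{\mathfrak h}_{\mathbb Z+1/2}=\mathfrak h\otimes t^{1/2}\mathbb C[t,t^{-1}]\oplus\mathbb C\mathbf k$ and $\hat{\mathfrak h}^{\pm}_{\mathbb Z+1/2}=\mathfrak h\otimes t^{\pm1/2}\mathbb C[t^{\pm1}]$. Let $N(\hat{\mathfrak h}_{\mathbb Z+1/2})$ be the quotient of the tensor algebra $T(\hat{\mathfrak h}_{\mathbb Z+1/2})$ by the two-sided ideal generated by $(a\otimes t^{m+\frac12})\otimes(b\otimes t^{n+\frac12})+(b\otimes t^{n+\frac12})\otimes(a\otimes t^{m+\frac12})-(a,b)\delta_{m+n+1,0}\mathbf k$ and $(a\otimes t^{k+\frac12})\otimes\mathbf k-\mathbf k\otimes(a\otimes t^{k+\frac12})$, for $a,b\in\mathfrak h$, integers $m\ge0$, $n\le-1$, $k\in\mathbb Z$. (No relations are imposed between two elements with both exponents positive or both negative.) Let $\mathbb C\mathbf 1$ be the one-dimensional module of the subalgebra $T(\hat{\mathfrak h}^+_{\mathbb Z+1/2})\otimes T(\mathbb C\mathbf k)$ on which $\hat{\mathfrak h}^+_{\mathbb Z+1/2}$ acts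 by $0$ and $\mathbf k$ acts by $1$, and let $V=N(\hat{\mathfrak h}_{\mathbb Z+1/2})\otimes_{T(\hat{\mathfrak h}^+_{\mathbb Z+1/2})\otimes T(\mathbb C\mathbf k)}\mathbb C\mathbf 1$. As a vector space $V\cong T(\hat{\mathfrak h}^-_{\mathbb Z+1/2})\otimes\mathbb C\mathbf 1$. Write $h(m+1/2)$, $m\in\mathbb Z$, for the action of $h\otimes t^{m+1/2}$ on $V$ (a positive mode if $m\ge0$, a negative mode if $m<0$). $V$ is spanned by $h_1(-m_1-1/2)\cdots h_r(-m_r-1/2)\mathbf 1$ ($r\in\mathbb N$, $h_i\in\mathfrak h$, $m_i\in\mathbb N$), and such an element is given weight $m_1+\cdots+m_r+\frac r2$. **Vertex operators.** For $h\in\mathfrak h$, $m\in\mathbb N$, set $h^{(m)}(x)=\sum_{n\in\mathbb Z}\binom{-n-1}{m}h(n+1/2)x^{-n-m-1}$. The normal ordering of a product of modes is $:h_1(n_1+1/2)\cdots h_r(n_r+1/2):\;=(-1)^\sigma h_{\sigma(1)}(n_{\sigma(1)}+1/2)\cdots h_{\sigma(r)}(n_{\sigma(r)}+1/2)$, where $\sigma$ is the unique permutation of $\{1,\dots,r\}$ placing all negative modes to the left of all positive modes while preserving the relative order among the negative modes and among the positive modes, and $(-1)^\sigma$ is its sign. It is extended componentwise to products of series: $:h_1^{(m_1)}(x_1)\cdots h_r^{(m_r)}(x_r):\;=\sum_{n_1,\dots,n_r\in\mathbb Z}:h_1(n_1+1/2)\cdots h_r(n_r+1/2):\prod_i\binom{-n_i-1}{m_i}x_i^{-n_i-m_i-1}$,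 and the variables may be set equal. The linear map $Y:V\otimes V\to V((x))$ is defined by $Y(\mathbf 1,x)=1_V$ and $Y(h_1(-m_1-1/2)\cdots h_r(-m_r-1/2)\mathbf 1,x)=\;:h_1^{(m_1)}(x)\cdots h_r^{(m_r)}(x):$ for $h_i\in\mathfrak h$, $m_i\in\mathbb N$, extended linearly. *)

theory Defs
  imports
    Complex_Main
    "HOL-Library.Poly_Mapping"
    "HOL-Library.Product_Plus"
    "HOL-Combinatorics.Permutations"
    "HOL-Algebra.Algebra"
    "HOL-Algebra.Algebraic_Closure_Type"
begin

section \<open>Meromorphic open-string vertex algebras\<close>

abbreviation complex_field :: "complex ring" where
  "complex_field \<equiv> ring_of_type_algebra"

text \<open>
  A grading by half integers is a family \<open>gr :: int \<Rightarrow> 'v set\<close>, where \<open>gr k\<close> is the homogeneous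
  subspace of weight \<open>k / 2\<close>. A vertex operator map is a function \<open>Y\<close> such that \<open>Y u n v\<close> is the
  coefficient of \<open>x\<^sup>n\<close> (not of \<open>x\<close> to the power \<open>-n-1\<close>) in the series \<open>Y(u, x) v\<close>.
\<close>

definition is_decomposition ::
  "(complex, 'v) module \<Rightarrow> (int \<Rightarrow> 'v set) \<Rightarrow> 'v \<Rightarrow> (int \<Rightarrow> 'v) \<Rightarrow> bool" where
  "is_decomposition V gr v f \<longleftrightarrow>
     (\<forall>k. f k \<in> gr k) \<and> finite {k. f k \<noteq> \<zero>\<^bsub>V\<^esub>} \<and> v = (\<Oplus>\<^bsub>V\<^esub>k\<in>{k. f k \<noteq> \<zero>\<^bsub>V\<^esub>}. f k)"

definition weight_operator :: "(complex, 'v) module \<Rightarrow> (int \<Rightarrow> 'v set) \<Rightarrow> 'v \<Rightarrow> 'v" where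
  "weight_operator V gr v =
     (let f = (THE f. is_decomposition V gr v f)
      in \<Oplus>\<^bsub>V\<^esub>k\<in>{k. f k \<noteq> \<zero>\<^bsub>V\<^esub>}. (of_int k / 2) \<odot>\<^bsub>V\<^esub> f k)"

text \<open>
  Doubly indexed families \<open>F a b\<close> hold the coefficients of \<open>x\<^sub>0\<^sup>a x\<^sub>2\<^sup>b\<close>. In
  \<open>translated_product\<close> below the power \<open>(x\<^sub>0 + x\<^sub>2)\<^sup>m\<close> is expanded as the sum over \<open>j \<ge> 0\<close> of
  \<open>(m gchoose j)\<close> times \<open>x\<^sub>0\<close> to the power \<open>m - j\<close> times \<open>x\<^sub>2\<^sup>j\<close>; the coefficient of
  \<open>x\<^sub>0\<^sup>a x\<^sub>2\<^sup>b\<close> collects the terms with \<open>m = a + j\<close>. When the grading is bounded below and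
  compatible with \<open>Y\<close>, only finitely many of them are nonzero, since \<open>Y u\<^sub>2 n v = 0\<close> for \<open>n\<close>
  sufficiently negative.
\<close>

definition translated_product ::
  "(complex, 'v) module \<Rightarrow> ('v \<Rightarrow> int \<Rightarrow> 'v \<Rightarrow> 'v) \<Rightarrow> 'v \<Rightarrow> 'v \<Rightarrow> 'v \<Rightarrow> int \<Rightarrow> int \<Rightarrow> 'v" where
  "translated_product V Y u1 u2 v a b =
     (let t = (\<lambda>j::nat. (of_int (a + int j) gchoose j) \<odot>\<^bsub>V\<^esub> Y u1 (a + int j) (Y u2 (b - int j) v))
      in \<Oplus>\<^bsub>V\<^esub>j\<in>{j. t j \<noteq> \<zero>\<^bsub>V\<^esub>}. t j)"

definition iterate_product ::
  "('v \<Rightarrow> int \<Rightarrow> 'v \<Rightarrow> 'v) \<Rightarrow> 'v \<Rightarrow> 'v \<Rightarrow> 'v \<Rightarrow> int \<Rightarrow> int \<Rightarrow> 'v" where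
  "iterate_product Y u1 u2 v a b = Y (Y u1 a u2) b v"

definition times_binomial_power ::
  "(complex, 'v) module \<Rightarrow> nat \<Rightarrow> (int \<Rightarrow> int \<Rightarrow> 'v) \<Rightarrow> int \<Rightarrow> int \<Rightarrow> 'v" where
  "times_binomial_power V p F a b =
     (\<Oplus>\<^bsub>V\<^esub>i\<in>{..p}. of_nat (p choose i) \<odot>\<^bsub>V\<^esub> F (a - int (p - i)) (b - int i))"

text \<open>
  In the derivative axioms, \<open>Y v 1 vac\<close> is the value at \<open>x = 0\<close> of the derivative of
  \<open>Y(v, x) vac\<close>, that is, \<open>D\<^sub>V v\<close>.
\<close>

locale mosva = module complex_field V
  for V :: "(complex, 'v) module" (structure) +
  fixes gr :: "int \<Rightarrow> 'v set"
    and Y :: "'v \<Rightarrow> int \<Rightarrow> 'v \<Rightarrow> 'v"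
    and vac :: 'v
  assumes gr_submodule: "submodule (gr k) complex_field V"
    and gr_direct_sum: "v \<in> carrier V \<Longrightarrow> \<exists>!f. is_decomposition V gr v f"
    and vac_closed: "vac \<in> carrier V"
    and Y_closed: "u \<in> carrier V \<Longrightarrow> v \<in> carrier V \<Longrightarrow> Y u n v \<in> carrier V"
    and Y_add_left: "u \<in> carrier V \<Longrightarrow> u' \<in> carrier V \<Longrightarrow> v \<in> carrier V \<Longrightarrow>
          Y (u \<oplus> u') n v = Y u n v \<oplus> Y u' n v"
    and Y_smult_left: "u \<in> carrier V \<Longrightarrow> v \<in> carrier V \<Longrightarrow>
          Y (c \<odot>\<^bsub>V\<^esub> u) n v = c \<odot>\<^bsub>V\<^esub> Y u n v"
    and Y_add_right: "u \<in> carrier V \<Longrightarrow> v \<in> carrier V \<Longrightarrow> v' \<in> carrier V \<Longrightarrow>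
          Y u n (v \<oplus> v') = Y u n v \<oplus> Y u n v'"
    and Y_smult_right: "u \<in> carrier V \<Longrightarrow> v \<in> carrier V \<Longrightarrow>
          Y u n (c \<odot>\<^bsub>V\<^esub> v) = c \<odot>\<^bsub>V\<^esub> Y u n v"
    and lower_bound: "\<exists>K. \<forall>k<K. gr k = {\<zero>}"
    and d_bracket: "v \<in> carrier V \<Longrightarrow> w \<in> carrier V \<Longrightarrow>
          weight_operator V gr (Y v n w) \<ominus> Y v n (weight_operator V gr w) =
          of_int n \<odot>\<^bsub>V\<^esub> Y v n w \<oplus> Y (weight_operator V gr v) n w"
    and identity: "v \<in> carrier V \<Longrightarrow> Y vac n v = (if n = 0 then v else \<zero>)"
    and creation_regular: "u \<in> carrier V \<Longrightarrow> n < 0 \<Longrightarrow> Y u n vac = \<zero>"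
    and creation: "u \<in> carrier V \<Longrightarrow> Y u 0 vac = u"
    and D_derivative: "v \<in> carrier V \<Longrightarrow> w \<in> carrier V \<Longrightarrow>
          of_int (n + 1) \<odot>\<^bsub>V\<^esub> Y v (n + 1) w = Y (Y v 1 vac) n w"
    and D_bracket: "v \<in> carrier V \<Longrightarrow> w \<in> carrier V \<Longrightarrow>
          of_int (n + 1) \<odot>\<^bsub>V\<^esub> Y v (n + 1) w = Y (Y v n w) 1 vac \<ominus> Y v n (Y w 1 vac)"
    and associativity: "u1 \<in> carrier V \<Longrightarrow> v \<in> carrier V \<Longrightarrow>
          \<exists>p. \<forall>u2\<in>carrier V. \<forall>a b.
            times_binomial_power V p (translated_product V Y u1 u2 v) a b =
            times_binomial_power V p (iterate_product Y u1 u2 v) a b"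


section \<open>The tensor algebra of a complex vector space\<close>

text \<open>
  \<open>Poly_Mapping\<close> turns \<open>'k \<Rightarrow>\<^sub>0 complex\<close> into the monoid algebra of an additively written monoid
  \<open>'k\<close>. With the free monoid of words this is the free algebra, and the tensor algebra is its
  quotient by the ideal that makes the letters depend linearly on the vectors.
\<close>

datatype 'u tword = Word "'u list"

instantiation tword :: (type) monoid_add
begin

definition zero_tword :: "'a tword" where "zero_tword = Word []"

fun plus_tword :: "'a tword \<Rightarrow> 'a tword \<Rightarrow> 'a tword" where
  "plus_tword (Word us) (Word vs) = Word (us @ vs)"

instance
proof
  fix a b c :: "'a tword"
  show "a + b + c = a + (b + c)" by (cases a; cases b; cases c) simp
  show "0 + a = a" by (cases a) (simp add: zero_tword_def)
  show "a + 0 = a" by (cases a) (simp add: zero_tword_def)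
qed

end

type_synonym 'u free_alg = "'u tword \<Rightarrow>\<^sub>0 complex"

definition monomial :: "'u list \<Rightarrow> 'u free_alg" where
  "monomial us = Poly_Mapping.single (Word us) 1"

definition scalar_elt :: "complex \<Rightarrow> 'u free_alg" where
  "scalar_elt c = Poly_Mapping.single (Word []) c"

abbreviation free_algebra :: "'u free_alg ring" where
  "free_algebra \<equiv> ring_of_type_algebra"

definition tensor_ideal :: "(complex \<Rightarrow> 'u::ab_group_add \<Rightarrow> 'u) \<Rightarrow> 'u free_alg set" where
  "tensor_ideal scale = Idl\<^bsub>free_algebra\<^esub>
     ({monomial [u + v] - monomial [u] - monomial [v] |u v. True} \<union>
      {monomial [scale c u] - scalar_elt c * monomial [u] |c u. True})"

definition tensor_algebra ::
  "(complex \<Rightarrow> 'u::ab_group_add \<Rightarrow> 'u) \<Rightarrow> 'u free_alg set ring" where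
  "tensor_algebra scale = free_algebra Quot tensor_ideal scale"

definition to_tensor ::
  "(complex \<Rightarrow> 'u::ab_group_add \<Rightarrow> 'u) \<Rightarrow> 'u free_alg \<Rightarrow> 'u free_alg set" where
  "to_tensor scale p = tensor_ideal scale +>\<^bsub>free_algebra\<^esub> p"


section \<open>The space \<open>h\<close> and its affinization\<close>

definition isotropic :: "('h \<Rightarrow> 'h \<Rightarrow> complex) \<Rightarrow> 'h set \<Rightarrow> bool" where
  "isotropic form S \<longleftrightarrow> (\<forall>a\<in>S. \<forall>b\<in>S. form a b = 0)"

locale polarized_space = vector_space scale
  for scale :: "complex \<Rightarrow> 'h::ab_group_add \<Rightarrow> 'h" +
  fixes form :: "'h \<Rightarrow> 'h \<Rightarrow> complex"
    and \<pp> \<qq> :: "'h set"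
    and M :: nat
  assumes finite_basis: "\<exists>B. finite B \<and> independent B \<and> span B = UNIV \<and> card B = 2 * M"
    and form_add: "form (a + b) c = form a c + form b c"
    and form_scale: "form (scale z a) c = z * form a c"
    and form_sym: "form a b = form b a"
    and form_nondegenerate: "(\<And>b. form a b = 0) \<Longrightarrow> a = 0"
    and pp_subspace: "subspace \<pp>"
    and qq_subspace: "subspace \<qq>"
    and pp_isotropic: "isotropic form \<pp>"
    and qq_isotropic: "isotropic form \<qq>"
    and pp_maximal: "subspace S \<Longrightarrow> isotropic form S \<Longrightarrow> \<pp> \<subseteq> S \<Longrightarrow> S = \<pp>"
    and qq_maximal: "subspace S \<Longrightarrow> isotropic form S \<Longrightarrow> \<qq> \<subseteq> S \<Longrightarrow> S = \<qq>"
    and pp_dim: "dim \<pp> = M"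
    and qq_dim: "dim \<qq> = M"
    and pp_qq_sum: "\<exists>a\<in>\<pp>. \<exists>b\<in>\<qq>. h = a + b"
    and pp_qq_int: "\<pp> \<inter> \<qq> = {0}"

text \<open>
  A Laurent polynomial with coefficients in \<open>h\<close> is a finitely supported map \<open>int \<Rightarrow>\<^sub>0 'h\<close>; the
  entry at \<open>n\<close> is the coefficient of \<open>t\<close> to the power \<open>n + 1/2\<close>. The second component of
  \<open>'h hhat\<close> is the coefficient of the central element \<open>k\<close>.
\<close>

type_synonym 'h hhat = "(int \<Rightarrow>\<^sub>0 'h) \<times> complex"

definition hhat_scale ::
  "(complex \<Rightarrow> 'h::ab_group_add \<Rightarrow> 'h) \<Rightarrow> complex \<Rightarrow> 'h hhat \<Rightarrow> 'h hhat" where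
  "hhat_scale scale c u = (Poly_Mapping.map (scale c) (fst u), c * snd u)"

definition hmode :: "'h::ab_group_add \<Rightarrow> int \<Rightarrow> 'h hhat" where
  "hmode h n = (Poly_Mapping.single n h, 0)"

definition hcentral :: "complex \<Rightarrow> 'h::ab_group_add hhat" where
  "hcentral c = (0, c)"


section \<open>The algebra \<open>N\<close>\<close>

definition N_ideal ::
  "(complex \<Rightarrow> 'h::ab_group_add \<Rightarrow> 'h) \<Rightarrow> ('h \<Rightarrow> 'h \<Rightarrow> complex) \<Rightarrow> 'h hhat free_alg set set" where
  "N_ideal scale form =
    (let T = tensor_algebra (hhat_scale scale);
         \<iota> = (\<lambda>u. to_tensor (hhat_scale scale) (monomial [u]))
     in Idl\<^bsub>T\<^esub>
       ({\<iota> (hmode a m) \<otimes>\<^bsub>T\<^esub> \<iota> (hmode b n) \<oplus>\<^bsub>T\<^esub> \<iota> (hmode b n) \<otimes>\<^bsub>T\<^esub> \<iota> (hmode a m)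
           \<ominus>\<^bsub>T\<^esub> \<iota> (hcentral (if m + n + 1 = 0 then form a b else 0)) |a b m n. m \<ge> 0 \<and> n \<le> -1} \<union>
        {\<iota> (hmode a k) \<otimes>\<^bsub>T\<^esub> \<iota> (hcentral 1) \<ominus>\<^bsub>T\<^esub> \<iota> (hcentral 1) \<otimes>\<^bsub>T\<^esub> \<iota> (hmode a k) |a k. True}))"

definition N_algebra ::
  "(complex \<Rightarrow> 'h::ab_group_add \<Rightarrow> 'h) \<Rightarrow> ('h \<Rightarrow> 'h \<Rightarrow> complex) \<Rightarrow> 'h hhat free_alg set set ring" where
  "N_algebra scale form = tensor_algebra (hhat_scale scale) Quot N_ideal scale form"

definition to_N ::
  "(complex \<Rightarrow> 'h::ab_group_add \<Rightarrow> 'h) \<Rightarrow> ('h \<Rightarrow> 'h \<Rightarrow> complex) \<Rightarrow>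
     'h hhat free_alg \<Rightarrow> 'h hhat free_alg set set" where
  "to_N scale form p =
     N_ideal scale form +>\<^bsub>tensor_algebra (hhat_scale scale)\<^esub> to_tensor (hhat_scale scale) p"


section \<open>The induced module \<open>V\<close>\<close>

text \<open>
  The subalgebra over which \<open>V\<close> is induced is spanned by the words in letters from
  \<open>h\<^sup>+ \<oplus> C k\<close>. Such a word acts on the one-dimensional module \<open>C 1\<close> by the scalar
  \<open>vac_character\<close>: a letter acts by the coefficient of \<open>k\<close> in it.

  Since \<open>C 1\<close> is one-dimensional, \<open>N\<close> tensored with it over the complex numbers is \<open>N\<close>, by
  \<open>n \<otimes> 1 \<mapsto> n\<close>. The tensor product over the subalgebra is the quotient of \<open>N\<close> by the span of
  the balancing relations \<open>n a \<otimes> 1 - n \<otimes> a 1\<close>. These are closed under scalar multiplication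
  because \<open>n\<close> ranges over all of \<open>N\<close>, so the additive subgroup generated by them is the span.
\<close>

definition nonneg_letters :: "'h::ab_group_add hhat set" where
  "nonneg_letters = {u. Poly_Mapping.keys (fst u) \<subseteq> {0..}}"

definition vac_character :: "'h::ab_group_add hhat list \<Rightarrow> complex" where
  "vac_character us = prod_list (map snd us)"

definition V_relations ::
  "(complex \<Rightarrow> 'h::ab_group_add \<Rightarrow> 'h) \<Rightarrow> ('h \<Rightarrow> 'h \<Rightarrow> complex) \<Rightarrow> 'h hhat free_alg set set set" where
  "V_relations scale form =
    (let N = N_algebra scale form
     in generate (add_monoid N)
          {n \<otimes>\<^bsub>N\<^esub> to_N scale form (monomial us) \<ominus>\<^bsub>N\<^esub>
             n \<otimes>\<^bsub>N\<^esub> to_N scale form (scalar_elt (vac_character us)) |n us.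
             n \<in> carrier N \<and> set us \<subseteq> nonneg_letters})"

type_synonym 'h vspace = "'h hhat free_alg set set set"

definition to_V ::
  "(complex \<Rightarrow> 'h::ab_group_add \<Rightarrow> 'h) \<Rightarrow> ('h \<Rightarrow> 'h \<Rightarrow> complex) \<Rightarrow>
     'h hhat free_alg set set \<Rightarrow> 'h vspace" where
  "to_V scale form n = V_relations scale form +>\<^bsub>N_algebra scale form\<^esub> n"

definition N_act ::
  "(complex \<Rightarrow> 'h::ab_group_add \<Rightarrow> 'h) \<Rightarrow> ('h \<Rightarrow> 'h \<Rightarrow> complex) \<Rightarrow>
     'h hhat free_alg set set \<Rightarrow> 'h vspace \<Rightarrow> 'h vspace" where
  "N_act scale form n S = (\<Union>x\<in>S. to_V scale form (n \<otimes>\<^bsub>N_algebra scale form\<^esub> x))"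

text \<open>The record type \<open>module\<close> extends rings; the fields \<open>mult\<close> and \<open>one\<close> play no role.\<close>

definition V_module ::
  "(complex \<Rightarrow> 'h::ab_group_add \<Rightarrow> 'h) \<Rightarrow> ('h \<Rightarrow> 'h \<Rightarrow> complex) \<Rightarrow> (complex, 'h vspace) module" where
  "V_module scale form =
     \<lparr>carrier = a_rcosets\<^bsub>N_algebra scale form\<^esub> V_relations scale form,
      monoid.mult = undefined, one = undefined,
      ring.zero = V_relations scale form, add = set_add (N_algebra scale form),
      module.smult = (\<lambda>c. N_act scale form (to_N scale form (scalar_elt c)))\<rparr>"

definition V_vac :: "(complex \<Rightarrow> 'h::ab_group_add \<Rightarrow> 'h) \<Rightarrow> ('h \<Rightarrow> 'h \<Rightarrow> complex) \<Rightarrow> 'h vspace" where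
  "V_vac scale form = to_V scale form \<one>\<^bsub>N_algebra scale form\<^esub>"

text \<open>\<open>V_mode scale form h n\<close> is the operator \<open>h(n + 1/2)\<close>.\<close>

definition V_mode ::
  "(complex \<Rightarrow> 'h::ab_group_add \<Rightarrow> 'h) \<Rightarrow> ('h \<Rightarrow> 'h \<Rightarrow> complex) \<Rightarrow>
     'h \<Rightarrow> int \<Rightarrow> 'h vspace \<Rightarrow> 'h vspace" where
  "V_mode scale form h n = N_act scale form (to_N scale form (monomial [hmode h n]))"

text \<open>
  The list \<open>[(h\<^sub>1, m\<^sub>1), \<dots>, (h\<^sub>r, m\<^sub>r)]\<close> stands for
  \<open>h\<^sub>1(-m\<^sub>1-1/2) \<cdots> h\<^sub>r(-m\<^sub>r-1/2) 1\<close>; its weight is half of \<open>double_weight\<close>.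
\<close>

definition V_word ::
  "(complex \<Rightarrow> 'h::ab_group_add \<Rightarrow> 'h) \<Rightarrow> ('h \<Rightarrow> 'h \<Rightarrow> complex) \<Rightarrow> ('h \<times> nat) list \<Rightarrow> 'h vspace" where
  "V_word scale form hms =
     foldr (\<lambda>(h, m). V_mode scale form h (- int m - 1)) hms (V_vac scale form)"

definition double_weight :: "('h \<times> nat) list \<Rightarrow> int" where
  "double_weight hms = (\<Sum>(h, m)\<leftarrow>hms. 2 * int m + 1)"

definition V_grading ::
  "(complex \<Rightarrow> 'h::ab_group_add \<Rightarrow> 'h) \<Rightarrow> ('h \<Rightarrow> 'h \<Rightarrow> complex) \<Rightarrow> int \<Rightarrow> 'h vspace set" where
  "V_grading scale form k =
     generate (add_monoid (V_module scale form))
       {c \<odot>\<^bsub>V_module scale form\<^esub> V_word scale form hms |c hms. double_weight hms = k}"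


section \<open>Normal ordering and vertex operators\<close>

text \<open>Permutations act on the positions \<open>0, \<dots>, length ns - 1\<close> of the list \<open>ns\<close> of mode indices.\<close>

definition is_normal_perm :: "int list \<Rightarrow> (nat \<Rightarrow> nat) \<Rightarrow> bool" where
  "is_normal_perm ns \<sigma> \<longleftrightarrow> \<sigma> permutes {..<length ns} \<and>
     (\<forall>j<length ns. \<forall>i<j.
        \<not> (ns ! \<sigma> i \<ge> 0 \<and> ns ! \<sigma> j < 0) \<and>
        ((ns ! \<sigma> i < 0 \<longleftrightarrow> ns ! \<sigma> j < 0) \<longrightarrow> \<sigma> i < \<sigma> j))"

definition normal_perm :: "int list \<Rightarrow> nat \<Rightarrow> nat" where
  "normal_perm ns = (THE \<sigma>. is_normal_perm ns \<sigma>)"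

definition normal_product ::
  "(complex \<Rightarrow> 'h::ab_group_add \<Rightarrow> 'h) \<Rightarrow> ('h \<Rightarrow> 'h \<Rightarrow> complex) \<Rightarrow>
     'h list \<Rightarrow> int list \<Rightarrow> 'h vspace \<Rightarrow> 'h vspace" where
  "normal_product scale form hs ns v =
     (let \<sigma> = normal_perm ns
      in of_int (sign \<sigma>) \<odot>\<^bsub>V_module scale form\<^esub>
           foldr (\<lambda>i. V_mode scale form (hs ! \<sigma> i) (ns ! \<sigma> i)) [0..<length ns] v)"

text \<open>
  The coefficient of \<open>x\<^sup>k\<close> in the normally ordered product of the series \<open>h\<^sub>i\<close> with derivative
  index \<open>m\<^sub>i\<close>, all in the variable \<open>x\<close>, applied to \<open>v\<close>. For given \<open>v\<close> and \<open>k\<close> only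
  finitely many terms are nonzero: a product with a large nonnegative mode kills \<open>v\<close>, and a
  negative mode contributes to a nonnegative power of \<open>x\<close> only. For the empty list the result is
  the identity series, so that the requirement \<open>Y(1, x) = 1\<close> is a special case.
\<close>

definition normal_series ::
  "(complex \<Rightarrow> 'h::ab_group_add \<Rightarrow> 'h) \<Rightarrow> ('h \<Rightarrow> 'h \<Rightarrow> complex) \<Rightarrow>
     ('h \<times> nat) list \<Rightarrow> int \<Rightarrow> 'h vspace \<Rightarrow> 'h vspace" where
  "normal_series scale form hms k v =
     (let V = V_module scale form;
          r = length hms;
          t = (\<lambda>ns. (\<Prod>i<r. of_int (- (ns ! i) - 1) gchoose snd (hms ! i)) \<odot>\<^bsub>V\<^esub>
                      normal_product scale form (map fst hms) ns v)
      in \<Oplus>\<^bsub>V\<^esub>ns\<in>{ns. length ns = r \<and> (\<Sum>i<r. - (ns ! i) - int (snd (hms ! i)) - 1) = k \<and>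
                       t ns \<noteq> \<zero>\<^bsub>V\<^esub>}. t ns)"

definition is_vertex_map ::
  "(complex \<Rightarrow> 'h::ab_group_add \<Rightarrow> 'h) \<Rightarrow> ('h \<Rightarrow> 'h \<Rightarrow> complex) \<Rightarrow>
     ('h vspace \<Rightarrow> int \<Rightarrow> 'h vspace \<Rightarrow> 'h vspace) \<Rightarrow> bool" where
  "is_vertex_map scale form Y \<longleftrightarrow>
    (let V = V_module scale form in
      (\<forall>u\<in>carrier V. \<forall>v\<in>carrier V. \<forall>n. Y u n v \<in> carrier V) \<and>
      (\<forall>u\<in>carrier V. \<forall>u'\<in>carrier V. \<forall>v\<in>carrier V. \<forall>n. Y (u \<oplus>\<^bsub>V\<^esub> u') n v = Y u n v \<oplus>\<^bsub>V\<^esub> Y u' n v) \<and>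
      (\<forall>c. \<forall>u\<in>carrier V. \<forall>v\<in>carrier V. \<forall>n. Y (c \<odot>\<^bsub>V\<^esub> u) n v = c \<odot>\<^bsub>V\<^esub> Y u n v) \<and>
      (\<forall>u\<in>carrier V. \<forall>v\<in>carrier V. \<forall>v'\<in>carrier V. \<forall>n. Y u n (v \<oplus>\<^bsub>V\<^esub> v') = Y u n v \<oplus>\<^bsub>V\<^esub> Y u n v') \<and>
      (\<forall>c. \<forall>u\<in>carrier V. \<forall>v\<in>carrier V. \<forall>n. Y u n (c \<odot>\<^bsub>V\<^esub> v) = c \<odot>\<^bsub>V\<^esub> Y u n v) \<and>
      (\<forall>u\<in>carrier V. \<forall>v\<in>carrier V. \<exists>n0. \<forall>n<n0. Y u n v = \<zero>\<^bsub>V\<^esub>) \<and>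
      (\<forall>hms n. \<forall>v\<in>carrier V. Y (V_word scale form hms) n v = normal_series scale form hms n v))"

end

theory Submission
  imports Defs "HOL-Computational_Algebra.Formal_Power_Series"
begin

text \<open>
  On \<open>V\<close> the positive modes act by contraction, so they are odd derivations of the tensor
  algebra \<open>T(h\<^sup>-)\<close> and anticommute with each other. Hence
  \<open>Y(h u, x) = h\<^sup>-(x) Y(u, x) + (-1)\<^sup>|\<^sup>u\<^sup>| Y(u, x) h\<^sup>+(x)\<close>, and every axiom follows by
  induction on the length of the first word. For associativity, \<open>Y(h u, x\<^sub>1) Y(v, x\<^sub>2) w\<close> splits
  into three terms. The first is \<open>h\<^sup>-(x\<^sub>1)\<close> times the series for \<open>u\<close>. In the second \<open>h\<close> is
  contracted with \<open>v\<close>, at \<open>x\<^sub>0 = x\<^sub>1 - x\<^sub>2\<close>. In the third it is contracted with \<open>w\<close>, and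
  only there the two expansions of \<open>x\<^sub>1 = x\<^sub>0 + x\<^sub>2\<close> differ. As \<open>w\<close> is fixed, the pole in \<open>x\<^sub>1\<close>
  of this term is bounded and a power of \<open>x\<^sub>0 + x\<^sub>2\<close> removes the difference.

  All computations take place in the free algebra on the letters \<open>(h, m)\<close>, where \<open>h\<close> runs
  through all vectors and no linearity is imposed. It is mapped onto \<open>V\<close> by \<open>cls\<close>. Expanding the
  letters in a basis of \<open>h\<close> gives a normal form \<open>nf\<close> with the same kernel: it is read off from
  an action of \<open>N\<close> on the free algebra that satisfies all defining relations. Thus the vertex
  operators and the weights on \<open>V\<close> are well defined.
\<close>

text \<open>In \<open>N\<close> two nonnegative modes satisfy no relation, so they can be reordered
  only on V. That reordering turns the permutation sign of a normally ordered product, which depends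
  on the positions of the negative modes, into one sign depending only on the number of letters, and
  so permits a recursion on the first letter.

  In associativity the exponent has to be chosen before \<open>u2\<close>, although contractions of
  the first vector with \<open>u2\<close> have poles of unbounded order. These cost nothing, because
  both sides carry the same negative power of \<open>x0\<close> for them. The recursion replaces
  \<open>w\<close> by contractions of \<open>w\<close>, so the induction keeps \<open>w\<close>
  arbitrary; by weight only finitely many of these are nonzero, and their exponents can be added up.

  The sums are infinite in form and finite by weight. A weight bound on the arguments gives a
  cut-off, every larger cut-off serves as well, and formulas with different arguments are compared
  at a common one.\<close>

section \<open>Scalar multiplication and induction in the free algebra\<close>

text \<open>Scalars act by left multiplication with \<open>scalar_elt c\<close>, the form in which
  they occur in the generators of \<open>tensor_ideal\<close> and in the scalar multiplication of
  \<open>V_module\<close>.\<close>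

definition fscale :: "complex \<Rightarrow> 'u free_alg \<Rightarrow> 'u free_alg" (infixr \<open>*\<^sub>F\<close> 75) where
  "c *\<^sub>F x = scalar_elt c * x"

primrec letters :: "'u tword \<Rightarrow> 'u list" where
  "letters (Word us) = us"

lemma Word_letters [simp]: "Word (letters k) = k"
  by (cases k) simp

lemma lookup_fscale [simp]: "Poly_Mapping.lookup (c *\<^sub>F x) k = c * Poly_Mapping.lookup x k"
proof -
  have "c *\<^sub>F x = Poly_Mapping.map ((*) c) x"
    by (simp add: fscale_def scalar_elt_def mult_map_scale_conv_mult zero_tword_def)
  then show ?thesis by (simp add: Poly_Mapping.map.rep_eq when_def)
qed

lemma fscale_add_right: "c *\<^sub>F (x + y) = c *\<^sub>F x + c *\<^sub>F y"
  by (simp add: fscale_def distrib_left)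

lemma fscale_diff_right: "c *\<^sub>F (x - y) = c *\<^sub>F x - c *\<^sub>F y"
  by (simp add: fscale_def right_diff_distrib)

lemma fscale_add_left: "(c + d) *\<^sub>F x = c *\<^sub>F x + d *\<^sub>F x"
  by (rule poly_mapping_eqI) (simp add: lookup_add distrib_right)

lemma fscale_fscale [simp]: "c *\<^sub>F d *\<^sub>F x = (c * d) *\<^sub>F x"
  by (rule poly_mapping_eqI) simp

lemma fscale_one [simp]: "1 *\<^sub>F x = x"
  by (rule poly_mapping_eqI) simp

lemma fscale_zero_left [simp]: "0 *\<^sub>F x = 0"
  by (rule poly_mapping_eqI) simp

lemma fscale_zero_right [simp]: "c *\<^sub>F 0 = 0"
  by (simp add: fscale_def)

lemma fscale_minus_right: "c *\<^sub>F (- x) = - (c *\<^sub>F x)"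
  by (simp add: fscale_def)

lemma fscale_minus_left: "(- c) *\<^sub>F x = - (c *\<^sub>F x)"
  by (rule poly_mapping_eqI) simp

lemma fscale_minus_one [simp]: "(- 1) *\<^sub>F x = - x"
  by (simp add: fscale_minus_left)

lemma fscale_sum_right: "c *\<^sub>F (\<Sum>i\<in>A. f i) = (\<Sum>i\<in>A. c *\<^sub>F f i)"
  by (simp add: fscale_def sum_distrib_left)

lemma fscale_sum_left: "(\<Sum>i\<in>A. f i) *\<^sub>F x = (\<Sum>i\<in>A. f i *\<^sub>F x)"
  by (induction A rule: infinite_finite_induct) (simp_all add: fscale_add_left)

lemma poly_mapping_expand: "f = (\<Sum>k\<in>Poly_Mapping.keys f. Poly_Mapping.single k (Poly_Mapping.lookup f k))"
proof (rule poly_mapping_eqI)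
  fix k
  have "(\<Sum>l\<in>Poly_Mapping.keys f. Poly_Mapping.lookup (Poly_Mapping.single l (Poly_Mapping.lookup f l)) k)
      = (\<Sum>l\<in>Poly_Mapping.keys f. if l = k then Poly_Mapping.lookup f k else 0)"
    by (intro sum.cong refl) (simp add: lookup_single when_def)
  also have "\<dots> = Poly_Mapping.lookup f k"
    by (simp add: in_keys_iff)
  finally show "Poly_Mapping.lookup f k =
      Poly_Mapping.lookup (\<Sum>k\<in>Poly_Mapping.keys f. Poly_Mapping.single k (Poly_Mapping.lookup f k)) k"
    by (simp add: lookup_sum)
qed

lemma free_alg_expand:
  fixes x :: "'u free_alg"
  shows "x = (\<Sum>k\<in>Poly_Mapping.keys x. Poly_Mapping.lookup x k *\<^sub>F monomial (letters k))"
proof -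
  have "c *\<^sub>F monomial (letters k) = Poly_Mapping.single k c" for c and k :: "'u tword"
    by (rule poly_mapping_eqI) (simp add: monomial_def lookup_single when_def)
  then show ?thesis by (simp only:) (rule poly_mapping_expand)
qed

lemma free_alg_induct [case_names zero monomial add scale]:
  assumes "P 0" and "\<And>us. P (monomial us)"
    and "\<And>x y. P x \<Longrightarrow> P y \<Longrightarrow> P (x + y)" and "\<And>c x. P x \<Longrightarrow> P (c *\<^sub>F x)"
  shows "P (x :: 'u free_alg)"
proof -
  have "P (\<Sum>k\<in>A. Poly_Mapping.lookup x k *\<^sub>F monomial (letters k))" for A
    by (induction A rule: infinite_finite_induct) (simp_all add: assms)
  then show ?thesis by (subst free_alg_expand)
qed

lemma monomial_mult [simp]: "monomial us * monomial vs = monomial (us @ vs)"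
  by (simp add: monomial_def mult_single)

lemma monomial_Nil [simp]: "monomial [] = 1"
  by (simp add: monomial_def flip: zero_tword_def)

lemma mult_fscale_left [simp]: "(c *\<^sub>F x) * y = c *\<^sub>F (x * y)"
  by (simp add: fscale_def mult.assoc)

lemma mult_fscale_right [simp]: "x * (c *\<^sub>F y) = c *\<^sub>F (x * y)"
proof -
  have "x * scalar_elt c = scalar_elt c * x" for x :: "'u free_alg"
  proof (induction x rule: free_alg_induct)
    case (monomial us)
    then show ?case by (simp add: monomial_def scalar_elt_def mult_single)
  next
    case (scale d x)
    have "scalar_elt d * scalar_elt c = (scalar_elt c * scalar_elt d :: 'u free_alg)"
      by (simp add: scalar_elt_def mult_single mult.commute)
    then show ?case using scale
      by (simp add: fscale_def mult.assoc) (simp flip: mult.assoc)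
  qed (simp_all add: distrib_left distrib_right)
  from this[of x] show ?thesis by (simp add: fscale_def flip: mult.assoc)
qed

subsection \<open>Linear maps\<close>

definition flin :: "('u free_alg \<Rightarrow> 'w free_alg) \<Rightarrow> bool" where
  "flin f \<longleftrightarrow> (\<forall>x y. f (x + y) = f x + f y) \<and> (\<forall>c x. f (c *\<^sub>F x) = c *\<^sub>F f x)"

lemma flinI: "(\<And>x y. f (x + y) = f x + f y) \<Longrightarrow> (\<And>c x. f (c *\<^sub>F x) = c *\<^sub>F f x) \<Longrightarrow> flin f"
  by (simp add: flin_def)

lemma
  assumes "flin f"
  shows flin_add: "f (x + y) = f x + f y"
    and flin_scale: "f (c *\<^sub>F x) = c *\<^sub>F f x"
    and flin_zero: "f 0 = 0"
    and flin_minus: "f (- x) = - f x"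
    and flin_diff: "f (x - y) = f x - f y"
    and flin_sum: "f (\<Sum>i\<in>A. g i) = (\<Sum>i\<in>A. f (g i))"
proof -
  show a: "f (x + y) = f x + f y" and s: "f (c *\<^sub>F x) = c *\<^sub>F f x" for x y c
    using assms by (auto simp: flin_def)
  show z: "f 0 = 0" using s[of 0 0] by simp
  show m: "f (- x) = - f x" for x using s[of "-1" x] by simp
  show "f (x - y) = f x - f y" using a[of x "- y"] m by simp
  show "f (\<Sum>i\<in>A. g i) = (\<Sum>i\<in>A. f (g i))"
    by (induction A rule: infinite_finite_induct) (simp_all add: a z)
qed

lemma flin_eqI:
  assumes "flin f" "flin g" "\<And>us. f (monomial us) = g (monomial us)"
  shows "f x = g x"
  by (induction x rule: free_alg_induct)
     (simp_all add: assms flin_zero flin_add flin_scale)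

lemma flin_compose: "flin f \<Longrightarrow> flin g \<Longrightarrow> flin (\<lambda>x. f (g x))"
  by (simp add: flin_def)

lemma flin_plus: "flin f \<Longrightarrow> flin g \<Longrightarrow> flin (\<lambda>x. f x + g x)"
  by (simp add: flin_def fscale_add_right)

lemma flin_minus_fun: "flin f \<Longrightarrow> flin g \<Longrightarrow> flin (\<lambda>x. f x - g x)"
  by (simp add: flin_def fscale_diff_right)

lemma flin_sum_fun: "(\<And>i. i \<in> A \<Longrightarrow> flin (f i)) \<Longrightarrow> flin (\<lambda>x. \<Sum>i\<in>A. f i x)"
  by (induction A rule: infinite_finite_induct) (auto simp: flin_def fscale_add_right)

lemma flin_mult_left: "flin f \<Longrightarrow> flin (\<lambda>x. a * f x)"
  by (simp add: flin_def distrib_left)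

lemma flin_scale_fun: "flin f \<Longrightarrow> flin (\<lambda>x. c *\<^sub>F f x)"
  by (simp add: flin_def fscale_add_right mult.commute)

lemma flin_ident: "flin (\<lambda>x. x)"
  by (simp add: flin_def)

definition lin_ext :: "('u list \<Rightarrow> 'w free_alg) \<Rightarrow> 'u free_alg \<Rightarrow> 'w free_alg" where
  "lin_ext f x = (\<Sum>k\<in>Poly_Mapping.keys x. Poly_Mapping.lookup x k *\<^sub>F f (letters k))"

lemma flin_lin_ext: "flin (lin_ext f)"
proof (rule flinI)
  have sup: "lin_ext f x = (\<Sum>k\<in>A. Poly_Mapping.lookup x k *\<^sub>F f (letters k))"
    if "finite A" "Poly_Mapping.keys x \<subseteq> A" for x A
    unfolding lin_ext_def using that
    by (intro sum.mono_neutral_left) (auto simp: in_keys_iff)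
  show "lin_ext f (x + y) = lin_ext f x + lin_ext f y" for x y
  proof -
    let ?A = "Poly_Mapping.keys x \<union> Poly_Mapping.keys y"
    show ?thesis
      using sup[of ?A x] sup[of ?A y] sup[of ?A "x + y"] keys_add[of x y]
      by (simp add: lookup_add fscale_add_left sum.distrib)
  qed
  show "lin_ext f (c *\<^sub>F x) = c *\<^sub>F lin_ext f x" for c x
  proof -
    have "Poly_Mapping.keys (c *\<^sub>F x) \<subseteq> Poly_Mapping.keys x" by (auto simp: in_keys_iff)
    then show ?thesis
      using sup[of "Poly_Mapping.keys x" "c *\<^sub>F x"] by (simp add: lin_ext_def[of f x] fscale_sum_right)
  qed
qed

lemma lin_ext_monomial [simp]: "lin_ext f (monomial us) = f us"
  by (simp add: lin_ext_def monomial_def)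

lemmas lin_ext_simps [simp] =
  flin_add[OF flin_lin_ext] flin_scale[OF flin_lin_ext] flin_zero[OF flin_lin_ext]
  flin_minus[OF flin_lin_ext] flin_diff[OF flin_lin_ext] flin_sum[OF flin_lin_ext]

subsection \<open>Weights\<close>

lemma double_weight_simps [simp]:
  "double_weight [] = 0"
  "double_weight ((h, m) # us) = 2 * int m + 1 + double_weight us"
  by (simp_all add: double_weight_def)

lemma double_weight_nonneg: "0 \<le> double_weight us"
  by (induction us) auto

text \<open>A set of weights serves two purposes: singletons \<open>{k}\<close> give the homogeneous
  subspaces, rays \<open>{..K}\<close> the filtration from which all cut-offs are derived.\<close>

definition wt_in :: "int set \<Rightarrow> ('h \<times> nat) free_alg \<Rightarrow> bool" where
  "wt_in S x \<longleftrightarrow> (\<forall>k\<in>Poly_Mapping.keys x. double_weight (letters k) \<in> S)"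

lemma wt_in_zero [simp]: "wt_in S 0"
  by (simp add: wt_in_def)

lemma wt_in_add: "wt_in S x \<Longrightarrow> wt_in S y \<Longrightarrow> wt_in S (x + y)"
  using keys_add[of x y] by (auto simp: wt_in_def)

lemma wt_in_scale: "wt_in S x \<Longrightarrow> wt_in S (c *\<^sub>F x)"
  by (auto simp: wt_in_def in_keys_iff)

lemma wt_in_diff: "wt_in S x \<Longrightarrow> wt_in S y \<Longrightarrow> wt_in S (x - y)"
  using wt_in_add[of S x "(-1) *\<^sub>F y"] wt_in_scale[of S y "-1"] by simp

lemma wt_in_sum: "(\<And>i. i \<in> A \<Longrightarrow> wt_in S (f i)) \<Longrightarrow> wt_in S (\<Sum>i\<in>A. f i)"
  by (induction A rule: infinite_finite_induct) (auto intro: wt_in_add)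

lemma wt_in_monomial: "wt_in S (monomial us) \<longleftrightarrow> double_weight us \<in> S"
  by (simp add: wt_in_def monomial_def)

lemma wt_in_lin_ext:
  "wt_in S x \<Longrightarrow> (\<And>us. double_weight us \<in> S \<Longrightarrow> wt_in S' (f us)) \<Longrightarrow> wt_in S' (lin_ext f x)"
  unfolding lin_ext_def by (intro wt_in_sum wt_in_scale) (auto simp: wt_in_def)

lemma wt_in_mono: "wt_in S x \<Longrightarrow> S \<subseteq> S' \<Longrightarrow> wt_in S' x"
  by (auto simp: wt_in_def)

text \<open>Words have nonnegative weight. Every truncation statement below is an instance of
  this.\<close>

lemma wt_in_neg: "wt_in {..k} x \<Longrightarrow> k < 0 \<Longrightarrow> x = 0"
proof (rule poly_mapping_eqI)
  fix l assume "wt_in {..k} x" "k < 0"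
  then show "Poly_Mapping.lookup x l = Poly_Mapping.lookup 0 l"
    using double_weight_nonneg[of "letters l"] by (force simp: wt_in_def in_keys_iff)
qed

lemma wt_in_bound: "\<exists>k\<ge>0. wt_in {..k} x"
proof -
  have "finite ((\<lambda>k. double_weight (letters k)) ` Poly_Mapping.keys x)" by simp
  then obtain K where "\<forall>z\<in>(\<lambda>k. double_weight (letters k)) ` Poly_Mapping.keys x. z \<le> K"
    by (meson bdd_above_finite bdd_above_def)
  then have "wt_in {..max K 0} x" by (auto simp: wt_in_def)
  then show ?thesis by (intro exI[of _ "max K 0"]) auto
qed

lemma wt_in_letter:
  assumes "wt_in S x"
  shows "wt_in {s. s - (2 * int m + 1) \<in> S} (monomial [(h, m)] * x)"
proof -
  have "monomial [(h, m)] * x = lin_ext (\<lambda>us. monomial ((h, m) # us)) x"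
    by (rule flin_eqI) (simp_all add: flin_lin_ext flin_mult_left flin_ident)
  then show ?thesis
    by (simp only:, intro wt_in_lin_ext[OF assms]) (auto simp: wt_in_monomial)
qed

lemma wt_in_induct [consumes 1, case_names zero monomial add scale]:
  assumes "wt_in S x" and "P 0" and "\<And>us. double_weight us \<in> S \<Longrightarrow> P (monomial us)"
    and "\<And>x y. P x \<Longrightarrow> P y \<Longrightarrow> P (x + y)" and "\<And>c x. P x \<Longrightarrow> P (c *\<^sub>F x)"
  shows "P x"
proof -
  have "P (\<Sum>k\<in>A. Poly_Mapping.lookup x k *\<^sub>F monomial (letters k))" if "A \<subseteq> Poly_Mapping.keys x" for A
    using that by (induction A rule: infinite_finite_induct) (use assms in \<open>auto simp: wt_in_def\<close>)
  from this[OF order_refl] show ?thesis by (subst free_alg_expand)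
qed

lemma free_alg_letter_induct [case_names zero one letter add scale]:
  assumes "P 0" and "P 1" and "\<And>l x. P x \<Longrightarrow> P (monomial [l] * x)"
    and "\<And>x y. P x \<Longrightarrow> P y \<Longrightarrow> P (x + y)" and "\<And>c x. P x \<Longrightarrow> P (c *\<^sub>F x)"
  shows "P (x :: 'u free_alg)"
proof (induction x rule: free_alg_induct)
  case (monomial us)
  show ?case
  proof (induction us)
    case (Cons l us)
    then show ?case using assms(3)[OF Cons, of l] by simp
  qed (simp add: assms)
qed (use assms in auto)

lemma Sum_any_lessThan: "(\<And>k. N \<le> k \<Longrightarrow> f k = 0) \<Longrightarrow> Sum_any f = (\<Sum>k<N. f (k::nat))"
  by (rule Sum_any.expand_superset) (auto simp: not_le[symmetric])

section \<open>The parity involution\<close>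

definition par :: "'u free_alg \<Rightarrow> 'u free_alg" where
  "par = lin_ext (\<lambda>us. (-1) ^ length us *\<^sub>F monomial us)"

lemma flin_par: "flin par"
  by (simp add: par_def flin_lin_ext)

lemmas par_simps [simp] =
  flin_add[OF flin_par] flin_scale[OF flin_par] flin_zero[OF flin_par]
  flin_minus[OF flin_par] flin_diff[OF flin_par] flin_sum[OF flin_par]

lemma par_monomial: "par (monomial us) = (-1) ^ length us *\<^sub>F monomial us"
  by (simp add: par_def)

lemma par_one [simp]: "par 1 = 1"
  using par_monomial[of "[]"] by simp

lemma par_par [simp]: "par (par x) = x"
proof (induction x rule: free_alg_induct)
  case (monomial us)
  then show ?case by (simp add: par_monomial)
qed simp_all

lemma par_letter [simp]: "par (monomial [l] * x) = - (monomial [l] * par x)"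
  by (rule flin_eqI[where f = "\<lambda>x. par (monomial [l] * x)"])
     (auto simp: par_monomial fscale_minus_left flin_def distrib_left fscale_add_right fscale_minus_right)

text \<open>The sign of moving an odd operator past \<open>x\<close> is carried by
  \<open>par x\<close>. Hence the recursion for a product with first letter \<open>l\<close> refers
  to both \<open>x\<close> and \<open>par x\<close>; on words the second hypothesis is a scalar
  multiple of the first.\<close>

lemma free_alg_par_induct [case_names zero one letter add scale]:
  assumes "P 0" and "P 1" and "\<And>l x. P x \<Longrightarrow> P (par x) \<Longrightarrow> P (monomial [l] * x)"
    and "\<And>x y. P x \<Longrightarrow> P y \<Longrightarrow> P (x + y)" and "\<And>c x. P x \<Longrightarrow> P (c *\<^sub>F x)"
  shows "P (x :: 'u free_alg)"
proof (induction x rule: free_alg_induct)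
  case (monomial us)
  show ?case
  proof (induction us)
    case (Cons l us)
    then show ?case using assms(3)[OF Cons, of l] assms(5)[OF Cons] by (simp add: par_monomial)
  qed (simp add: assms)
qed (use assms in auto)

lemma wt_in_par: "wt_in S x \<Longrightarrow> wt_in S (par x)"
  unfolding par_def by (erule wt_in_lin_ext) (simp add: wt_in_scale wt_in_monomial)

text \<open>The coefficients of \<open>h^(m)(x)\<close>, indexed by modes: \<open>cplus m k\<close>
  belongs to the letter \<open>(h, k + m)\<close>, with power \<open>x^k\<close>, and
  \<open>cminus m i\<close> to the mode \<open>h(i+1/2)\<close>, with power
  \<open>x^(-i-m-1)\<close>. Letters of index below \<open>m\<close> have coefficient 0 and are left
  out by this indexing.\<close>

definition cplus :: "nat \<Rightarrow> nat \<Rightarrow> complex" where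
  "cplus m k = of_nat (k + m choose m)"

definition cminus :: "nat \<Rightarrow> nat \<Rightarrow> complex" where
  "cminus m i = (of_int (- int i - 1) gchoose m)"

subsection \<open>Contractions and vertex operators on words\<close>

locale contraction =
  fixes form :: "'h \<Rightarrow> 'h \<Rightarrow> complex"
begin

text \<open>The action of the mode \<open>h(i+1/2)\<close>: the letter \<open>(g, i)\<close> stands
  for \<open>g(-i-1/2)\<close>, the only kind of letter whose anticommutator with it can be
  nonzero.\<close>

primrec contract_word :: "'h \<Rightarrow> nat \<Rightarrow> ('h \<times> nat) list \<Rightarrow> ('h \<times> nat) free_alg" where
  "contract_word h i [] = 0"
| "contract_word h i (l # us) =
     (if snd l = i then form h (fst l) else 0) *\<^sub>F monomial us - monomial [l] * contract_word h i us"

definition con :: "'h \<Rightarrow> nat \<Rightarrow> ('h \<times> nat) free_alg \<Rightarrow> ('h \<times> nat) free_alg" where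
  "con h i = lin_ext (contract_word h i)"

lemma flin_con: "flin (con h i)"
  by (simp add: con_def flin_lin_ext)

lemmas con_simps [simp] =
  flin_add[OF flin_con] flin_scale[OF flin_con] flin_zero[OF flin_con]
  flin_minus[OF flin_con] flin_diff[OF flin_con] flin_sum[OF flin_con]

lemma con_one [simp]: "con h i 1 = 0"
  using lin_ext_monomial[of "contract_word h i" "[]"] by (simp add: con_def del: lin_ext_monomial)

lemma con_letter:
  "con h i (monomial [(g, j)] * x) = (if j = i then form h g else 0) *\<^sub>F x - monomial [(g, j)] * con h i x"
  by (rule flin_eqI[where f = "\<lambda>x. con h i (monomial [(g, j)] * x)"])
     (auto simp: con_def flin_def distrib_left fscale_add_right fscale_minus_right algebra_simps
       fscale_diff_right)

text \<open>Moving either contraction past a letter costs a sign and a scalar; in the double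
  contraction the scalar terms cancel, and both contractions kill the empty word.\<close>

lemma con_con: "con h i (con g j x) = - con g j (con h i x)"
proof (induction x rule: free_alg_letter_induct)
  case (letter l x)
  then show ?case by (cases l) (simp add: con_letter algebra_simps)
next
  case (scale c x)
  then show ?case by (simp add: fscale_minus_right)
qed simp_all

lemma con_par: "con h i (par x) = - par (con h i x)"
proof (induction x rule: free_alg_letter_induct)
  case (letter l x)
  then show ?case by (cases l) (simp add: con_letter algebra_simps)
next
  case (scale c x)
  then show ?case by (simp add: fscale_minus_right)
qed simp_all

lemma wt_in_con:
  assumes "wt_in S x"
  shows "wt_in {s. s + (2 * int i + 1) \<in> S} (con h i x)"
proof -
  have w: "wt_in {double_weight us - (2 * int i + 1)} (contract_word h i us)" for us
  proof (induction us)
    case (Cons l us)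
    obtain g j where l: "l = (g, j)" by (cases l)
    have "wt_in {s. s - (2 * int j + 1) \<in> {double_weight us - (2 * int i + 1)}}
            (monomial [l] * contract_word h i us)"
      unfolding l by (rule wt_in_letter[OF Cons])
    then have 1: "wt_in {double_weight (l # us) - (2 * int i + 1)} (monomial [l] * contract_word h i us)"
      by (rule wt_in_mono) (auto simp: l)
    have 2: "wt_in {double_weight (l # us) - (2 * int i + 1)}
            ((if snd l = i then form h (fst l) else 0) *\<^sub>F monomial us)"
      by (auto simp: l intro!: wt_in_scale simp: wt_in_monomial)
    show ?case using wt_in_diff[OF 2 1] by simp
  qed simp
  show ?thesis unfolding con_def
    by (rule wt_in_lin_ext[OF assms], rule wt_in_mono[OF w]) auto
qed

lemma con_eq_0: "wt_in {..K} x \<Longrightarrow> K < 2 * int i + 1 \<Longrightarrow> con h i x = 0"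
  by (rule wt_in_neg[of "K - (2 * int i + 1)"], rule wt_in_mono[OF wt_in_con]) auto

text \<open>
  Since the positive modes anticommute on \<open>V\<close>, the positive part of the first letter can be
  moved past all the other modes of the normally ordered product, with sign
  \<open>(-1) ^ length us\<close>.
\<close>

primrec Yw :: "('h \<times> nat) list \<Rightarrow> int \<Rightarrow> ('h \<times> nat) free_alg \<Rightarrow> ('h \<times> nat) free_alg" where
  "Yw [] n v = (if n = 0 then v else 0)"
| "Yw (l # us) n v =
     Sum_any (\<lambda>k. cplus (snd l) k *\<^sub>F (monomial [(fst l, k + snd l)] * Yw us (n - int k) v)) +
     (-1) ^ length us *\<^sub>F
       Sum_any (\<lambda>i. cminus (snd l) i *\<^sub>F Yw us (n + int i + int (snd l) + 1) (con (fst l) i v))"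

lemma wt_in_Sum_any: "(\<And>i. wt_in S (f i)) \<Longrightarrow> wt_in S (Sum_any f)"
  by (simp add: Sum_any.expand_set wt_in_sum)

lemma wt_in_Yw: "wt_in S v \<Longrightarrow> wt_in {s. s - (double_weight us + 2 * n) \<in> S} (Yw us n v)"
proof (induction us arbitrary: n v S)
  case Nil
  then show ?case by simp
next
  case (Cons l us)
  obtain h m where l: "l = (h, m)" by (cases l)
  have 1: "wt_in {s. s - (double_weight (l # us) + 2 * n) \<in> S} (monomial [(h, k + m)] * Yw us (n - int k) v)" for k
    by (rule wt_in_mono[OF wt_in_letter[OF Cons.IH[OF Cons.prems, of "n - int k"]]])
       (auto simp: l algebra_simps)
  have 2: "wt_in {s. s - (double_weight (l # us) + 2 * n) \<in> S} (Yw us (n + int i + int m + 1) (con h i v))" for i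
    by (rule wt_in_mono[OF Cons.IH[OF wt_in_con[OF Cons.prems]]])
       (auto simp: l algebra_simps)
  show ?case by (auto simp: l simp del: double_weight_simps intro!: wt_in_add wt_in_Sum_any wt_in_scale
     1[unfolded l] 2[unfolded l])
qed

lemma Yw_eq_0: "wt_in {..K} v \<Longrightarrow> K + double_weight us + 2 * n < 0 \<Longrightarrow> Yw us n v = 0"
  by (rule wt_in_neg[of "K + double_weight us + 2 * n"], rule wt_in_mono[OF wt_in_Yw]) auto

lemma Yw_zero [simp]: "Yw us n 0 = 0"
  by (induction us arbitrary: n) auto

text \<open>The first bound cuts off the creation part, where \<open>Yw us (n - int k) v\<close>
  falls below weight 0, and \<open>K \<le> 2 * int N\<close> the contractions of \<open>v\<close>.
  Any larger \<open>N\<close> works too, so several instances can share one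
  \<open>N\<close>.\<close>

lemma Yw_Cons:
  assumes "wt_in {..K} v" "K + double_weight us + 2 * n < 2 * int N" "K \<le> 2 * int N"
  shows "Yw ((h, m) # us) n v =
     (\<Sum>k<N. cplus m k *\<^sub>F (monomial [(h, k + m)] * Yw us (n - int k) v)) +
     (-1) ^ length us *\<^sub>F (\<Sum>i<N. cminus m i *\<^sub>F Yw us (n + int i + int m + 1) (con h i v))"
proof -
  have "Yw us (n - int k) v = 0" if "N \<le> k" for k
  proof -
    from that have "int N \<le> int k" by simp
    then show ?thesis using assms(2) by (intro Yw_eq_0[OF assms(1)]) (simp add: algebra_simps)
  qed
  moreover have "con h k v = 0" if "N \<le> k" for k
  proof -
    from that have "int N \<le> int k" by simp
    then show ?thesis using assms(3) by (intro con_eq_0[OF assms(1)]) simp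
  qed
  ultimately show ?thesis
    by (simp, intro arg_cong2[where f = "(+)"] arg_cong2[where f = "(*\<^sub>F)"] refl Sum_any_lessThan) auto
qed

text \<open>\<open>Sum_any\<close> is additive only on finitely supported families. Linearity is
  therefore read off from the truncations \<open>?F N\<close>, with one \<open>N\<close> that is
  large enough for \<open>x\<close>, \<open>y\<close>, \<open>x + y\<close> and the multiple of
  \<open>x\<close>.\<close>

lemma flin_Yw: "flin (Yw us n)"
proof (induction us arbitrary: n)
  case Nil
  then show ?case by (simp add: flin_def)
next
  case (Cons l us)
  obtain h m where l: "l = (h, m)" by (cases l)
  let ?F = "\<lambda>N v. (\<Sum>k<N. cplus m k *\<^sub>F (monomial [(h, k + m)] * Yw us (n - int k) v)) +
     (-1) ^ length us *\<^sub>F (\<Sum>i<N. cminus m i *\<^sub>F Yw us (n + int i + int m + 1) (con h i v))"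
  have F: "flin (?F N)" for N
    by (intro flin_plus flin_sum_fun flin_scale_fun flin_mult_left Cons flin_con
       flin_compose[where f = "Yw us _", OF Cons])
  have ex: "\<exists>N0. \<forall>N\<ge>N0. Yw (l # us) n v = ?F N v" for v
  proof -
    obtain K where "wt_in {..K} v" using wt_in_bound by blast
    then show ?thesis unfolding l
      by (intro exI[of _ "nat (\<bar>K\<bar> + \<bar>double_weight us + 2 * n\<bar> + 1)"] allI impI Yw_Cons[of K]) linarith+
  qed
  show ?case
  proof (rule flinI)
    fix x y c
    obtain N1 where "\<forall>N\<ge>N1. Yw (l # us) n x = ?F N x" using ex[of x] by blast
    moreover obtain N2 where "\<forall>N\<ge>N2. Yw (l # us) n y = ?F N y" using ex[of y] by blast
    moreover obtain N3 where "\<forall>N\<ge>N3. Yw (l # us) n (x + y) = ?F N (x + y)"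
      using ex[of "x + y"] by blast
    moreover obtain N4 where "\<forall>N\<ge>N4. Yw (l # us) n (c *\<^sub>F x) = ?F N (c *\<^sub>F x)"
      using ex[of "c *\<^sub>F x"] by blast
    moreover define N where "N = max (max N1 N2) (max N3 N4)"
    ultimately have "Yw (l # us) n x = ?F N x" "Yw (l # us) n y = ?F N y"
      "Yw (l # us) n (x + y) = ?F N (x + y)" "Yw (l # us) n (c *\<^sub>F x) = ?F N (c *\<^sub>F x)"
      by (simp_all del: Yw.simps)
    then show "Yw (l # us) n (x + y) = Yw (l # us) n x + Yw (l # us) n y"
      "Yw (l # us) n (c *\<^sub>F x) = c *\<^sub>F Yw (l # us) n x"
      using flin_add[OF F] flin_scale[OF F] by (simp_all del: Yw.simps)
  qed
qed

definition Y0 :: "('h \<times> nat) free_alg \<Rightarrow> int \<Rightarrow> ('h \<times> nat) free_alg \<Rightarrow> ('h \<times> nat) free_alg" where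
  "Y0 u n v = lin_ext (\<lambda>us. Yw us n v) u"

lemma flin_Y0_left: "flin (\<lambda>u. Y0 u n v)"
  unfolding Y0_def by (rule flin_lin_ext)

lemma flin_Y0_right: "flin (Y0 u n)"
  unfolding Y0_def lin_ext_def by (intro flin_sum_fun flin_scale_fun flin_Yw)

lemmas Y0_simps [simp] =
  flin_add[OF flin_Y0_left] flin_scale[OF flin_Y0_left] flin_zero[OF flin_Y0_left]
  flin_minus[OF flin_Y0_left] flin_diff[OF flin_Y0_left] flin_sum[OF flin_Y0_left]
  flin_add[OF flin_Y0_right] flin_scale[OF flin_Y0_right] flin_zero[OF flin_Y0_right]
  flin_minus[OF flin_Y0_right] flin_diff[OF flin_Y0_right] flin_sum[OF flin_Y0_right]

lemma Y0_monomial: "Y0 (monomial us) n v = Yw us n v"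
  by (simp add: Y0_def)

lemma Y0_one: "Y0 1 n v = (if n = 0 then v else 0)"
  using Y0_monomial[of "[]"] by simp

lemma wt_in_Y0:
  assumes "wt_in {..A} u" "wt_in {..B} v"
  shows "wt_in {..A + B + 2 * n} (Y0 u n v)"
  unfolding Y0_def
  by (rule wt_in_lin_ext[OF assms(1)], rule wt_in_mono[OF wt_in_Yw[OF assms(2)]]) auto

lemma Y0_eq_0: "wt_in {..A} u \<Longrightarrow> wt_in {..B} v \<Longrightarrow> A + B + 2 * n < 0 \<Longrightarrow> Y0 u n v = 0"
  using wt_in_Y0 wt_in_neg by blast

text \<open>The recursion behind all later inductions. With the sign absorbed into
  \<open>par u\<close> both sides are linear in \<open>u\<close>, so it holds for arbitrary elements
  and not only for words.\<close>

lemma Y0_letter: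
  assumes "wt_in {..A} u" "wt_in {..K} v" "A + K + 2 * n < 2 * int N" "K \<le> 2 * int N"
  shows "Y0 (monomial [(h, m)] * u) n v =
     (\<Sum>k<N. cplus m k *\<^sub>F (monomial [(h, k + m)] * Y0 u (n - int k) v)) +
     (\<Sum>i<N. cminus m i *\<^sub>F Y0 (par u) (n + int i + int m + 1) (con h i v))"
  using assms(1)
proof (induction u rule: wt_in_induct)
  case (monomial us)
  then have "Yw ((h, m) # us) n v =
     (\<Sum>k<N. cplus m k *\<^sub>F (monomial [(h, k + m)] * Yw us (n - int k) v)) +
     (-1) ^ length us *\<^sub>F (\<Sum>i<N. cminus m i *\<^sub>F Yw us (n + int i + int m + 1) (con h i v))"
    using assms by (intro Yw_Cons[of K]) auto
  then show ?case
    by (simp add: Y0_monomial par_monomial fscale_sum_right mult.commute del: Yw.simps)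
next
  case (add x y)
  then show ?case by (simp add: distrib_left sum.distrib fscale_add_right)
next
  case (scale c x)
  then show ?case by (simp add: fscale_add_right fscale_sum_right mult.commute)
qed simp

text \<open>Creation and contraction both change the parity by one, so \<open>Y\<close> is even.
  This is needed when \<open>Y(u, x0) v\<close> itself becomes the second factor in
  \<open>Y0_letter\<close> and its parity is taken.\<close>

lemma Y0_par: "par (Y0 u n v) = Y0 (par u) n (par v)"
proof (induction u arbitrary: n v rule: free_alg_par_induct)
  case (letter l x)
  obtain h m where l: "l = (h, m)" by (cases l)
  obtain A where A: "wt_in {..A} x" using wt_in_bound[of x] by blast
  obtain K where K: "wt_in {..K} v" using wt_in_bound[of v] by blast
  define N where "N = nat (\<bar>K\<bar> + \<bar>A\<bar> + \<bar>2 * n\<bar> + 1)"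
  have N: "A + K + 2 * n < 2 * int N" "K \<le> 2 * int N" unfolding N_def by linarith+
  show ?case unfolding l par_letter Y0_simps
      Y0_letter[OF A K N] Y0_letter[OF wt_in_par[OF A] wt_in_par[OF K] N]
    by (simp only: letter con_par flin_minus[OF flin_Y0_right] fscale_minus_right sum_negf
        minus_add minus_minus add.commute par_simps par_par par_letter)
next
  case (add x y)
  then show ?case by (simp only: par_simps Y0_simps)
next
  case (scale c x)
  then show ?case by (simp only: par_simps Y0_simps)
qed (simp_all add: Y0_one)

end

section \<open>Coefficients and derivatives\<close>

lemma sum_lessThan_shift:
  fixes g :: "nat \<Rightarrow> 'a::comm_monoid_add"
  assumes "g 0 = 0" "g N = 0"
  shows "(\<Sum>k<N. g (Suc k)) = (\<Sum>k<N. g k)"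
proof -
  have "(\<Sum>k<N. g (Suc k)) = (\<Sum>k<Suc N. g k)"
    using assms by (simp only: sum.lessThan_Suc_shift) simp
  then show ?thesis using assms by simp
qed

text \<open>On coefficients, \<open>(m+1) h^(m+1)(x)\<close> is the derivative of
  \<open>h^(m)(x)\<close>. \<open>cminus_Suc\<close> is the same fact for the nonnegative
  modes.\<close>

lemma cplus_Suc: "of_nat (Suc m) * cplus (Suc m) k = of_nat (Suc k) * cplus m (Suc k)"
proof -
  have "Suc m * (k + Suc m choose Suc m) = Suc k * (Suc k + m choose m)"
    using binomial_absorb_comp[of "Suc (k + m)" m] Suc_times_binomial[of m "k + m"] by simp
  then show ?thesis unfolding cplus_def by (metis of_nat_mult)
qed

text \<open>The derivation \<open>Dd\<close> below sends a letter of index \<open>k + m\<close> to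
  \<open>k + m + 1\<close> times the next one; the identity matches this with the derivative of the
  creation part in \<open>x\<close>. \<open>cminus_step\<close> plays the same role for the
  contractions.\<close>

lemma cplus_step: "of_nat (k + m + 1) * cplus m k = of_nat (Suc k) * cplus m (Suc k)"
proof -
  have "(k + m + 1) * (k + m choose m) = Suc k * (Suc k + m choose m)"
    using binomial_absorb_comp[of "Suc (k + m)" m] by simp
  then show ?thesis unfolding cplus_def by (metis of_nat_mult)
qed

lemma cminus_Suc: "of_nat (Suc m) * cminus (Suc m) i = - (of_nat (i + m + 1) * cminus m i)"
  using gbinomial_mult_1[of "of_int (- int i - 1) :: complex" m]
  by (simp add: cminus_def algebra_simps)

lemma cminus_step: "of_nat (Suc i) * cminus m (Suc i) = of_nat (i + m + 1) * cminus m i"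
  using gbinomial_absorb_comp[of "of_int (- int i - 1) :: complex" m]
  by (simp add: cminus_def algebra_simps)

lemma ex_nat_large: "\<exists>N::nat. a < 2 * int N \<and> b \<le> 2 * int N \<and> n < N"
proof -
  define N where "N = nat \<bar>a\<bar> + nat \<bar>b\<bar> + n + 1"
  have "int N = \<bar>a\<bar> + \<bar>b\<bar> + int n + 1" by (simp add: N_def)
  then have "a < 2 * int N" "b \<le> 2 * int N" "int n < int N" by linarith+
  then show ?thesis by auto
qed

section \<open>The commutator formula\<close>

context contraction
begin

text \<open>The anticommutator of \<open>g(n+1/2)\<close> with \<open>h^(m)(x)\<close> is
  \<open>form g h\<close> times \<open>(n choose m) x^(n-m)\<close>. As \<open>con g n\<close> is an
  odd derivation, it meets every letter of \<open>v\<close> in this way and finally reaches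
  \<open>w\<close>.\<close>

lemma con_Y0:
  "con g n (Y0 v b w) =
     (\<Sum>j\<le>n. of_nat (n choose j) *\<^sub>F Y0 (con g j v) (b - int (n - j)) w) + Y0 (par v) b (con g n w)"
proof (induction v arbitrary: b w rule: free_alg_par_induct)
  case one
  then show ?case by (simp add: Y0_one)
next
  case (letter l x)
  obtain h m where l: "l = (h, m)" by (cases l)
  obtain A where A: "wt_in {..A} x" using wt_in_bound[of x] by blast
  obtain K where K: "wt_in {..K} w" using wt_in_bound[of w] by blast
  obtain N where N: "A + K + 2 * b < 2 * int N" "K \<le> 2 * int N" "n < N"
    using ex_nat_large by blast
  have A': "wt_in {..A} (con g j x)" for j
    by (rule wt_in_mono[OF wt_in_con[OF A]]) auto
  have K': "wt_in {..K} (con g j w)" for j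
    by (rule wt_in_mono[OF wt_in_con[OF K]]) auto
  let ?L = "\<lambda>k. monomial [(h, k + m)]"
  \<comment> \<open>\<open>?d\<close> contracts \<open>g\<close> with the first letter. In
    \<open>?P\<close> and \<open>?Q\<close> it meets \<open>x\<close>, in \<open>?R\<close> and
    \<open>?T\<close> it reaches \<open>w\<close>; the first of each pair comes from the creation
    part of \<open>h\<close>, the second from its contractions.\<close>
  let ?d = "(if m \<le> n then (of_nat (n choose m) * form g h) *\<^sub>F Y0 x (b - int (n - m)) w else 0)"
  let ?P = "\<Sum>k<N. \<Sum>j\<le>n. (cplus m k * of_nat (n choose j)) *\<^sub>F
              (?L k * Y0 (con g j x) (b - int (n - j) - int k) w)"
  let ?Q = "\<Sum>i<N. \<Sum>j\<le>n. (cminus m i * of_nat (n choose j)) *\<^sub>F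
              Y0 (par (con g j x)) (b - int (n - j) + int i + int m + 1) (con h i w)"
  let ?R = "\<Sum>k<N. cplus m k *\<^sub>F (?L k * Y0 (par x) (b - int k) (con g n w))"
  let ?T = "\<Sum>i<N. cminus m i *\<^sub>F Y0 x (b + int i + int m + 1) (con g n (con h i w))"
  have L: "con g n (Y0 (monomial [(h, m)] * x) b w) = ?d - ?P - ?R - ?Q + ?T"
  proof -
    have "con g n (Y0 (monomial [(h, m)] * x) b w) =
       (\<Sum>k<N. cplus m k *\<^sub>F ((if k + m = n then form g h else 0) *\<^sub>F Y0 x (b - int k) w)) -
       (\<Sum>k<N. cplus m k *\<^sub>F (?L k * con g n (Y0 x (b - int k) w))) +
       (\<Sum>i<N. cminus m i *\<^sub>F con g n (Y0 (par x) (b + int i + int m + 1) (con h i w)))"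
      unfolding Y0_letter[OF A K N(1,2)]
      by (simp add: con_letter fscale_diff_right sum_subtractf)
    \<comment> \<open>Only \<open>k = n - m\<close> contributes, and \<open>n < N\<close> keeps it
      inside the range.\<close>
    also have "(\<Sum>k<N. cplus m k *\<^sub>F ((if k + m = n then form g h else 0) *\<^sub>F Y0 x (b - int k) w)) = ?d"
    proof (cases "m \<le> n")
      case True
      have "(\<Sum>k<N. cplus m k *\<^sub>F ((if k + m = n then form g h else 0) *\<^sub>F Y0 x (b - int k) w)) =
        (\<Sum>k<N. if k = n - m then (of_nat (n choose m) * form g h) *\<^sub>F Y0 x (b - int (n - m)) w else 0)"
        using True by (intro sum.cong) (auto simp: cplus_def)
      then show ?thesis using N(3) True by (simp add: less_imp_diff_less)
    qed (auto intro!: sum.neutral)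
    also have "(\<Sum>k<N. cplus m k *\<^sub>F (?L k * con g n (Y0 x (b - int k) w))) = ?P + ?R"
      by (simp add: letter(1) distrib_left sum_distrib_left fscale_add_right fscale_sum_right sum.distrib
          algebra_simps)
    also have "(\<Sum>i<N. cminus m i *\<^sub>F con g n (Y0 (par x) (b + int i + int m + 1) (con h i w))) = ?T - ?Q"
      by (simp add: letter(2) fscale_add_right fscale_sum_right sum.distrib con_par fscale_minus_right
          fscale_diff_right sum_subtractf sum_negf algebra_simps)
    finally show ?thesis by simp
  qed
  have R1: "Y0 (monomial [(h, m)] * con g j x) (b - int (n - j)) w =
     (\<Sum>k<N. cplus m k *\<^sub>F (?L k * Y0 (con g j x) (b - int (n - j) - int k) w)) +
     (\<Sum>i<N. cminus m i *\<^sub>F Y0 (par (con g j x)) (b - int (n - j) + int i + int m + 1) (con h i w))" for j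
  proof (rule Y0_letter[OF A' K _ N(2)])
    have *: "A + K + 2 * c < 2 * int N" if "c \<le> b" for c using that N(1) by linarith
    show "A + K + 2 * (b - int (n - j)) < 2 * int N" by (rule *) simp
  qed
  have "(\<Sum>j\<le>n. of_nat (n choose j) *\<^sub>F Y0 (con g j (monomial [(h, m)] * x)) (b - int (n - j)) w) =
     (\<Sum>j\<le>n. of_nat (n choose j) *\<^sub>F ((if m = j then form g h else 0) *\<^sub>F Y0 x (b - int (n - j)) w)) -
     (\<Sum>j\<le>n. of_nat (n choose j) *\<^sub>F Y0 (monomial [(h, m)] * con g j x) (b - int (n - j)) w)"
    by (simp add: con_letter fscale_diff_right sum_subtractf)
  also have "(\<Sum>j\<le>n. of_nat (n choose j) *\<^sub>F ((if m = j then form g h else 0) *\<^sub>F Y0 x (b - int (n - j)) w)) = ?d"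
  proof -
    have "(\<Sum>j\<le>n. of_nat (n choose j) *\<^sub>F ((if m = j then form g h else 0) *\<^sub>F Y0 x (b - int (n - j)) w)) =
      (\<Sum>j\<le>n. if j = m then (of_nat (n choose m) * form g h) *\<^sub>F Y0 x (b - int (n - m)) w else 0)"
      by (intro sum.cong) auto
    then show ?thesis by simp
  qed
  also have "(\<Sum>j\<le>n. of_nat (n choose j) *\<^sub>F Y0 (monomial [(h, m)] * con g j x) (b - int (n - j)) w) = ?P + ?Q"
    unfolding R1 fscale_add_right sum.distrib fscale_sum_right
    by (subst (1 2) sum.swap) (simp add: mult.commute)
  finally have R: "(\<Sum>j\<le>n. of_nat (n choose j) *\<^sub>F Y0 (con g j (monomial [(h, m)] * x)) (b - int (n - j)) w)
      = ?d - (?P + ?Q)" .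
  have "Y0 (par (monomial [(h, m)] * x)) b (con g n w) = - Y0 (monomial [(h, m)] * par x) b (con g n w)"
    by simp
  also have "\<dots> = ?T - ?R"
    unfolding Y0_letter[OF wt_in_par[OF A] K' N(1,2)] con_con[of h _ g n w]
    by (simp add: fscale_minus_right sum_negf)
  finally show ?case unfolding l L R by (simp add: algebra_simps)
next
  case (add x y)
  then show ?case by (simp add: sum.distrib fscale_add_right)
next
  case (scale c x)
  then show ?case by (simp add: fscale_add_right fscale_sum_right mult.commute)
qed simp

subsection \<open>The derivation\<close>

text \<open>A closed form of \<open>D_V\<close>: \<open>Y0_vacuum_1\<close> identifies it with the
  coefficient of \<open>x\<close> in \<open>Y(u, x) 1\<close>.\<close>

primrec deriv_word :: "('h \<times> nat) list \<Rightarrow> ('h \<times> nat) free_alg" where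
  "deriv_word [] = 0"
| "deriv_word (l # us) = of_nat (Suc (snd l)) *\<^sub>F monomial ((fst l, Suc (snd l)) # us) +
     monomial [l] * deriv_word us"

definition Dd :: "('h \<times> nat) free_alg \<Rightarrow> ('h \<times> nat) free_alg" where
  "Dd = lin_ext deriv_word"

lemma flin_Dd: "flin Dd"
  by (simp add: Dd_def flin_lin_ext)

lemmas Dd_simps [simp] =
  flin_add[OF flin_Dd] flin_scale[OF flin_Dd] flin_zero[OF flin_Dd]
  flin_minus[OF flin_Dd] flin_diff[OF flin_Dd] flin_sum[OF flin_Dd]

lemma Dd_one [simp]: "Dd 1 = 0"
  using lin_ext_monomial[of deriv_word "[]"] by (simp add: Dd_def del: lin_ext_monomial)

lemma Dd_letter:
  "Dd (monomial [(h, m)] * x) = of_nat (Suc m) *\<^sub>F (monomial [(h, Suc m)] * x) + monomial [(h, m)] * Dd x"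
  by (rule flin_eqI[where f = "\<lambda>x. Dd (monomial [(h, m)] * x)"])
     (auto simp: Dd_def flin_def distrib_left fscale_add_right algebra_simps)

lemma par_Dd: "par (Dd x) = Dd (par x)"
proof (induction x rule: free_alg_letter_induct)
  case (letter l x)
  then show ?case by (cases l) (simp add: Dd_letter fscale_minus_right)
qed simp_all

text \<open>For \<open>n = 0\<close> the natural number \<open>n - 1\<close> is 0, and the factor
  \<open>of_nat n\<close> removes the term.\<close>

lemma con_Dd: "con g n (Dd x) = Dd (con g n x) + of_nat n *\<^sub>F con g (n - 1) x"
proof (induction x rule: free_alg_letter_induct)
  case (letter l x)
  obtain h m where l: "l = (h, m)" by (cases l)
  show ?case unfolding l using letter
    by (cases n) (auto simp add: con_letter Dd_letter fscale_diff_right fscale_add_right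
        fscale_add_left fscale_minus_right distrib_left algebra_simps)
next
  case (scale c x)
  then show ?case by (simp add: fscale_add_right mult.commute)
qed (simp_all add: fscale_add_right)

lemma wt_in_Dd: "wt_in S x \<Longrightarrow> wt_in {s. s - 2 \<in> S} (Dd x)"
proof -
  have w: "wt_in {double_weight us + 2} (deriv_word us)" for us
  proof (induction us)
    case (Cons l us)
    obtain h m where l: "l = (h, m)" by (cases l)
    have "wt_in {double_weight (l # us) + 2} (monomial [l] * deriv_word us)"
      unfolding l by (rule wt_in_mono[OF wt_in_letter[OF Cons]]) auto
    moreover have "wt_in {double_weight (l # us) + 2}
        (of_nat (Suc (snd l)) *\<^sub>F monomial ((fst l, Suc (snd l)) # us))"
      by (auto simp: l intro!: wt_in_scale simp: wt_in_monomial)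
    ultimately show ?case by (simp add: wt_in_add)
  qed simp
  show "wt_in S x \<Longrightarrow> ?thesis" unfolding Dd_def
    by (erule wt_in_lin_ext, rule wt_in_mono[OF w]) auto
qed

section \<open>Vertex operators applied to the vacuum\<close>

lemma Y0_vacuum_letter:
  "wt_in {..A} x \<Longrightarrow> A + 2 * n < 2 * int N \<Longrightarrow>
   Y0 (monomial [(h, m)] * x) n 1 = (\<Sum>k<N. cplus m k *\<^sub>F (monomial [(h, k + m)] * Y0 x (n - int k) 1))"
  using Y0_letter[of A x 0 1 n N h m] wt_in_monomial[of "{..0}" "[]"] by simp

lemma Y0_vacuum_neg: "n < 0 \<Longrightarrow> Y0 u n 1 = 0"
proof (induction u arbitrary: n rule: free_alg_letter_induct)
  case (letter l x)
  obtain h m where l: "l = (h, m)" by (cases l)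
  obtain A where A: "wt_in {..A} x" using wt_in_bound[of x] by blast
  have "A + 2 * n < 2 * int (nat (\<bar>A\<bar> + \<bar>2 * n\<bar> + 1))" by linarith
  from Y0_vacuum_letter[OF A this] letter show ?case by (simp add: l)
qed (simp_all add: Y0_one)

lemma Y0_vacuum_0: "Y0 u 0 1 = u"
proof (induction u rule: free_alg_letter_induct)
  case (letter l x)
  obtain h m where l: "l = (h, m)" by (cases l)
  obtain A where A: "wt_in {..A} x" using wt_in_bound[of x] by blast
  obtain N where "A + 2 * 0 < 2 * int N" "0 \<le> 2 * int N" "0 < N" using ex_nat_large by blast
  moreover then obtain N' where "N = Suc N'" by (cases N) auto
  ultimately have "A + 2 * 0 < 2 * int (Suc N')" by simp
  from Y0_vacuum_letter[OF A this] letter show ?case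
    by (simp add: l sum.lessThan_Suc_shift cplus_def Y0_vacuum_neg del: sum.lessThan_Suc)
qed (simp_all add: Y0_one)

lemma Y0_vacuum_1: "Y0 u 1 1 = Dd u"
proof (induction u rule: free_alg_letter_induct)
  case (letter l x)
  obtain h m where l: "l = (h, m)" by (cases l)
  obtain A where A: "wt_in {..A} x" using wt_in_bound[of x] by blast
  obtain N where "A + 2 * 1 < 2 * int N" "0 \<le> 2 * int N" "1 < N" using ex_nat_large by blast
  moreover then obtain N' where "N = Suc (Suc N')" by (metis less_natE add_2_eq_Suc' One_nat_def Suc_lessE)
  ultimately have "A + 2 * 1 < 2 * int (Suc (Suc N'))" by simp
  from Y0_vacuum_letter[OF A this] letter show ?case
    by (simp add: l sum.lessThan_Suc_shift cplus_def Y0_vacuum_neg Y0_vacuum_0 Dd_letter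
        del: sum.lessThan_Suc)
qed (simp_all add: Y0_one)

section \<open>The derivative axioms on words\<close>

text \<open>By the product rule \<open>Dd\<close> hits the first letter or the rest. The two factors
  add up to \<open>n + 1\<close>: as \<open>k + (n - k + 1)\<close> in the creation part, as
  \<open>-(i + m + 1) + (n + i + m + 2)\<close> in the contractions.\<close>

lemma Y0_Dd: "Y0 (Dd u) n w = of_int (n + 1) *\<^sub>F Y0 u (n + 1) w"
proof (induction u arbitrary: n w rule: free_alg_par_induct)
  case one
  have "of_int (n + 1) = (0 :: complex)" if "n + 1 = 0" using that by (simp only: of_int_0)
  then show ?case by (auto simp: Y0_one simp del: of_int_add)
next
  case (letter l x)
  obtain h m where l: "l = (h, m)" by (cases l)
  obtain A0 where A0: "wt_in {..A0} x" using wt_in_bound[of x] by blast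
  \<comment> \<open>\<open>Dd\<close> raises the double weight by 2, so this bound serves both
    \<open>x\<close> and \<open>Dd x\<close>.\<close>
  define A where "A = A0 + 2"
  have A: "wt_in {..A} x" by (rule wt_in_mono[OF A0]) (auto simp: A_def)
  have A': "wt_in {..A} (Dd x)" by (rule wt_in_mono[OF wt_in_Dd[OF A0]]) (auto simp: A_def)
  obtain K where K: "wt_in {..K} w" using wt_in_bound[of w] by blast
  obtain N where N: "A + K + 2 * (n + 1) < 2 * int N" "K \<le> 2 * int N" "0 < N"
    using ex_nat_large by blast
  have N': "A + K + 2 * n < 2 * int N" using N by simp
  let ?L = "\<lambda>k. monomial [(h, k)]"
  let ?X = "\<lambda>k. ?L (k + m) * Y0 x (n + 1 - int k) w"
  let ?Z = "\<lambda>i. Y0 (par x) (n + int i + int m + 2) (con h i w)"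
  \<comment> \<open>The shift of the summation index needs both end terms to vanish: at 0 by the
    factor \<open>k\<close>, at \<open>N\<close> by weight. This is why \<open>N\<close> was chosen
    for the exponent \<open>n + 1\<close>.\<close>
  have X0: "?X N = 0" using Y0_eq_0[OF A K, of "n + 1 - int N"] N by simp
  have 1: "of_nat (Suc m) *\<^sub>F Y0 (?L (Suc m) * x) n w =
     (\<Sum>k<N. (of_nat k * cplus m k) *\<^sub>F ?X k) - (\<Sum>i<N. (of_nat (i + m + 1) * cminus m i) *\<^sub>F ?Z i)"
  proof -
    have "(\<Sum>k<N. (of_nat (Suc m) * cplus (Suc m) k) *\<^sub>F (?L (k + Suc m) * Y0 x (n - int k) w)) =
       (\<Sum>k<N. (of_nat (Suc k) * cplus m (Suc k)) *\<^sub>F ?X (Suc k))"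
      unfolding cplus_Suc by simp
    also have "\<dots> = (\<Sum>k<N. (of_nat k * cplus m k) *\<^sub>F ?X k)"
      by (rule sum_lessThan_shift) (simp_all only: X0, simp_all)
    finally have k: "(\<Sum>k<N. (of_nat (Suc m) * cplus (Suc m) k) *\<^sub>F (?L (k + Suc m) * Y0 x (n - int k) w)) =
       (\<Sum>k<N. (of_nat k * cplus m k) *\<^sub>F ?X k)" .
    have "of_nat (Suc m) *\<^sub>F Y0 (?L (Suc m) * x) n w =
       (\<Sum>k<N. (of_nat (Suc m) * cplus (Suc m) k) *\<^sub>F (?L (k + Suc m) * Y0 x (n - int k) w)) +
       (\<Sum>i<N. (of_nat (Suc m) * cminus (Suc m) i) *\<^sub>F ?Z i)"
      unfolding Y0_letter[OF A K N' N(2)]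
      by (simp only: fscale_add_right fscale_sum_right fscale_fscale) (simp add: algebra_simps)
    also have "\<dots> = (\<Sum>k<N. (of_nat k * cplus m k) *\<^sub>F ?X k) - (\<Sum>i<N. (of_nat (i + m + 1) * cminus m i) *\<^sub>F ?Z i)"
      unfolding k cminus_Suc by (simp only: fscale_minus_left sum_negf diff_conv_add_uminus)
    finally show ?thesis .
  qed
  have 2: "Y0 (?L m * Dd x) n w =
     (\<Sum>k<N. (cplus m k * of_int (n - int k + 1)) *\<^sub>F ?X k) +
     (\<Sum>i<N. (cminus m i * of_int (n + int i + int m + 2)) *\<^sub>F ?Z i)"
    unfolding Y0_letter[OF A' K N' N(2)] par_Dd letter
    by (simp add: algebra_simps)
  have 3: "of_int (n + 1) *\<^sub>F Y0 (?L m * x) (n + 1) w =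
     (\<Sum>k<N. (of_int (n + 1) * cplus m k) *\<^sub>F ?X k) +
     (\<Sum>i<N. (of_int (n + 1) * cminus m i) *\<^sub>F ?Z i)"
    unfolding Y0_letter[OF A K N(1,2)]
    by (simp only: fscale_add_right fscale_sum_right fscale_fscale) (simp add: algebra_simps)
  have k: "(of_nat k * cplus m k) *\<^sub>F ?X k + (cplus m k * of_int (n - int k + 1)) *\<^sub>F ?X k =
      (of_int (n + 1) * cplus m k) *\<^sub>F ?X k" for k
    by (simp only: flip: fscale_add_left) (simp add: algebra_simps)
  have i: "(cminus m i * of_int (n + int i + int m + 2)) *\<^sub>F ?Z i - (of_nat (i + m + 1) * cminus m i) *\<^sub>F ?Z i
      = (of_int (n + 1) * cminus m i) *\<^sub>F ?Z i" for i
    by (simp only: diff_conv_add_uminus flip: fscale_add_left fscale_minus_left) (simp add: algebra_simps)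
  show ?case unfolding l Dd_letter Y0_simps 1 2 3 k[symmetric] i[symmetric] sum.distrib sum_subtractf
    by simp
next
  case (add x y)
  then show ?case by (simp add: fscale_add_right)
next
  case (scale c x)
  then show ?case by (simp add: mult.commute)
qed simp

text \<open>Commuting \<open>Dd\<close> with the creation letters differentiates the creation part
  in \<open>x\<close>, commuting it with the contractions differentiates the other part. The inner
  operator, of exponent shifted by one, supplies the rest of \<open>n + 1\<close>.\<close>

lemma Dd_Y0: "Dd (Y0 u n w) = Y0 u n (Dd w) + of_int (n + 1) *\<^sub>F Y0 u (n + 1) w"
proof (induction u arbitrary: n w rule: free_alg_par_induct)
  case one
  have "of_int (n + 1) = (0 :: complex)" if "n + 1 = 0" using that by (simp only: of_int_0)
  then show ?case by (auto simp: Y0_one simp del: of_int_add)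
next
  case (letter l x)
  obtain h m where l: "l = (h, m)" by (cases l)
  obtain A where A: "wt_in {..A} x" using wt_in_bound[of x] by blast
  obtain K0 where K0: "wt_in {..K0} w" using wt_in_bound[of w] by blast
  define K where "K = K0 + 2"
  have K: "wt_in {..K} w" by (rule wt_in_mono[OF K0]) (auto simp: K_def)
  have K': "wt_in {..K} (Dd w)" by (rule wt_in_mono[OF wt_in_Dd[OF K0]]) (auto simp: K_def)
  obtain N where N: "A + K + 2 * (n + 1) < 2 * int N" "K \<le> 2 * int N" "0 < N"
    using ex_nat_large by blast
  have N': "A + K + 2 * n < 2 * int N" using N by simp
  let ?L = "\<lambda>k. monomial [(h, k)]"
  let ?X = "\<lambda>k. ?L (k + m) * Y0 x (n + 1 - int k) w"
  let ?Z = "\<lambda>i. Y0 (par x) (n + int i + int m + 2) (con h i w)"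
  \<comment> \<open>The extra term of \<open>con_Dd\<close> when \<open>Dd\<close> is applied to
    \<open>w\<close>. Shifted by one index it is, up to sign, the derivative of the powers
    \<open>x^(-i-m-1)\<close>.\<close>
  let ?W = "\<lambda>i. (of_nat i * cminus m i) *\<^sub>F Y0 (par x) (n + int i + int m + 1) (con h (i - 1) w)"
  have X0: "?X N = 0" using Y0_eq_0[OF A K, of "n + 1 - int N"] N by simp
  have W0: "?W N = 0" using con_eq_0[OF K0, of "N - 1" h] N by (simp add: K_def)
  have k: "(\<Sum>k<N. (of_nat (k + m + 1) * cplus m k) *\<^sub>F (?L (Suc (k + m)) * Y0 x (n - int k) w)) =
      (\<Sum>k<N. (of_nat k * cplus m k) *\<^sub>F ?X k)"
  proof -
    have "(\<Sum>k<N. (of_nat (k + m + 1) * cplus m k) *\<^sub>F (?L (Suc (k + m)) * Y0 x (n - int k) w)) =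
       (\<Sum>k<N. (of_nat (Suc k) * cplus m (Suc k)) *\<^sub>F ?X (Suc k))"
      unfolding cplus_step by simp
    also have "\<dots> = (\<Sum>k<N. (of_nat k * cplus m k) *\<^sub>F ?X k)"
      by (rule sum_lessThan_shift) (simp_all only: X0, simp_all)
    finally show ?thesis .
  qed
  have i: "(\<Sum>i<N. ?W i) = (\<Sum>i<N. (of_nat (i + m + 1) * cminus m i) *\<^sub>F ?Z i)"
  proof -
    have "(\<Sum>i<N. ?W i) = (\<Sum>i<N. ?W (Suc i))"
      by (rule sum_lessThan_shift[symmetric]) (simp_all only: W0, simp_all)
    then show ?thesis unfolding cminus_step by (simp add: algebra_simps)
  qed
  have 1: "Dd (Y0 (?L m * x) n w) =
     (\<Sum>k<N. (of_nat k * cplus m k) *\<^sub>F ?X k) +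
     (\<Sum>k<N. cplus m k *\<^sub>F (?L (k + m) * Dd (Y0 x (n - int k) w))) +
     (\<Sum>i<N. cminus m i *\<^sub>F Dd (Y0 (par x) (n + int i + int m + 1) (con h i w)))"
    unfolding Y0_letter[OF A K N' N(2)] k[symmetric]
    by (simp add: Dd_letter fscale_add_right sum.distrib mult.commute)
  have 2: "Y0 (?L m * x) n (Dd w) =
     (\<Sum>k<N. cplus m k *\<^sub>F (?L (k + m) * Y0 x (n - int k) (Dd w))) +
     (\<Sum>i<N. cminus m i *\<^sub>F Y0 (par x) (n + int i + int m + 1) (Dd (con h i w))) + (\<Sum>i<N. ?W i)"
    unfolding Y0_letter[OF A K' N' N(2)]
    by (simp add: con_Dd fscale_add_right sum.distrib mult.commute)
  have 3: "of_int (n + 1) *\<^sub>F Y0 (?L m * x) (n + 1) w =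
     (\<Sum>k<N. (of_int (n + 1) * cplus m k) *\<^sub>F ?X k) +
     (\<Sum>i<N. (of_int (n + 1) * cminus m i) *\<^sub>F ?Z i)"
    unfolding Y0_letter[OF A K N(1,2)]
    by (simp only: fscale_add_right fscale_sum_right fscale_fscale) (simp add: algebra_simps)
  have k': "(\<Sum>k<N. cplus m k *\<^sub>F (?L (k + m) * Dd (Y0 x (n - int k) w))) =
     (\<Sum>k<N. cplus m k *\<^sub>F (?L (k + m) * Y0 x (n - int k) (Dd w))) +
     (\<Sum>k<N. (of_int (n - int k + 1) * cplus m k) *\<^sub>F ?X k)"
    unfolding letter by (simp add: distrib_left fscale_add_right sum.distrib algebra_simps)
  have i': "(\<Sum>i<N. cminus m i *\<^sub>F Dd (Y0 (par x) (n + int i + int m + 1) (con h i w))) =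
     (\<Sum>i<N. cminus m i *\<^sub>F Y0 (par x) (n + int i + int m + 1) (Dd (con h i w))) +
     (\<Sum>i<N. (of_int (n + int i + int m + 2) * cminus m i) *\<^sub>F ?Z i)"
    unfolding letter by (simp add: fscale_add_right sum.distrib algebra_simps)
  have k'': "(of_nat k * cplus m k) *\<^sub>F ?X k + (of_int (n - int k + 1) * cplus m k) *\<^sub>F ?X k =
      (of_int (n + 1) * cplus m k) *\<^sub>F ?X k" for k
    by (simp only: flip: fscale_add_left) (simp add: algebra_simps)
  have i'': "(of_nat (i + m + 1) * cminus m i) *\<^sub>F ?Z i + (of_int (n + 1) * cminus m i) *\<^sub>F ?Z i =
      (of_int (n + int i + int m + 2) * cminus m i) *\<^sub>F ?Z i" for i
    by (simp only: flip: fscale_add_left) (simp add: algebra_simps)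
  show ?case unfolding l 1 2 3 i k' i' k''[symmetric] i''[symmetric] sum.distrib
    by (simp only: ac_simps)
next
  case (add x y)
  then show ?case by (simp add: fscale_add_right)
next
  case (scale c x)
  then show ?case by (simp add: mult.commute fscale_add_right)
qed simp

end

section \<open>Binomial identities for the expansions\<close>

lemma sum_box_eq_triangle:
  fixes f :: "nat \<Rightarrow> nat \<Rightarrow> 'a::comm_monoid_add"
  assumes "\<And>l i. (l < P \<and> i < Q) \<noteq> (l + i < N) \<Longrightarrow> f l i = 0"
  shows "(\<Sum>n<N. \<Sum>l\<le>n. f l (n - l)) = (\<Sum>l<P. \<Sum>i<Q. f l i)"
proof -
  let ?A = "{(l, i). l + i < N}" and ?B = "{..<P} \<times> {..<Q}"
  have A: "finite ?A" by (rule finite_subset[of _ "{..N} \<times> {..N}"]) auto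
  have "(\<Sum>n<N. \<Sum>l\<le>n. f l (n - l)) = (\<Sum>(l, i)\<in>?A. f l i)"
    by (rule sum.triangle_reindex[symmetric])
  also have "\<dots> = (\<Sum>(l, i)\<in>?A \<inter> ?B. f l i)"
    using A assms by (intro sum.mono_neutral_right) auto
  also have "\<dots> = (\<Sum>(l, i)\<in>?B. f l i)"
    using assms by (intro sum.mono_neutral_left) auto
  finally show ?thesis by (simp add: sum.cartesian_product)
qed

lemma sum_lessThan_mono_neutral:
  "P \<le> N \<Longrightarrow> (\<And>i. P \<le> i \<Longrightarrow> f i = 0) \<Longrightarrow> (\<Sum>i<N. f i) = (\<Sum>i<P. f (i::nat))"
  by (rule sum.mono_neutral_right) auto

text \<open>The Taylor expansion of the creation part at \<open>x0 + x2\<close>: on the left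
  \<open>x0^k\<close> and \<open>x2^i\<close> are produced one after the other, on the right they
  are the terms of \<open>(x0 + x2)^(k+i)\<close>.\<close>

lemma cplus_cplus: "cplus m k * cplus (k + m) i = cplus m (k + i) * of_nat (k + i choose i)"
proof -
  have "(k + m choose m) * (i + (k + m) choose (k + m)) = (k + i + m choose m) * (k + i choose i)"
    using choose_mult[of m "k + m" "i + (k + m)"] binomial_symmetric[of i "k + i"]
    by (simp add: algebra_simps)
  then show ?thesis by (simp add: cplus_def flip: of_nat_mult)
qed

lemma cminus_eq: "cminus m i = (-1) ^ m * cplus m i"
proof -
  have 1: "of_int (- int i - 1) = - (of_nat (Suc i) :: complex)" by simp
  have 2: "of_nat (Suc i) + of_nat m - 1 = (of_nat (i + m) :: complex)" by simp
  show ?thesis unfolding cminus_def 1 gbinomial_minus 2 cplus_def binomial_gbinomial ..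
qed

text \<open>Summed over \<open>i\<close>, the right-hand coefficients give
  \<open>(x1 - x2)^(-l-m-1)\<close> in nonnegative powers of \<open>x2\<close>, the pole caused by a
  contraction with the second vector.\<close>

lemma cminus_choose:
  "cminus m (l + i) * of_nat (l + i choose l) = cminus m l * of_nat (l + m + i choose i)"
proof -
  have "(l + i + m choose m) * (l + i choose l) = (l + m choose m) * (l + m + i choose i)"
    using choose_mult[of m "l + m" "l + i + m"] binomial_symmetric[of i "l + m + i"]
    by (simp add: algebra_simps)
  then show ?thesis by (simp add: cminus_eq cplus_def flip: of_nat_mult)
qed

text \<open>Summed over \<open>k\<close>, the right-hand coefficients give
  \<open>(x0 + x2)^(-i-m-1)\<close> in nonnegative powers of \<open>x0\<close>. The product side of
  associativity expands the same power in \<open>x2\<close>.\<close>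

lemma cplus_cminus:
  "cplus m k * cminus (k + m) i = cminus m i * (of_int (- int (i + m + 1)) gchoose k)"
proof -
  have 1: "of_int (- int (i + m + 1)) = of_int (- int i - 1) - (of_nat m :: complex)" by simp
  show ?thesis
    using gbinomial_trinomial_revision[of m "k + m" "of_int (- int i - 1) :: complex"]
    unfolding cminus_def cplus_def binomial_gbinomial 1 by (simp add: mult.commute)
qed

text \<open>Coefficients of \<open>z^n\<close> in
  \<open>(1-z)^(-a-1) (1-z)^(-r-1) = (1-z)^(-a-r-2)\<close>; negating the upper entries reduces it
  to Vandermonde.\<close>

lemma gbinomial_convolution:
  "(\<Sum>j\<le>n. (of_int (a + int j) gchoose j) * of_nat (r + (n - j) choose (n - j))) =
     (of_int (a + int r + 1 + int n) gchoose n :: complex)"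
proof -
  have 1: "(of_int (a + int j) gchoose j :: complex) = (-1) ^ j * (of_int (- a - 1) gchoose j)" for a j
  proof -
    have 1: "of_int (- a - 1) = - (of_int (a + 1) :: complex)" by simp
    have 2: "of_int (a + 1) + of_nat j - 1 = (of_int (a + int j) :: complex)" by simp
    show ?thesis unfolding 1 gbinomial_minus 2 by simp
  qed
  have 2: "(of_nat (r + k choose k) :: complex) = (-1) ^ k * (of_int (- int r - 1) gchoose k)" for k
    using 1[of "int r" k] by (simp add: binomial_gbinomial)
  have "(\<Sum>j\<le>n. (of_int (a + int j) gchoose j) * of_nat (r + (n - j) choose (n - j))) =
      (\<Sum>j\<le>n. (-1) ^ n * ((of_int (- a - 1) gchoose j) * (of_int (- int r - 1) gchoose (n - j))) :: complex)"
    unfolding 1 2 by (intro sum.cong refl) (simp add: algebra_simps flip: power_add)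
  also have "\<dots> = (-1) ^ n * ((of_int (- a - 1) + of_int (- int r - 1)) gchoose n)"
    by (simp only: gbinomial_Vandermonde[symmetric] sum_distrib_left atMost_atLeast0)
  also have "\<dots> = (of_int (a + int r + 1 + int n) gchoose n)"
    unfolding 1 by (simp add: algebra_simps)
  finally show ?thesis .
qed

subsection \<open>Doubly indexed families\<close>

text \<open>Multiplication by \<open>(x0 + x2)^p\<close>, the counterpart of
  \<open>times_binomial_power\<close> before classes are taken.\<close>

definition tbp :: "nat \<Rightarrow> (int \<Rightarrow> int \<Rightarrow> 'u free_alg) \<Rightarrow> int \<Rightarrow> int \<Rightarrow> 'u free_alg" where
  "tbp p F a b = (\<Sum>i\<le>p. of_nat (p choose i) *\<^sub>F F (a - int (p - i)) (b - int i))"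

lemma tbp_0 [simp]: "tbp 0 F = F"
  by (simp add: tbp_def fun_eq_iff)

lemma tbp_Suc: "tbp (Suc p) F a b = tbp p F (a - 1) b + tbp p F a (b - 1)"
proof -
  define f where "f i = F (a - int (Suc p - i)) (b - int i)" for i
  have "tbp (Suc p) F a b = f 0 + (\<Sum>i\<le>p. of_nat (Suc p choose Suc i) *\<^sub>F f (Suc i))"
    unfolding tbp_def f_def by (subst sum.atMost_Suc_shift) simp
  also have "\<dots> = (f 0 + (\<Sum>i\<le>p. of_nat (p choose Suc i) *\<^sub>F f (Suc i))) +
      (\<Sum>i\<le>p. of_nat (p choose i) *\<^sub>F f (Suc i))"
    by (simp add: fscale_add_left sum.distrib)
  also have "f 0 + (\<Sum>i\<le>p. of_nat (p choose Suc i) *\<^sub>F f (Suc i)) =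
      (\<Sum>i\<le>Suc p. of_nat (p choose i) *\<^sub>F f i)"
    by (subst sum.atMost_Suc_shift) simp
  also have "\<dots> = tbp p F (a - 1) b"
    unfolding tbp_def f_def by (auto simp: Suc_diff_le binomial_eq_0 algebra_simps intro!: sum.cong)
  also have "(\<Sum>i\<le>p. of_nat (p choose i) *\<^sub>F f (Suc i)) = tbp p F a (b - 1)"
    unfolding tbp_def f_def by (simp add: algebra_simps)
  finally show ?thesis .
qed

lemma tbp_tbp: "tbp p (tbp q F) = tbp (p + q) F"
proof (induction p)
  case (Suc p)
  then show ?case by (simp add: fun_eq_iff tbp_Suc)
qed simp

text \<open>The coefficient at \<open>(a, b)\<close> involves only exponents at most
  \<open>a\<close> and \<open>b\<close>. Expansions whose cut-off was chosen for
  \<open>(a, b)\<close> remain valid for these, so they may be inserted under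
  \<open>tbp\<close>.\<close>

lemma tbp_cong:
  assumes "\<And>a' b'. a' \<le> a \<Longrightarrow> b' \<le> b \<Longrightarrow> F a' b' = G a' b'"
  shows "tbp p F a b = tbp p G a b"
  unfolding tbp_def by (intro sum.cong refl arg_cong2[where f = "(*\<^sub>F)"] assms) auto

lemma tbp_add: "tbp p (\<lambda>a b. F a b + G a b) a b = tbp p F a b + tbp p G a b"
  by (simp add: tbp_def fscale_add_right sum.distrib)

lemma tbp_scale: "tbp p (\<lambda>a b. c *\<^sub>F F a b) a b = c *\<^sub>F tbp p F a b"
  by (simp add: tbp_def fscale_sum_right mult.commute)

lemma tbp_mult: "tbp p (\<lambda>a b. x * F a b) a b = x * tbp p F a b"
  by (simp add: tbp_def sum_distrib_left)

lemma tbp_sum: "tbp p (\<lambda>a b. \<Sum>i\<in>A. F i a b) a b = (\<Sum>i\<in>A. tbp p (F i) a b)"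
  unfolding tbp_def by (subst sum.swap) (simp add: fscale_sum_right)

lemma tbp_shift: "tbp p (\<lambda>a b. F (a + c) b) a b = tbp p F (a + c) b"
  by (simp add: tbp_def algebra_simps)

lemma tbp_eq_mono:
  assumes "tbp p F = tbp p G" "p \<le> q"
  shows "tbp q F = tbp q G"
  using assms tbp_tbp[of "q - p" p F] tbp_tbp[of "q - p" p G] by simp

section \<open>Substituting x0 + x2 for x1\<close>

text \<open>\<open>G c b\<close> is the coefficient of \<open>x1^c x2^b\<close>, and
  \<open>x1 = x0 + x2\<close> is expanded in nonnegative powers of \<open>x2\<close>, as in
  \<open>translated_product\<close>.\<close>

definition Tr :: "(int \<Rightarrow> int \<Rightarrow> 'u free_alg) \<Rightarrow> int \<Rightarrow> int \<Rightarrow> 'u free_alg" where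
  "Tr G a b = Sum_any (\<lambda>j::nat. (of_int (a + int j) gchoose j) *\<^sub>F G (a + int j) (b - int j))"

lemma Tr_finite:
  assumes "\<And>j. J \<le> j \<Longrightarrow> G (a + int j) (b - int j) = 0"
  shows "Tr G a b = (\<Sum>j<J. (of_int (a + int j) gchoose j) *\<^sub>F G (a + int j) (b - int j))"
  unfolding Tr_def using assms by (intro Sum_any_lessThan) simp

text \<open>A factor \<open>x1\<close> before the substitution is a factor \<open>x0 + x2\<close>
  after it; on coefficients this is Pascal's rule. The lower bound on the powers of
  \<open>x2\<close> makes the sums finite.\<close>

lemma Tr_shift1:
  assumes "\<And>c b. b < B \<Longrightarrow> G c b = 0"
  shows "Tr (\<lambda>c b. G (c - 1) b) a b = Tr G (a - 1) b + Tr G a (b - 1)"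
proof -
  define J where "J = nat (b - B + 1)"
  have z: "G c (b - int j) = 0" if "J \<le> j" for c j
    using that by (intro assms) (simp add: J_def)
  have "Tr (\<lambda>c b. G (c - 1) b) a b =
      (\<Sum>j<Suc J. (of_int (a + int j) gchoose j) *\<^sub>F G (a + int j - 1) (b - int j))"
    using z by (intro Tr_finite) simp
  also have "\<dots> = G (a - 1) b +
      (\<Sum>j<J. (of_int (a - 1 + int (Suc j)) gchoose Suc j) *\<^sub>F G (a - 1 + int (Suc j)) (b - int (Suc j))) +
      (\<Sum>j<J. (of_int (a + int j) gchoose j) *\<^sub>F G (a + int j) (b - 1 - int j))"
  proof -
    have g: "(of_int (a + int (Suc j)) gchoose Suc j :: complex) =
        (of_int (a - 1 + int (Suc j)) gchoose Suc j) + (of_int (a + int j) gchoose j)" for j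
      using gbinomial_Suc_Suc[of "of_int (a + int j) :: complex" j] by (simp add: algebra_simps)
    show ?thesis
      by (simp only: sum.lessThan_Suc_shift g fscale_add_left sum.distrib) (simp add: algebra_simps)
  qed
  also have "G (a - 1) b +
      (\<Sum>j<J. (of_int (a - 1 + int (Suc j)) gchoose Suc j) *\<^sub>F G (a - 1 + int (Suc j)) (b - int (Suc j))) =
      (\<Sum>j<Suc J. (of_int (a - 1 + int j) gchoose j) *\<^sub>F G (a - 1 + int j) (b - int j))"
    by (simp only: sum.lessThan_Suc_shift) simp
  also have "\<dots> = Tr G (a - 1) b"
    using z by (intro Tr_finite[symmetric]) simp
  also have "(\<Sum>j<J. (of_int (a + int j) gchoose j) *\<^sub>F G (a + int j) (b - 1 - int j)) = Tr G a (b - 1)"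
  proof (rule Tr_finite[symmetric])
    show "G (a + int j) (b - 1 - int j) = 0" if "J \<le> j" for j
      using z[of "Suc j" "a + int j"] that by (simp add: algebra_simps)
  qed
  finally show ?thesis .
qed

lemma Tr_shift:
  assumes "\<And>c b. b < B \<Longrightarrow> G c b = 0"
  shows "Tr (\<lambda>c b. G (c - int k) b) = tbp k (Tr G)"
proof (induction k)
  case (Suc k)
  have "Tr (\<lambda>c b. G (c - int (Suc k)) b) a b = Tr (\<lambda>c b. G (c - int k) b) (a - 1) b +
      Tr (\<lambda>c b. G (c - int k) b) a (b - 1)" for a b
    using Tr_shift1[of B "\<lambda>c b. G (c - int k) b" a b] assms by (simp add: algebra_simps)
  then show ?case by (simp add: fun_eq_iff tbp_Suc Suc)
qed simp

text \<open>The factor \<open>(x0 + x2)^k\<close> cancels \<open>x1^(-k)\<close>. This removes the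
  poles on the product side of associativity; \<open>tbp_Iv\<close> does so on the iterate
  side.\<close>

lemma tbp_Tr_unshift:
  assumes "\<And>c b. b < B \<Longrightarrow> G c b = 0"
  shows "tbp k (Tr (\<lambda>c b. G (c + int k) b)) = Tr G"
  using Tr_shift[of B "\<lambda>c b. G (c + int k) b" k] assms by simp

text \<open>
  Substituting \<open>x\<^sub>1 = x\<^sub>0 + x\<^sub>2\<close> turns \<open>(x\<^sub>1 - x\<^sub>2)\<^sup>-\<^sup>r\<^sup>-\<^sup>1\<close>, expanded in powers
  of \<open>x\<^sub>2\<close>, into \<open>x\<^sub>0\<^sup>-\<^sup>r\<^sup>-\<^sup>1\<close>.
\<close>

lemma Tr_geometric:
  assumes z: "\<And>c j. J \<le> j \<Longrightarrow> G c (b - int j) = 0"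
  shows "(\<Sum>j<J. \<Sum>i<J. ((of_int (a + int j) gchoose j) * of_nat (r + i choose i)) *\<^sub>F
             G (a + int r + 1 + int j + int i) (b - int j - int i)) = Tr G (a + int r + 1) b"
proof -
  define f where "f j i = ((of_int (a + int j) gchoose j) * of_nat (r + i choose i)) *\<^sub>F
             G (a + int r + 1 + int (j + i)) (b - int (j + i))" for j i
  have "(\<Sum>j<J. \<Sum>i<J. f j i) = (\<Sum>n<J. \<Sum>j\<le>n. f j (n - j))"
    by (rule sum_box_eq_triangle[symmetric]) (auto simp: f_def z not_less simp del: of_nat_add)
  also have "\<dots> = (\<Sum>n<J. (of_int (a + int r + 1 + int n) gchoose n) *\<^sub>F G (a + int r + 1 + int n) (b - int n))"
  proof (intro sum.cong refl)
    fix n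
    have "(\<Sum>j\<le>n. f j (n - j)) = (\<Sum>j\<le>n. ((of_int (a + int j) gchoose j) * of_nat (r + (n - j) choose (n - j))) *\<^sub>F
             G (a + int r + 1 + int n) (b - int n))"
      by (intro sum.cong refl) (simp add: f_def)
    then show "(\<Sum>j\<le>n. f j (n - j)) =
        (of_int (a + int r + 1 + int n) gchoose n) *\<^sub>F G (a + int r + 1 + int n) (b - int n)"
      by (simp only: fscale_sum_left[symmetric] gbinomial_convolution)
  qed
  also have "\<dots> = Tr G (a + int r + 1) b"
    using z by (intro Tr_finite[symmetric])
  finally show ?thesis by (simp add: f_def algebra_simps)
qed

section \<open>Negative powers of x0 + x2 expanded in x0\<close>

text \<open>Multiplication by \<open>(x0 + x2)^(-q)\<close> expanded in nonnegative powers of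
  \<open>x0\<close>, the opposite convention to \<open>Tr\<close>.\<close>

definition Iv :: "nat \<Rightarrow> (int \<Rightarrow> int \<Rightarrow> 'u free_alg) \<Rightarrow> int \<Rightarrow> int \<Rightarrow> 'u free_alg" where
  "Iv q F a b = Sum_any (\<lambda>k::nat. (of_int (- int q) gchoose k) *\<^sub>F F (a - int k) (b + int q + int k))"

lemma Iv_finite:
  assumes "\<And>k b. N \<le> k \<Longrightarrow> F (a - int k) b = 0"
  shows "Iv q F a b = (\<Sum>k<N. (of_int (- int q) gchoose k) *\<^sub>F F (a - int k) (b + int q + int k))"
  unfolding Iv_def using assms by (intro Sum_any_lessThan) simp

text \<open>One factor \<open>x0 + x2\<close> cancels one negative power, again by Pascal's rule.
  Here finiteness comes from the lower bound on the powers of \<open>x0\<close>.\<close>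

lemma Iv_step:
  assumes "\<And>a b. a < A \<Longrightarrow> F a b = 0"
  shows "Iv (Suc q) F (a - 1) b + Iv (Suc q) F a (b - 1) = Iv q F a b"
proof -
  define N where "N = nat (a - A + 1)"
  have z: "F (a - int k) c = 0" if "N \<le> k" for c k
    using that by (intro assms) (simp add: N_def)
  let ?F = "\<lambda>k. F (a - int k) (b + int q + int k)"
  have "Iv (Suc q) F (a - 1) b = (\<Sum>k<N. (of_int (- int (Suc q)) gchoose k) *\<^sub>F ?F (Suc k))"
  proof -
    have z': "F (a - 1 - int k) c = 0" if "N \<le> k" for c k
      using z[OF le_SucI[OF that], of c] by (simp add: diff_diff_eq)
    have "Iv (Suc q) F (a - 1) b =
        (\<Sum>k<N. (of_int (- int (Suc q)) gchoose k) *\<^sub>F F (a - 1 - int k) (b + int (Suc q) + int k))"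
      by (rule Iv_finite) (rule z')
    moreover have "a - 1 - int k = a - int (Suc k)" "b + int (Suc q) + int k = b + int q + int (Suc k)" for k
      by simp_all
    ultimately show ?thesis by (simp only:)
  qed
  moreover have "Iv (Suc q) F a (b - 1) =
      ?F 0 + (\<Sum>k<N. (of_int (- int (Suc q)) gchoose Suc k) *\<^sub>F ?F (Suc k))"
  proof -
    have "Iv (Suc q) F a (b - 1) =
        (\<Sum>k<Suc N. (of_int (- int (Suc q)) gchoose k) *\<^sub>F F (a - int k) (b - 1 + int (Suc q) + int k))"
      by (rule Iv_finite) (rule z, simp)
    moreover have "b - 1 + int (Suc q) + int k = b + int q + int k" for k
      by simp
    ultimately show ?thesis by (simp only: sum.lessThan_Suc_shift gbinomial_0 fscale_one)
  qed
  moreover have "Iv q F a b = ?F 0 + (\<Sum>k<N. (of_int (- int q) gchoose Suc k) *\<^sub>F ?F (Suc k))"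
  proof -
    have "Iv q F a b = (\<Sum>k<Suc N. (of_int (- int q) gchoose k) *\<^sub>F ?F k)"
      by (rule Iv_finite) (rule z, simp)
    then show ?thesis by (simp only: sum.lessThan_Suc_shift gbinomial_0 fscale_one)
  qed
  moreover have "(of_int (- int q) gchoose Suc k :: complex) =
      (of_int (- int (Suc q)) gchoose k) + (of_int (- int (Suc q)) gchoose Suc k)" for k
    using gbinomial_Suc_Suc[of "of_int (- int (Suc q)) :: complex" k] by simp
  ultimately show ?thesis
    by (simp only: fscale_add_left sum.distrib ac_simps)
qed

lemma tbp_Iv:
  assumes "\<And>a b. a < A \<Longrightarrow> F a b = 0"
  shows "tbp q (Iv q F) = F"
proof (induction q)
  case 0
  have "Iv 0 F a b = F a b" for a b
  proof -
    have "(\<lambda>k. (of_int (- int 0) gchoose k) *\<^sub>F F (a - int k) (b + int 0 + int k)) = (\<lambda>k. F a b when k = 0)"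
      by (rule ext) (simp add: gbinomial_0_left when_def)
    then show ?thesis by (simp only: Iv_def Sum_any_when_equal)
  qed
  then show ?case by (simp add: fun_eq_iff)
next
  case (Suc q)
  have "tbp 1 (Iv (Suc q) F) = Iv q F"
    unfolding One_nat_def by (intro ext) (simp only: tbp_Suc tbp_0 Iv_step[OF assms])
  then have "tbp (q + 1) (Iv (Suc q) F) = tbp q (Iv q F)" by (simp only: tbp_tbp[symmetric])
  then show ?case by (simp only: Suc Suc_eq_plus1)
qed

subsection \<open>Associativity\<close>

context contraction
begin

text \<open>The two sides of associativity, as families of coefficients of \<open>x\<^sub>0\<^sup>a x\<^sub>2\<^sup>b\<close>.\<close>

definition Lf where "Lf u v w = Tr (\<lambda>c b. Y0 u c (Y0 v b w))"

definition Rf where "Rf u v w = (\<lambda>a b. Y0 (Y0 u a v) b w)"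

lemma Y0_truncated: "\<exists>B. \<forall>b<B. Y0 v b w = 0"
proof -
  obtain V where V: "wt_in {..V} v" using wt_in_bound[of v] by blast
  obtain W where W: "wt_in {..W} w" using wt_in_bound[of w] by blast
  have "Y0 v b w = 0" if "b < - \<bar>V + W\<bar>" for b
    using that by (intro Y0_eq_0[OF V W]) simp
  then show ?thesis by blast
qed

lemma Tr_Y0_shift:
  "Tr (\<lambda>c b. Y0 u (c - int k) (Y0 v b w)) = tbp k (Lf u v w)"
proof -
  obtain B where "\<forall>b<B. Y0 v b w = 0" using Y0_truncated by blast
  then show ?thesis unfolding Lf_def
    by (intro Tr_shift[where G = "\<lambda>c b. Y0 u c (Y0 v b w)" and B = B]) simp
qed

lemma tbp_Tr_Y0:
  "tbp k (Tr (\<lambda>c b. Y0 u (c + int k) (Y0 v b w))) = Lf u v w"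
proof -
  obtain B where "\<forall>b<B. Y0 v b w = 0" using Y0_truncated by blast
  then show ?thesis unfolding Lf_def
    by (intro tbp_Tr_unshift[where G = "\<lambda>c b. Y0 u c (Y0 v b w)" and B = B]) simp
qed

text \<open>The cut-off depends on \<open>Y(v, x2) w\<close> alone and so serves all
  \<open>u\<close> at once, which makes \<open>Lf\<close> linear in \<open>u\<close>.\<close>

lemma Lf_expand:
  "\<exists>J. \<forall>u. Lf u v w a b =
     (\<Sum>j<J. (of_int (a + int j) gchoose j) *\<^sub>F Y0 u (a + int j) (Y0 v (b - int j) w))"
proof -
  obtain B where B: "\<forall>b<B. Y0 v b w = 0" using Y0_truncated by blast
  have "Y0 v (b - int j) w = 0" if "nat (b - B + 1) \<le> j" for j
    using that by (intro B[rule_format]) simp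
  then show ?thesis unfolding Lf_def
    by (intro exI[of _ "nat (b - B + 1)"] allI Tr_finite) simp
qed

lemma wt_in_con_le: "wt_in {..V} v \<Longrightarrow> wt_in {..V} (con h i v)"
  by (rule wt_in_mono[OF wt_in_con]) auto

text \<open>\<open>con_Y0\<close> carries the nonnegative modes of the first letter past
  \<open>Y(v, x2)\<close>. \<open>P\<close> bounds the contractions of \<open>v\<close>,
  \<open>Q\<close> those of \<open>w\<close>, \<open>J\<close> the powers of \<open>x2\<close>, and
  \<open>N\<close> the original sums. The bound on \<open>Q\<close> involves \<open>w\<close> only,
  so \<open>Q\<close> may enter the exponent of associativity.\<close>

lemma Lf_letter:
  assumes U: "wt_in {..U} x" and V: "wt_in {..V} v" and W: "wt_in {..W} w"
    and P: "V \<le> 2 * int P" and Q: "W \<le> 2 * int Q" and J: "V + W + 2 * b < 2 * int J"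
    and N: "U + V + W + 2 * (a + b) < 2 * int N" "V + W + 2 * b \<le> 2 * int N" "P + J \<le> N" "Q \<le> N"
  shows "Lf (monomial [(h, m)] * x) v w a b =
     (\<Sum>k<N. cplus m k *\<^sub>F (monomial [(h, k + m)] * tbp k (Lf x v w) a b)) +
     (\<Sum>l<P. cminus m l *\<^sub>F Lf (par x) (con h l v) w (a + int (l + m + 1)) b) +
     (\<Sum>i<Q. cminus m i *\<^sub>F
        Tr (\<lambda>c b. Y0 (par x) (c + int (i + m + 1)) (Y0 (par v) b (con h i w))) a b)"
proof -
  have z: "Y0 v' (b - int j) w' = 0" if "J \<le> j" "wt_in {..V} v'" "wt_in {..W} w'" for j v' w'
  proof (rule Y0_eq_0[OF that(2,3)])
    have "int J \<le> int j" using that(1) by simp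
    then show "V + W + 2 * (b - int j) < 0" using J by presburger
  qed
  let ?g = "\<lambda>j. (of_int (a + int j) gchoose j :: complex)"
  let ?A = "\<lambda>k. \<Sum>j<J. ?g j *\<^sub>F Y0 x (a + int j - int k) (Y0 v (b - int j) w)"
  let ?G = "\<lambda>l c b. Y0 (par x) c (Y0 (con h l v) b w)"
  \<comment> \<open>\<open>?t1\<close> creates, \<open>?t2\<close> contracts with \<open>v\<close>,
    \<open>?t3\<close> contracts with \<open>w\<close>.\<close>
  have step: "Y0 (monomial [(h, m)] * x) (a + int j) (Y0 v (b - int j) w) =
      (\<Sum>k<N. cplus m k *\<^sub>F (monomial [(h, k + m)] * Y0 x (a + int j - int k) (Y0 v (b - int j) w))) +
      (\<Sum>l<P. \<Sum>i<J. (cminus m l * of_nat (l + m + i choose i)) *\<^sub>F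
          ?G l (a + int (l + m) + 1 + int j + int i) (b - int j - int i)) +
      (\<Sum>i<Q. cminus m i *\<^sub>F Y0 (par x) (a + int j + int (i + m + 1)) (Y0 (par v) (b - int j) (con h i w)))"
    (is "_ = ?t1 + ?t2 + ?t3") for j
  proof -
    have "Y0 (monomial [(h, m)] * x) (a + int j) (Y0 v (b - int j) w) = ?t1 +
       (\<Sum>i<N. cminus m i *\<^sub>F Y0 (par x) (a + int j + int i + int m + 1) (con h i (Y0 v (b - int j) w)))"
      using N by (intro Y0_letter[OF U wt_in_Y0[OF V W]]) simp_all
    also have "(\<Sum>i<N. cminus m i *\<^sub>F Y0 (par x) (a + int j + int i + int m + 1) (con h i (Y0 v (b - int j) w))) =
       (\<Sum>i<N. \<Sum>l\<le>i. (cminus m i * of_nat (i choose l)) *\<^sub>F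
            ?G l (a + int j + int i + int m + 1) (b - int j - int (i - l))) +
       (\<Sum>i<N. cminus m i *\<^sub>F Y0 (par x) (a + int j + int (i + m + 1)) (Y0 (par v) (b - int j) (con h i w)))"
      by (simp add: con_Y0 fscale_add_right fscale_sum_right sum.distrib algebra_simps)
    also have "(\<Sum>i<N. \<Sum>l\<le>i. (cminus m i * of_nat (i choose l)) *\<^sub>F
            ?G l (a + int j + int i + int m + 1) (b - int j - int (i - l))) = ?t2"
    proof -
      define f where "f l i = (cminus m (l + i) * of_nat (l + i choose l)) *\<^sub>F
            ?G l (a + int j + int (l + i) + int m + 1) (b - int j - int i)" for l i
      have "(\<Sum>i<N. \<Sum>l\<le>i. (cminus m i * of_nat (i choose l)) *\<^sub>F
            ?G l (a + int j + int i + int m + 1) (b - int j - int (i - l))) =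
          (\<Sum>i<N. \<Sum>l\<le>i. f l (i - l))"
        by (intro sum.cong refl) (simp add: f_def)
      \<comment> \<open>\<open>P + J \<le> N\<close> puts the box inside the triangle. Outside the
        box the contraction of \<open>v\<close> or the coefficient in \<open>x2\<close>
        vanishes.\<close>
      also have "\<dots> = (\<Sum>l<P. \<Sum>i<J. f l i)"
      proof (rule sum_box_eq_triangle)
        fix l i assume li: "(l < P \<and> i < J) \<noteq> (l + i < N)"
        then have "P \<le> l \<or> J \<le> i" using N(3) by auto
        then show "f l i = 0"
        proof
          assume "P \<le> l"
          then have "int P \<le> int l" by simp
          then have "con h l v = 0" using P by (intro con_eq_0[OF V]) presburger
          then show ?thesis by (simp add: f_def)
        next
          assume "J \<le> i"
          then have "Y0 (con h l v) (b - int (j + i)) w = 0"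
            by (intro z wt_in_con_le V W) simp
          then show ?thesis by (simp add: f_def algebra_simps)
        qed
      qed
      also have "\<dots> = ?t2"
        unfolding f_def cminus_choose by (simp add: algebra_simps)
      finally show ?thesis .
    qed
    also have "(\<Sum>i<N. cminus m i *\<^sub>F Y0 (par x) (a + int j + int (i + m + 1)) (Y0 (par v) (b - int j) (con h i w))) = ?t3"
    proof (rule sum_lessThan_mono_neutral[OF N(4)])
      fix i assume "Q \<le> i"
      then have "int Q \<le> int i" by simp
      then have "con h i w = 0" using Q by (intro con_eq_0[OF W]) presburger
      then show "cminus m i *\<^sub>F Y0 (par x) (a + int j + int (i + m + 1)) (Y0 (par v) (b - int j) (con h i w)) = 0"
        by simp
    qed
    finally show ?thesis by (simp only: add.assoc)
  qed
  have A: "?A k = tbp k (Lf x v w) a b" for k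
    unfolding Tr_Y0_shift[symmetric] by (rule Tr_finite[symmetric]) (simp add: z V W)
  \<comment> \<open>The double sum is the substituted expansion of
    \<open>(x1 - x2)^(-l-m-1)\<close>. It collapses to \<open>x0^(-l-m-1)\<close>, visible as the
    shift of \<open>a\<close> by \<open>l + m + 1\<close>.\<close>
  have B: "(\<Sum>j<J. \<Sum>i<J. (?g j * of_nat (l + m + i choose i)) *\<^sub>F
        ?G l (a + int (l + m) + 1 + int j + int i) (b - int j - int i)) =
      Lf (par x) (con h l v) w (a + int (l + m + 1)) b" for l
  proof -
    have e: "a + int (l + m + 1) = a + int (l + m) + 1" by simp
    show ?thesis unfolding Lf_def e
      by (rule Tr_geometric) (simp add: z V W wt_in_con_le)
  qed
  have C: "(\<Sum>j<J. ?g j *\<^sub>F Y0 (par x) (a + int j + int (i + m + 1)) (Y0 (par v) (b - int j) (con h i w))) =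
      Tr (\<lambda>c b. Y0 (par x) (c + int (i + m + 1)) (Y0 (par v) b (con h i w))) a b" for i
    by (rule Tr_finite[symmetric]) (simp add: z V W wt_in_con_le wt_in_par)
  have "Lf (monomial [(h, m)] * x) v w a b =
      (\<Sum>j<J. ?g j *\<^sub>F Y0 (monomial [(h, m)] * x) (a + int j) (Y0 v (b - int j) w))"
    unfolding Lf_def by (rule Tr_finite) (simp add: z V W)
  also have "\<dots> = (\<Sum>j<J. \<Sum>k<N. ?g j *\<^sub>F cplus m k *\<^sub>F
          (monomial [(h, k + m)] * Y0 x (a + int j - int k) (Y0 v (b - int j) w))) +
      (\<Sum>j<J. \<Sum>l<P. \<Sum>i<J. ?g j *\<^sub>F (cminus m l * of_nat (l + m + i choose i)) *\<^sub>F
          ?G l (a + int (l + m) + 1 + int j + int i) (b - int j - int i)) +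
      (\<Sum>j<J. \<Sum>i<Q. ?g j *\<^sub>F cminus m i *\<^sub>F
          Y0 (par x) (a + int j + int (i + m + 1)) (Y0 (par v) (b - int j) (con h i w)))"
    unfolding step by (simp only: fscale_add_right fscale_sum_right sum.distrib)
  also have "(\<Sum>j<J. \<Sum>k<N. ?g j *\<^sub>F cplus m k *\<^sub>F
          (monomial [(h, k + m)] * Y0 x (a + int j - int k) (Y0 v (b - int j) w))) =
      (\<Sum>k<N. cplus m k *\<^sub>F (monomial [(h, k + m)] * ?A k))"
    by (subst sum.swap) (simp add: sum_distrib_left fscale_sum_right mult.commute)
  also have "(\<Sum>j<J. \<Sum>l<P. \<Sum>i<J. ?g j *\<^sub>F (cminus m l * of_nat (l + m + i choose i)) *\<^sub>F
          ?G l (a + int (l + m) + 1 + int j + int i) (b - int j - int i)) =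
      (\<Sum>l<P. cminus m l *\<^sub>F (\<Sum>j<J. \<Sum>i<J. (?g j * of_nat (l + m + i choose i)) *\<^sub>F
        ?G l (a + int (l + m) + 1 + int j + int i) (b - int j - int i)))"
    by (subst sum.swap) (simp add: fscale_sum_right mult.left_commute)
  also have "(\<Sum>j<J. \<Sum>i<Q. ?g j *\<^sub>F cminus m i *\<^sub>F
          Y0 (par x) (a + int j + int (i + m + 1)) (Y0 (par v) (b - int j) (con h i w))) =
      (\<Sum>i<Q. cminus m i *\<^sub>F (\<Sum>j<J. ?g j *\<^sub>F
          Y0 (par x) (a + int j + int (i + m + 1)) (Y0 (par v) (b - int j) (con h i w))))"
    by (subst sum.swap) (simp add: fscale_sum_right mult.commute)
  finally show ?thesis unfolding A B C .
qed

text \<open>Here the first letter meets \<open>v\<close> at once, in the variable \<open>x0\<close>,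
  and its creation part then acts as a vertex operator on \<open>w\<close>. The pole in
  \<open>x0 + x2\<close> thus arises expanded in \<open>x0\<close>, whence \<open>Iv\<close> in the
  last sum.\<close>

lemma Rf_letter:
  assumes U: "wt_in {..U} x" and V: "wt_in {..V} v" and W: "wt_in {..W} w"
    and P: "V \<le> 2 * int P" and Q: "W \<le> 2 * int Q"
    and N: "U + V + W + 2 * (a + b) < 2 * int N" "U + V + 2 * a < 2 * int N" "P \<le> N" "Q \<le> N"
  shows "Rf (monomial [(h, m)] * x) v w a b =
     (\<Sum>k<N. cplus m k *\<^sub>F (monomial [(h, k + m)] * tbp k (Rf x v w) a b)) +
     (\<Sum>l<P. cminus m l *\<^sub>F Rf (par x) (con h l v) w (a + int (l + m + 1)) b) +
     (\<Sum>i<Q. cminus m i *\<^sub>F Iv (i + m + 1) (Rf (par x) (par v) (con h i w)) a b)"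
proof -
  have WN: "W \<le> 2 * int N" using Q N(4) by presburger
  have VN: "V \<le> 2 * int N" using P N(3) by presburger
  have "Y0 (monomial [(h, m)] * x) a v =
     (\<Sum>k<N. cplus m k *\<^sub>F (monomial [(h, k + m)] * Y0 x (a - int k) v)) +
     (\<Sum>l<N. cminus m l *\<^sub>F Y0 (par x) (a + int l + int m + 1) (con h l v))"
    by (rule Y0_letter[OF U V N(2) VN])
  also have "(\<Sum>l<N. cminus m l *\<^sub>F Y0 (par x) (a + int l + int m + 1) (con h l v)) =
      (\<Sum>l<P. cminus m l *\<^sub>F Y0 (par x) (a + int (l + m + 1)) (con h l v))"
  proof (subst sum_lessThan_mono_neutral[OF N(3)])
    fix l assume "P \<le> l"
    then have "int P \<le> int l" by simp
    then have "con h l v = 0" using P by (intro con_eq_0[OF V]) presburger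
    then show "cminus m l *\<^sub>F Y0 (par x) (a + int l + int m + 1) (con h l v) = 0" by simp
  qed (simp add: algebra_simps)
  finally have "Rf (monomial [(h, m)] * x) v w a b =
     (\<Sum>k<N. cplus m k *\<^sub>F Y0 (monomial [(h, k + m)] * Y0 x (a - int k) v) b w) +
     (\<Sum>l<P. cminus m l *\<^sub>F Rf (par x) (con h l v) w (a + int (l + m + 1)) b)"
    by (simp add: Rf_def)
  also have "(\<Sum>k<N. cplus m k *\<^sub>F Y0 (monomial [(h, k + m)] * Y0 x (a - int k) v) b w) =
     (\<Sum>k<N. cplus m k *\<^sub>F (\<Sum>i<N. cplus (k + m) i *\<^sub>F
         (monomial [(h, i + (k + m))] * Rf x v w (a - int k) (b - int i)))) +
     (\<Sum>k<N. cplus m k *\<^sub>F (\<Sum>i<Q. cminus (k + m) i *\<^sub>F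
         Rf (par x) (par v) (con h i w) (a - int k) (b + int (i + m + 1) + int k)))"
  proof -
    have "Y0 (monomial [(h, k + m)] * Y0 x (a - int k) v) b w =
      (\<Sum>i<N. cplus (k + m) i *\<^sub>F (monomial [(h, i + (k + m))] * Rf x v w (a - int k) (b - int i))) +
      (\<Sum>i<Q. cminus (k + m) i *\<^sub>F
         Rf (par x) (par v) (con h i w) (a - int k) (b + int (i + m + 1) + int k))" for k
    proof -
      \<comment> \<open>The parity of the inner vector \<open>Y(x, x0) v\<close> is distributed over
        \<open>x\<close> and \<open>v\<close> by \<open>Y0_par\<close>.\<close>
      have "Y0 (monomial [(h, k + m)] * Y0 x (a - int k) v) b w =
        (\<Sum>i<N. cplus (k + m) i *\<^sub>F (monomial [(h, i + (k + m))] * Rf x v w (a - int k) (b - int i))) +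
        (\<Sum>i<N. cminus (k + m) i *\<^sub>F
           Rf (par x) (par v) (con h i w) (a - int k) (b + int (i + m + 1) + int k))"
        using Y0_letter[OF wt_in_Y0[OF U V, of "a - int k"] W _ WN, of b h "k + m"] N(1)
        by (simp add: Rf_def Y0_par algebra_simps)
      also have "(\<Sum>i<N. cminus (k + m) i *\<^sub>F
           Rf (par x) (par v) (con h i w) (a - int k) (b + int (i + m + 1) + int k)) =
         (\<Sum>i<Q. cminus (k + m) i *\<^sub>F
           Rf (par x) (par v) (con h i w) (a - int k) (b + int (i + m + 1) + int k))"
      proof (rule sum_lessThan_mono_neutral[OF N(4)])
        fix i assume "Q \<le> i"
        then have "int Q \<le> int i" by simp
        then have "con h i w = 0" using Q by (intro con_eq_0[OF W]) presburger
        then show "cminus (k + m) i *\<^sub>F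
           Rf (par x) (par v) (con h i w) (a - int k) (b + int (i + m + 1) + int k) = 0"
          by (simp add: Rf_def)
      qed
      finally show ?thesis .
    qed
    then show ?thesis by (simp only: fscale_add_right sum.distrib)
  qed
  also have "(\<Sum>k<N. cplus m k *\<^sub>F (\<Sum>i<N. cplus (k + m) i *\<^sub>F
         (monomial [(h, i + (k + m))] * Rf x v w (a - int k) (b - int i)))) =
     (\<Sum>k<N. cplus m k *\<^sub>F (monomial [(h, k + m)] * tbp k (Rf x v w) a b))"
  proof -
    define f where "f i k = (cplus m (k + i) * of_nat (k + i choose i)) *\<^sub>F
         (monomial [(h, k + i + m)] * Rf x v w (a - int k) (b - int i))" for k i
    have "(\<Sum>k<N. cplus m k *\<^sub>F (\<Sum>i<N. cplus (k + m) i *\<^sub>F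
         (monomial [(h, i + (k + m))] * Rf x v w (a - int k) (b - int i)))) = (\<Sum>k<N. \<Sum>i<N. f i k)"
      by (simp add: fscale_sum_right cplus_cplus f_def algebra_simps)
    also have "\<dots> = (\<Sum>i<N. \<Sum>k<N. f i k)" by (rule sum.swap)
    \<comment> \<open>Collecting the terms of total degree \<open>n\<close> produces
      \<open>(x0 + x2)^n\<close>, that is \<open>tbp n\<close>; the remainder of the square vanishes
      by weight.\<close>
    also have "\<dots> = (\<Sum>n<N. \<Sum>i\<le>n. f i (n - i))"
    proof (rule sum_box_eq_triangle[symmetric])
      fix i k assume "(i < N \<and> k < N) \<noteq> (i + k < N)"
      then have "int N \<le> int i + int k" by auto
      then have "Rf x v w (a - int k) (b - int i) = 0" unfolding Rf_def
        using N(1) by (intro Y0_eq_0[OF wt_in_Y0[OF U V] W]) presburger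
      then show "f i k = 0" by (simp add: f_def)
    qed
    also have "\<dots> = (\<Sum>k<N. cplus m k *\<^sub>F (monomial [(h, k + m)] * tbp k (Rf x v w) a b))"
      by (intro sum.cong refl)
         (simp add: f_def tbp_def fscale_sum_right sum_distrib_left)
    finally show ?thesis .
  qed
  also have "(\<Sum>k<N. cplus m k *\<^sub>F (\<Sum>i<Q. cminus (k + m) i *\<^sub>F
         Rf (par x) (par v) (con h i w) (a - int k) (b + int (i + m + 1) + int k))) =
     (\<Sum>i<Q. cminus m i *\<^sub>F Iv (i + m + 1) (Rf (par x) (par v) (con h i w)) a b)"
  proof -
    have "Iv (i + m + 1) (Rf (par x) (par v) (con h i w)) a b =
       (\<Sum>k<N. (of_int (- int (i + m + 1)) gchoose k) *\<^sub>F
          Rf (par x) (par v) (con h i w) (a - int k) (b + int (i + m + 1) + int k))" for i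
    proof (rule Iv_finite)
      fix k b assume "N \<le> k"
      then have "int N \<le> int k" by simp
      then have "Y0 (par x) (a - int k) (par v) = 0"
        using N(2) by (intro Y0_eq_0[OF wt_in_par[OF U] wt_in_par[OF V]]) presburger
      then show "Rf (par x) (par v) (con h i w) (a - int k) b = 0" by (simp add: Rf_def)
    qed
    then show ?thesis
      by (simp only: fscale_sum_right fscale_fscale cplus_cminus flip: mult.assoc, subst sum.swap)
         (simp only:)
  qed
  finally show ?thesis by (simp only: ac_simps)
qed

text \<open>The exponent is chosen before \<open>v\<close>. The induction therefore uses each
  hypothesis for all \<open>v\<close> at once, in particular for the contractions of
  \<open>v\<close>, and varies \<open>w\<close> only over its finitely many nonzero
  contractions.\<close>

lemma weak_associativity_words: "\<exists>p. \<forall>v. tbp p (Lf u v w) = tbp p (Rf u v w)"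
proof (induction u arbitrary: w rule: free_alg_par_induct)
  case zero
  show ?case by (rule exI[of _ 0]) (simp add: Lf_def Rf_def Tr_def fun_eq_iff)
next
  case one
  have "Lf 1 v w a b = Rf 1 v w a b" for v a b
  proof -
    \<comment> \<open>The identity series contributes only at \<open>a + j = 0\<close>, and there
      \<open>0 gchoose j\<close> leaves only \<open>j = 0\<close>.\<close>
    have "Lf 1 v w a b = Sum_any (\<lambda>j. (if a = 0 then Y0 v b w else 0) when j = nat (- a))"
      unfolding Lf_def Tr_def
      by (intro arg_cong[where f = Sum_any] ext)
         (auto simp: Y0_one when_def gbinomial_0_left nat_eq_iff)
    then show ?thesis by (simp add: Rf_def Y0_one)
  qed
  then show ?case by (intro exI[of _ 0]) (simp add: fun_eq_iff)
next
  case (letter l x)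
  obtain h m where l: "l = (h, m)" by (cases l)
  obtain U where U: "wt_in {..U} x" using wt_in_bound[of x] by blast
  obtain W where W: "wt_in {..W} w" using wt_in_bound[of w] by blast
  define Q where "Q = nat W"
  have Q: "W \<le> 2 * int Q" by (simp add: Q_def)
  obtain p1 where p1: "\<forall>v. tbp p1 (Lf x v w) = tbp p1 (Rf x v w)" using letter(1) by blast
  obtain p2 where p2: "\<forall>v. tbp p2 (Lf (par x) v w) = tbp p2 (Rf (par x) v w)" using letter(2) by blast
  have "\<forall>i. \<exists>p. \<forall>v. tbp p (Lf (par x) v (con h i w)) = tbp p (Rf (par x) v (con h i w))"
    using letter(2) by blast
  from choice[OF this] obtain p3 where
    "\<forall>i v. tbp (p3 i) (Lf (par x) v (con h i w)) = tbp (p3 i) (Rf (par x) v (con h i w))" by blast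
  then have p3: "tbp (p3 i) (Lf (par x) v (con h i w)) = tbp (p3 i) (Rf (par x) v (con h i w))" for i v
    by blast
  \<comment> \<open>A common upper bound: \<open>p1\<close> for the creation terms,
    \<open>p2\<close> for the contractions with \<open>v\<close>, and for each contraction
    \<open>i\<close> with \<open>w\<close> the hypothesis \<open>p3 i\<close> together with the
    order \<open>i + m + 1\<close> of its pole.\<close>
  define p where "p = p1 + p2 + (\<Sum>i<Q. p3 i + (i + m + 1))"
  have p12: "p1 \<le> p" "p2 \<le> p" by (simp_all add: p_def)
  have p3': "p3 i + (i + m + 1) \<le> p" if "i < Q" for i
    using member_le_sum[of i "{..<Q}" "\<lambda>i. p3 i + (i + m + 1)"] that by (simp add: p_def)
  have "tbp p (Lf (monomial [l] * x) v w) a b = tbp p (Rf (monomial [l] * x) v w) a b" for v a b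
  proof -
    obtain V where V: "wt_in {..V} v" using wt_in_bound[of v] by blast
    define P where "P = nat V"
    have P: "V \<le> 2 * int P" by (simp add: P_def)
    obtain J where J: "V + W + 2 * b < 2 * int J" using ex_nat_large by blast
    obtain N1 where N1: "U + V + W + 2 * (a + b) < 2 * int N1" "V + W + 2 * b \<le> 2 * int N1" "P + J + Q < N1"
      using ex_nat_large by blast
    obtain N2 where N2: "U + V + 2 * a < 2 * int N2" using ex_nat_large by blast
    define N where "N = N1 + N2"
    have N: "U + V + W + 2 * (a + b) < 2 * int N" "V + W + 2 * b \<le> 2 * int N" "P + J \<le> N" "Q \<le> N" "P \<le> N"
      "U + V + 2 * a < 2 * int N"
      using N1 N2 by (simp_all add: N_def)
    let ?A = "\<lambda>F a b. \<Sum>k<N. cplus m k *\<^sub>F (monomial [(h, k + m)] * tbp k F a b)"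
    let ?B = "\<lambda>F a b. \<Sum>l<P. cminus m l *\<^sub>F F l (a + int (l + m + 1)) b"
    let ?C = "\<lambda>F a b. \<Sum>i<Q. cminus m i *\<^sub>F F i a b"
    let ?F = "\<lambda>i. Tr (\<lambda>c b. Y0 (par x) (c + int (i + m + 1)) (Y0 (par v) b (con h i w)))"
    let ?G = "\<lambda>i. Iv (i + m + 1) (Rf (par x) (par v) (con h i w))"
    have A: "tbp p (?A F) a b = ?A (tbp p F) a b" for F
      by (simp only: tbp_sum tbp_scale tbp_mult tbp_tbp add.commute)
    have B: "tbp p (?B F) a b = ?B (\<lambda>l. tbp p (F l)) a b" for F
      by (simp only: tbp_sum tbp_scale tbp_shift)
    have C: "tbp p (?C F) a b = ?C (\<lambda>i. tbp p (F i)) a b" for F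
      by (simp only: tbp_sum tbp_scale)
    have L: "tbp p (Lf (monomial [l] * x) v w) a b =
        tbp p (\<lambda>a b. ?A (Lf x v w) a b + ?B (\<lambda>l. Lf (par x) (con h l v) w) a b + ?C ?F a b) a b"
      unfolding l
      by (rule tbp_cong, rule Lf_letter[OF U V W P Q, where J = J]) (use J N in presburger)+
    have R: "tbp p (Rf (monomial [l] * x) v w) a b =
        tbp p (\<lambda>a b. ?A (Rf x v w) a b + ?B (\<lambda>l. Rf (par x) (con h l v) w) a b + ?C ?G a b) a b"
      unfolding l
      by (rule tbp_cong, rule Rf_letter[OF U V W P Q]) (use N in presburger)+
    have 1: "tbp p (Lf x v w) = tbp p (Rf x v w)"
      using p1 p12(1) tbp_eq_mono by blast
    have 2: "tbp p (Lf (par x) v w) = tbp p (Rf (par x) v w)" for v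
      using p2 p12(2) tbp_eq_mono by blast
    \<comment> \<open>Cancelling the pole first makes the two expansions ordinary instances of
      \<open>Lf\<close> and \<open>Rf\<close>, to which the hypothesis for \<open>con h i w\<close>
      applies.\<close>
    have 3: "tbp p (?F i) = tbp p (?G i)" if "i < Q" for i
    proof -
      have "tbp (i + m + 1) (?F i) = Lf (par x) (par v) (con h i w)"
        by (rule tbp_Tr_Y0)
      then have F: "tbp (p3 i + (i + m + 1)) (?F i) = tbp (p3 i) (Rf (par x) (par v) (con h i w))"
        by (simp only: p3 flip: tbp_tbp)
      have "tbp (i + m + 1) (?G i) = Rf (par x) (par v) (con h i w)"
      proof (rule tbp_Iv)
        fix a b assume "a < - \<bar>U + V\<bar>"
        then have "Y0 (par x) a (par v) = 0"
          by (intro Y0_eq_0[OF wt_in_par[OF U] wt_in_par[OF V]]) simp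
        then show "Rf (par x) (par v) (con h i w) a b = 0" by (simp add: Rf_def)
      qed
      then have "tbp (p3 i + (i + m + 1)) (?G i) = tbp (p3 i) (Rf (par x) (par v) (con h i w))"
        by (simp only: flip: tbp_tbp)
      with F show ?thesis by (intro tbp_eq_mono[OF _ p3'[OF that]]) (simp only:)
    qed
    show ?thesis
      unfolding L R tbp_add A C 1 B[of "\<lambda>l. Lf (par x) (con h l v) w"] B[of "\<lambda>l. Rf (par x) (con h l v) w"] 2
      using 3 by simp
  qed
  then show ?case by (intro exI[of _ p]) (simp add: fun_eq_iff)
next
  case (add x y)
  obtain p where p: "\<forall>v. tbp p (Lf x v w) = tbp p (Rf x v w)" using add(1) by blast
  obtain q where q: "\<forall>v. tbp q (Lf y v w) = tbp q (Rf y v w)" using add(2) by blast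
  have "Lf (x + y) v w a b = Lf x v w a b + Lf y v w a b" for v a b
  proof -
    obtain J where "\<forall>u. Lf u v w a b =
        (\<Sum>j<J. (of_int (a + int j) gchoose j) *\<^sub>F Y0 u (a + int j) (Y0 v (b - int j) w))"
      using Lf_expand by blast
    then show ?thesis by (simp add: fscale_add_right sum.distrib)
  qed
  then have "Lf (x + y) v w = (\<lambda>a b. Lf x v w a b + Lf y v w a b)" for v
    by (intro ext)
  then have L: "tbp r (Lf (x + y) v w) a b = tbp r (Lf x v w) a b + tbp r (Lf y v w) a b" for r v a b
    by (simp only: tbp_add)
  have R: "tbp r (Rf (x + y) v w) a b = tbp r (Rf x v w) a b + tbp r (Rf y v w) a b" for r v a b
    by (simp add: Rf_def flip: tbp_add)
  have "tbp (p + q) (Lf x v w) = tbp (p + q) (Rf x v w)" "tbp (p + q) (Lf y v w) = tbp (p + q) (Rf y v w)" for v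
    by (rule tbp_eq_mono[of p], use p in simp_all, rule tbp_eq_mono[of q], use q in simp_all)
  then show ?case by (intro exI[of _ "p + q"]) (simp add: fun_eq_iff L R)
next
  case (scale c x)
  then obtain p where p: "\<forall>v. tbp p (Lf x v w) = tbp p (Rf x v w)" by blast
  have "Lf (c *\<^sub>F x) v w a b = c *\<^sub>F Lf x v w a b" for v a b
  proof -
    obtain J where "\<forall>u. Lf u v w a b =
        (\<Sum>j<J. (of_int (a + int j) gchoose j) *\<^sub>F Y0 u (a + int j) (Y0 v (b - int j) w))"
      using Lf_expand by blast
    then show ?thesis by (simp add: fscale_sum_right mult.commute)
  qed
  then have "Lf (c *\<^sub>F x) v w = (\<lambda>a b. c *\<^sub>F Lf x v w a b)" for v
    by (intro ext)
  then have L: "tbp r (Lf (c *\<^sub>F x) v w) a b = c *\<^sub>F tbp r (Lf x v w) a b" for r v a b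
    by (simp only: tbp_scale)
  have R: "tbp r (Rf (c *\<^sub>F x) v w) a b = c *\<^sub>F tbp r (Rf x v w) a b" for r v a b
    by (simp add: Rf_def flip: tbp_scale)
  show ?case using p by (intro exI[of _ p]) (simp add: fun_eq_iff L R)
qed

end

subsection \<open>The space \<open>V\<close> as a quotient of a free algebra\<close>

lemma ring_free_algebra: "ring (ring_of_type_algebra :: 'a::ring_1 ring)"
proof -
  have "\<exists>y. x + y = 0" for x :: 'a
    using add.right_inverse by blast
  then show ?thesis
    unfolding ring_of_type_algebra_def using add.right_inverse
    by unfold_locales (auto simp: algebra_simps Units_def)
qed

lemma free_algebra_simps [simp]:
  "carrier (ring_of_type_algebra :: 'a::ring_1 ring) = UNIV"
  "x \<otimes>\<^bsub>(ring_of_type_algebra :: 'a::ring_1 ring)\<^esub> y = x * y"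
  "x \<oplus>\<^bsub>(ring_of_type_algebra :: 'a::ring_1 ring)\<^esub> y = x + y"
  "\<one>\<^bsub>(ring_of_type_algebra :: 'a::ring_1 ring)\<^esub> = 1"
  "\<zero>\<^bsub>(ring_of_type_algebra :: 'a::ring_1 ring)\<^esub> = 0"
  by (simp_all add: ring_of_type_algebra_def)

lemma free_algebra_minus [simp]:
  "\<ominus>\<^bsub>(ring_of_type_algebra :: 'a::ring_1 ring)\<^esub> x = - x"
  "x \<ominus>\<^bsub>(ring_of_type_algebra :: 'a::ring_1 ring)\<^esub> y = x - y"
proof -
  interpret R: ring "ring_of_type_algebra :: 'a ring" by (rule ring_free_algebra)
  show 1: "\<ominus>\<^bsub>(ring_of_type_algebra :: 'a ring)\<^esub> x = - x" for x
    by (rule R.minus_equality) simp_all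
  show "x \<ominus>\<^bsub>(ring_of_type_algebra :: 'a ring)\<^esub> y = x - y"
    by (simp add: a_minus_def 1)
qed

sublocale polarized_space \<subseteq> contraction form .

context polarized_space
begin

abbreviation "FA \<equiv> (free_algebra :: 'h hhat free_alg ring)"
abbreviation "TA \<equiv> tensor_algebra (hhat_scale scale)"
abbreviation "NA \<equiv> N_algebra scale form"
abbreviation "VA \<equiv> V_module scale form"
abbreviation "tt \<equiv> to_tensor (hhat_scale scale)"
abbreviation "nn \<equiv> to_N scale form"
abbreviation "Vrel \<equiv> V_relations scale form"

lemma tensor_ideal_ideal: "ideal (tensor_ideal (hhat_scale scale)) FA"
  unfolding tensor_ideal_def by (rule ring.genideal_ideal[OF ring_free_algebra]) simp

lemma ring_TA: "ring TA"
  unfolding tensor_algebra_def by (rule ideal.quotient_is_ring[OF tensor_ideal_ideal])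

sublocale TA: ring TA by (rule ring_TA)

lemma tt_hom: "tt \<in> ring_hom FA TA"
proof -
  have "tt = (+>\<^bsub>FA\<^esub>) (tensor_ideal (hhat_scale scale))"
    by (simp add: to_tensor_def fun_eq_iff)
  then show ?thesis
    unfolding tensor_algebra_def using ideal.rcos_ring_hom[OF tensor_ideal_ideal] by simp
qed

lemma carrier_TA: "carrier TA = range tt"
  by (auto simp: tensor_algebra_def FactRing_def A_RCOSETS_def' to_tensor_def)

lemma tt_closed [simp]: "tt x \<in> carrier TA"
  by (simp add: carrier_TA)

lemma tt_simps:
  "tt (x + y) = tt x \<oplus>\<^bsub>TA\<^esub> tt y" "tt (x * y) = tt x \<otimes>\<^bsub>TA\<^esub> tt y" "tt 1 = \<one>\<^bsub>TA\<^esub>"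
  using ring_hom_add[OF tt_hom] ring_hom_mult[OF tt_hom] ring_hom_one[OF tt_hom] by simp_all

lemma tt_zero: "tt 0 = \<zero>\<^bsub>TA\<^esub>"
  using ring_hom_zero[OF tt_hom ring_free_algebra ring_TA] by simp

lemma tt_minus: "tt (- x) = \<ominus>\<^bsub>TA\<^esub> tt x"
  by (rule TA.minus_equality[symmetric]) (simp_all flip: tt_simps(1) add: tt_zero)

lemma tt_diff: "tt (x - y) = tt x \<ominus>\<^bsub>TA\<^esub> tt y"
  using tt_simps(1)[of x "- y"] by (simp add: tt_minus a_minus_def)

lemma tt_eq_iff: "tt x = tt y \<longleftrightarrow> x - y \<in> tensor_ideal (hhat_scale scale)"
  using ring.quotient_eq_iff_same_a_r_cos[OF ring_free_algebra tensor_ideal_ideal, of x y]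
  by (auto simp: to_tensor_def)

lemma N_ideal_ideal: "ideal (N_ideal scale form) TA"
  unfolding N_ideal_def Let_def
  by (rule TA.genideal_ideal) (auto intro!: TA.minus_closed)

lemma ring_NA: "ring NA"
  unfolding N_algebra_def by (rule ideal.quotient_is_ring[OF N_ideal_ideal])

sublocale NA: ring NA by (rule ring_NA)

lemma nn_hom: "nn \<in> ring_hom FA NA"
proof -
  have "nn = (+>\<^bsub>TA\<^esub>) (N_ideal scale form) \<circ> tt"
    by (simp add: to_N_def fun_eq_iff)
  then show ?thesis
    unfolding N_algebra_def using ring_hom_trans[OF tt_hom ideal.rcos_ring_hom[OF N_ideal_ideal]] by simp
qed

lemma carrier_NA: "carrier NA = range nn"
  by (auto simp: N_algebra_def FactRing_def A_RCOSETS_def' to_N_def carrier_TA)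

lemma nn_closed [simp]: "nn x \<in> carrier NA"
  by (simp add: carrier_NA)

lemma nn_simps:
  "nn (x + y) = nn x \<oplus>\<^bsub>NA\<^esub> nn y" "nn (x * y) = nn x \<otimes>\<^bsub>NA\<^esub> nn y" "nn 1 = \<one>\<^bsub>NA\<^esub>"
  using ring_hom_add[OF nn_hom] ring_hom_mult[OF nn_hom] ring_hom_one[OF nn_hom] by simp_all

lemma nn_zero: "nn 0 = \<zero>\<^bsub>NA\<^esub>"
  using ring_hom_zero[OF nn_hom ring_free_algebra ring_NA] by simp

lemma nn_minus: "nn (- x) = \<ominus>\<^bsub>NA\<^esub> nn x"
  by (rule NA.minus_equality[symmetric]) (simp_all flip: nn_simps(1) add: nn_zero)

lemma nn_diff: "nn (x - y) = nn x \<ominus>\<^bsub>NA\<^esub> nn y"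
  using nn_simps(1)[of x "- y"] by (simp add: nn_minus a_minus_def)

lemma nn_eq_iff: "nn x = nn y \<longleftrightarrow> tt (x - y) \<in> N_ideal scale form"
  using ring.quotient_eq_iff_same_a_r_cos[OF ring_TA N_ideal_ideal, of "tt x" "tt y"]
  by (auto simp: to_N_def tt_diff)

lemma nn_eqI: "tt x = tt y \<Longrightarrow> nn x = nn y"
  by (simp add: to_N_def)

lemma tensor_ideal_gens:
  "{monomial [u + v] - monomial [u] - monomial [v] |u v. True} \<union>
   {monomial [hhat_scale scale c u] - scalar_elt c * monomial [u] |c u. True}
   \<subseteq> tensor_ideal (hhat_scale scale)"
  unfolding tensor_ideal_def by (rule ring.genideal_self[OF ring_free_algebra]) simp

lemma nn_letter_add: "nn (monomial [u + v]) = nn (monomial [u] + monomial [v])"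
  by (rule nn_eqI) (unfold tt_eq_iff diff_diff_eq[symmetric], rule subsetD[OF tensor_ideal_gens], blast)

lemma nn_letter_scale: "nn (monomial [hhat_scale scale c u]) = nn (c *\<^sub>F monomial [u])"
  by (rule nn_eqI) (unfold tt_eq_iff fscale_def, rule subsetD[OF tensor_ideal_gens], blast)

lemma nn_anticommute:
  assumes "0 \<le> m" "n \<le> -1"
  shows "nn (monomial [hmode a m] * monomial [hmode b n] + monomial [hmode b n] * monomial [hmode a m]) =
    nn (monomial [hcentral (if m + n + 1 = 0 then form a b else 0)])"
  unfolding nn_eq_iff tt_diff tt_simps N_ideal_def Let_def
  by (rule subsetD[OF TA.genideal_self]) (use assms in \<open>auto intro!: TA.minus_closed\<close>)

lemma nn_central_commute:
  "nn (monomial [hmode a k] * monomial [hcentral 1]) = nn (monomial [hcentral 1] * monomial [hmode a k])"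
  unfolding nn_eq_iff tt_diff tt_simps N_ideal_def Let_def
  by (rule subsetD[OF TA.genideal_self]) (auto intro!: TA.minus_closed)

lemma Vrel_gen_subset:
  "{n \<otimes>\<^bsub>NA\<^esub> nn (monomial us) \<ominus>\<^bsub>NA\<^esub> n \<otimes>\<^bsub>NA\<^esub> nn (scalar_elt (vac_character us)) |n us.
      n \<in> carrier NA \<and> set us \<subseteq> nonneg_letters} \<subseteq> carrier (add_monoid NA)"
  by (auto intro!: NA.minus_closed)

lemma Vrel_subgroup: "additive_subgroup Vrel NA"
  unfolding V_relations_def Let_def
  by (rule additive_subgroup.intro, rule group.generate_is_subgroup[OF NA.a_group Vrel_gen_subset])

lemma Vrel_abelian: "abelian_subgroup Vrel NA"
  by (rule abelian_subgroupI3[OF Vrel_subgroup NA.abelian_group_axioms])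

sublocale VR: abelian_subgroup Vrel NA by (rule Vrel_abelian)

text \<open>In this form the generators are left multiples, so that \<open>Vrel\<close> is seen to
  be stable under left multiplication.\<close>

lemma Vrel_eq:
  "Vrel = generate (add_monoid NA)
     {nn (x * (monomial us - scalar_elt (vac_character us))) |x us. set us \<subseteq> nonneg_letters}"
proof -
  have "{n \<otimes>\<^bsub>NA\<^esub> nn (monomial us) \<ominus>\<^bsub>NA\<^esub> n \<otimes>\<^bsub>NA\<^esub> nn (scalar_elt (vac_character us)) |n us.
      n \<in> carrier NA \<and> set us \<subseteq> nonneg_letters} =
     {nn (x * (monomial us - scalar_elt (vac_character us))) |x us. set us \<subseteq> nonneg_letters}"
    unfolding carrier_NA by (auto simp: nn_diff nn_simps right_diff_distrib)
  then show ?thesis by (simp add: V_relations_def Let_def)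
qed

lemma Vrel_induct [consumes 1, case_names zero gen minus add]:
  assumes "z \<in> Vrel"
    and zero: "P 0"
    and gen: "\<And>x us. set us \<subseteq> nonneg_letters \<Longrightarrow> P (x * (monomial us - scalar_elt (vac_character us)))"
    and minus: "\<And>x. P x \<Longrightarrow> P (- x)"
    and add: "\<And>x y. P x \<Longrightarrow> P y \<Longrightarrow> P (x + y)"
  shows "\<exists>x. z = nn x \<and> P x"
  using assms(1) unfolding Vrel_eq
proof induction
  case one
  then show ?case using zero nn_zero by (intro exI[of _ 0]) simp
next
  case (incl h)
  then show ?case using gen by blast
next
  case (inv h)
  then obtain x us where h: "h = nn (x * (monomial us - scalar_elt (vac_character us)))"
    and "set us \<subseteq> nonneg_letters" by blast
  then show ?case using minus[OF gen]
    by (intro exI[of _ "- (x * (monomial us - scalar_elt (vac_character us)))"])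
       (simp only: nn_minus a_inv_def)
next
  case (eng h1 h2)
  then obtain x y where "h1 = nn x" "P x" "h2 = nn y" "P y" by blast
  then show ?case using add by (intro exI[of _ "x + y"]) (simp add: nn_simps)
qed

lemma Vrel_left: "z \<in> Vrel \<Longrightarrow> nn y \<otimes>\<^bsub>NA\<^esub> z \<in> Vrel"
proof -
  assume "z \<in> Vrel"
  then have "\<exists>x. z = nn x \<and> nn (y * x) \<in> Vrel"
  proof (induction rule: Vrel_induct)
    case zero
    then show ?case by (simp add: nn_zero)
  next
    case (gen x us)
    then show ?case unfolding Vrel_eq mult.assoc[symmetric]
      by (intro generate.incl) blast
  next
    case (minus x)
    then show ?case by (simp add: nn_minus)
  next
    case (add x y)
    then show ?case by (simp add: distrib_left nn_simps)
  qed
  then show ?thesis by (auto simp: nn_simps)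
qed

definition q :: "'h hhat free_alg \<Rightarrow> 'h vspace" where
  "q x = to_V scale form (nn x)"

lemma q_eq_iff: "q x = q y \<longleftrightarrow> nn (x - y) \<in> Vrel"
proof
  assume "q x = q y"
  then have "nn x \<in> Vrel +>\<^bsub>NA\<^esub> nn y"
    unfolding q_def to_V_def by (metis VR.a_rcos_self nn_closed)
  then show "nn (x - y) \<in> Vrel"
    using VR.a_rcos_module_minus[OF ring_NA, of "nn y" "nn x"] by (simp add: nn_diff)
next
  assume "nn (x - y) \<in> Vrel"
  then have "nn x \<in> Vrel +>\<^bsub>NA\<^esub> nn y"
    using VR.a_rcos_module_minus[OF ring_NA, of "nn y" "nn x"] by (simp add: nn_diff)
  then show "q x = q y"
    unfolding q_def to_V_def using VR.a_repr_independence' nn_closed by metis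
qed

lemma carrier_VA: "carrier VA = range q"
  by (auto simp: V_module_def A_RCOSETS_def' q_def to_V_def carrier_NA)

lemma q_closed [simp]: "q x \<in> carrier VA"
  by (simp add: carrier_VA)

lemma q_add: "q x \<oplus>\<^bsub>VA\<^esub> q y = q (x + y)"
  by (simp add: V_module_def q_def to_V_def VR.a_rcos_sum nn_simps)

lemma q_zero: "\<zero>\<^bsub>VA\<^esub> = q 0"
  by (simp add: V_module_def q_def to_V_def nn_zero VR.a_rcos_const)

text \<open>\<open>N_act\<close> is a union over all members of a coset. \<open>Vrel_left\<close>
  makes the cosets in this union equal, so it is a single one.\<close>

lemma N_act_q: "N_act scale form (nn y) (q x) = q (y * x)"
proof -
  have 1: "z \<in> carrier NA" if "z \<in> q x" for z
    using that unfolding q_def to_V_def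
    by (meson NA.a_r_coset_subset_G VR.a_subset nn_closed subsetD)
  have 2: "to_V scale form (nn y \<otimes>\<^bsub>NA\<^esub> z) = q (y * x)" if z: "z \<in> q x" for z
  proof -
    obtain w where w: "z = nn w" using 1[OF z] by (auto simp: carrier_NA)
    have "nn (w - x) \<in> Vrel"
      using z VR.a_rcos_module_minus[OF ring_NA, of "nn x" "nn w"]
      by (simp add: nn_diff w q_def to_V_def)
    then have "nn (y * w - y * x) \<in> Vrel"
      using Vrel_left[of "nn (w - x)" y] by (simp add: nn_simps flip: right_diff_distrib)
    then have "q (y * w) = q (y * x)" by (simp add: q_eq_iff)
    then show ?thesis by (simp add: w q_def nn_simps)
  qed
  have "nn x \<in> q x" by (simp add: q_def to_V_def VR.a_rcos_self)
  then show ?thesis using 2 unfolding N_act_def by blast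
qed

lemma q_smult: "c \<odot>\<^bsub>VA\<^esub> q x = q (c *\<^sub>F x)"
  by (simp add: V_module_def N_act_q fscale_def)

lemma V_vac_q: "V_vac scale form = q 1"
  by (simp add: V_vac_def q_def nn_simps)

lemma V_mode_q: "V_mode scale form h n (q x) = q (monomial [hmode h n] * x)"
  by (simp add: V_mode_def N_act_q)

lemma module_VA: "module complex_field VA"
proof (rule moduleI)
  show "cring complex_field" by (rule cring_from_type_algebra)
  show "abelian_group VA"
  proof (rule abelian_groupI)
    show "\<exists>y\<in>carrier VA. y \<oplus>\<^bsub>VA\<^esub> x = \<zero>\<^bsub>VA\<^esub>" if x: "x \<in> carrier VA" for x
    proof -
      from x obtain w where w: "x = q w" by (auto simp: carrier_VA)
      show ?thesis by (rule bexI[of _ "q (- w)"]) (simp_all add: w q_add q_zero)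
    qed
  qed (auto simp: carrier_VA q_add q_zero algebra_simps)
qed (auto simp: carrier_VA q_add q_smult fscale_add_left fscale_add_right)

sublocale VA: module complex_field VA by (rule module_VA)

section \<open>Words in the negative modes\<close>

text \<open>The letter \<open>(h, m)\<close> stands for \<open>h(-m-1/2)\<close>; the index of
  \<open>hmode\<close> is the exponent minus \<open>1/2\<close>, hence
  \<open>- int m - 1\<close>.\<close>

definition iota :: "('h \<times> nat) free_alg \<Rightarrow> 'h hhat free_alg" where
  "iota = lin_ext (\<lambda>us. monomial (map (\<lambda>(h, m). hmode h (- int m - 1)) us))"

lemma flin_iota: "flin iota"
  by (simp add: iota_def flin_lin_ext)

lemmas iota_simps [simp] =
  flin_add[OF flin_iota] flin_scale[OF flin_iota] flin_zero[OF flin_iota]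
  flin_minus[OF flin_iota] flin_diff[OF flin_iota] flin_sum[OF flin_iota]

lemma iota_one [simp]: "iota 1 = 1"
  using lin_ext_monomial[of "\<lambda>us. monomial (map (\<lambda>(h, m). hmode h (- int m - 1)) us)" "[]"]
  by (simp add: iota_def del: lin_ext_monomial)

lemma iota_letter: "iota (monomial [(h, m)] * x) = monomial [hmode h (- int m - 1)] * iota x"
  by (rule flin_eqI[where f = "\<lambda>x. iota (monomial [(h, m)] * x)"])
     (auto simp: iota_def flin_def distrib_left)

definition cls :: "('h \<times> nat) free_alg \<Rightarrow> 'h vspace" where
  "cls x = q (iota x)"

lemma cls_closed [simp]: "cls x \<in> carrier VA"
  by (simp add: cls_def)

lemma cls_add: "cls x \<oplus>\<^bsub>VA\<^esub> cls y = cls (x + y)"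
  by (simp add: cls_def q_add)

lemma cls_zero: "\<zero>\<^bsub>VA\<^esub> = cls 0"
  by (simp add: cls_def q_zero)

lemma cls_scale: "c \<odot>\<^bsub>VA\<^esub> cls x = cls (c *\<^sub>F x)"
  by (simp add: cls_def q_smult)

lemma cls_uminus: "\<ominus>\<^bsub>VA\<^esub> cls x = cls (- x)"
  by (rule VA.minus_equality) (simp_all add: cls_add cls_zero)

lemma cls_diff: "cls x \<ominus>\<^bsub>VA\<^esub> cls y = cls (x - y)"
  by (simp add: a_minus_def cls_uminus cls_add)

lemma cls_sum: "(\<Oplus>\<^bsub>VA\<^esub>i\<in>A. cls (f i)) = cls (\<Sum>i\<in>A. f i)"
proof (induction A rule: infinite_finite_induct)
  case (infinite A)
  then show ?case by (simp add: VA.finsum_infinite cls_zero)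
next
  case empty
  then show ?case by (simp add: cls_zero)
next
  case (insert x F)
  then show ?case by (simp add: VA.M.finsum_insert cls_add)
qed

lemma cls_one: "V_vac scale form = cls 1"
  by (simp add: cls_def V_vac_q)

lemma V_mode_neg: "V_mode scale form h (- int m - 1) (cls x) = cls (monomial [(h, m)] * x)"
  by (simp add: cls_def V_mode_q iota_letter)

lemma V_word_cls: "V_word scale form us = cls (monomial us)"
proof (induction us)
  case Nil
  then show ?case by (simp add: V_word_def cls_one)
next
  case (Cons l us)
  then show ?case by (cases l) (simp add: V_word_def V_mode_neg)
qed

text \<open>V is only a left module: equality in V survives a left factor, whereas in front of a
  fixed right factor one may only replace elements that are equal in \<open>N\<close>.\<close>

lemma q_cong_left: "q x = q y \<Longrightarrow> q (z * x) = q (z * y)"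
  by (metis N_act_q)

lemma q_cong_nn_right: "nn x = nn y \<Longrightarrow> q (x * z) = q (y * z)"
  by (simp add: q_def nn_simps)

lemma q_vacuum:
  assumes "set us \<subseteq> nonneg_letters"
  shows "q (monomial us) = q (scalar_elt (vac_character us))"
proof -
  have "nn (1 * (monomial us - scalar_elt (vac_character us))) \<in> Vrel"
    unfolding Vrel_eq using assms by (intro generate.incl) blast
  then show ?thesis by (simp add: q_eq_iff)
qed

lemma map_scale_single: "Poly_Mapping.map (scale c) (Poly_Mapping.single n h) = Poly_Mapping.single n (scale c h)"
  by (rule poly_mapping_eqI) (simp add: Poly_Mapping.map.rep_eq lookup_single when_def)

lemma hcentral_scale: "hcentral c = hhat_scale scale c (hcentral 1)"
  by (simp add: hcentral_def hhat_scale_def poly_mapping_eq_iff Poly_Mapping.map.rep_eq fun_eq_iff)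

lemma nn_central: "nn (monomial [hcentral c]) = nn (c *\<^sub>F monomial [hcentral 1])"
  by (subst hcentral_scale) (rule nn_letter_scale)

lemma nn_letter_zero: "nn (monomial [0]) = nn 0"
proof -
  have "hhat_scale scale 0 0 = 0"
    by (simp add: hhat_scale_def zero_prod_def poly_mapping_eq_iff Poly_Mapping.map.rep_eq fun_eq_iff)
  then show ?thesis using nn_letter_scale[of 0 0] by simp
qed

text \<open>The central element commutes with every mode, so it can be moved right until it reaches
  the vacuum, where it acts by 1.\<close>

lemma q_central: "q (monomial [hcentral 1] * iota x) = cls x"
proof (induction x rule: free_alg_letter_induct)
  case one
  have "q (monomial [hcentral 1]) = q (scalar_elt (vac_character [hcentral 1 :: 'h hhat]))"
    by (rule q_vacuum) (simp add: nonneg_letters_def hcentral_def)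
  also have "scalar_elt (vac_character [hcentral 1 :: 'h hhat]) = 1"
    by (simp add: vac_character_def hcentral_def scalar_elt_def flip: zero_tword_def)
  finally show ?case by (simp add: cls_def)
next
  case (letter l x)
  obtain h m where l: "l = (h, m)" by (cases l)
  have "q (monomial [hcentral 1] * iota (monomial [l] * x)) =
      q (monomial [hmode h (- int m - 1)] * (monomial [hcentral 1] * iota x))"
    unfolding l iota_letter mult.assoc[symmetric]
    by (rule q_cong_nn_right[OF nn_central_commute[symmetric]])
  also have "\<dots> = q (monomial [hmode h (- int m - 1)] * iota x)"
    using letter by (intro q_cong_left) (simp add: cls_def)
  finally show ?case by (simp add: l cls_def iota_letter)
next
  case (add x y)
  then show ?case by (simp add: distrib_left flip: q_add cls_add)
next
  case (scale c x)
  then show ?case by (simp flip: q_smult cls_scale)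
qed (simp add: cls_def)

text \<open>Moving the mode right by one letter leaves a multiple of the central element, which acts
  by 1, and a sign; on the vacuum the mode is 0. This is the recursion of
  \<open>contract_word\<close>.\<close>

lemma V_mode_pos: "V_mode scale form h (int i) (cls x) = cls (con h i x)"
proof -
  have "q (monomial [hmode h (int i)] * iota x) = cls (con h i x)"
  proof (induction x rule: free_alg_letter_induct)
    case one
    have "q (monomial [hmode h (int i)]) = q (scalar_elt (vac_character [hmode h (int i)]))"
      by (rule q_vacuum) (simp add: nonneg_letters_def hmode_def)
    then show ?case by (simp add: cls_def vac_character_def hmode_def scalar_elt_def)
  next
    case (letter l x)
    obtain g j where l: "l = (g, j)" by (cases l)
    let ?p = "monomial [hmode h (int i)]" and ?n = "monomial [hmode g (- int j - 1)]"
    let ?c = "if j = i then form h g else 0"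
    have "nn (?p * ?n + ?n * ?p) = nn (monomial [hcentral (if int i + (- int j - 1) + 1 = 0 then form h g else 0)])"
      by (rule nn_anticommute) auto
    also have "(if int i + (- int j - 1) + 1 = 0 then form h g else 0) = ?c" by auto
    also have "nn (monomial [hcentral ?c]) = nn (?c *\<^sub>F monomial [hcentral 1])" by (rule nn_central)
    finally have "nn (?p * ?n) = nn (?c *\<^sub>F monomial [hcentral 1] - ?n * ?p)"
      by (metis add_diff_cancel_right' nn_diff)
    then have "q (?p * (?n * iota x)) = q ((?c *\<^sub>F monomial [hcentral 1] - ?n * ?p) * iota x)"
      unfolding mult.assoc[symmetric] by (rule q_cong_nn_right)
    also have "\<dots> = q (?c *\<^sub>F (monomial [hcentral 1] * iota x) + (-1) *\<^sub>F (?n * (?p * iota x)))"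
      by (simp add: left_diff_distrib mult.assoc del: monomial_mult)
    also have "\<dots> = ?c \<odot>\<^bsub>VA\<^esub> q (monomial [hcentral 1] * iota x) \<oplus>\<^bsub>VA\<^esub> (-1) \<odot>\<^bsub>VA\<^esub> q (?n * (?p * iota x))"
      by (simp only: q_smult q_add)
    also have "q (?n * (?p * iota x)) = q (?n * iota (con h i x))"
      using letter by (intro q_cong_left) (simp add: cls_def)
    also have "?c \<odot>\<^bsub>VA\<^esub> q (monomial [hcentral 1] * iota x) \<oplus>\<^bsub>VA\<^esub> (-1) \<odot>\<^bsub>VA\<^esub> q (?n * iota (con h i x)) =
        cls (con h i (monomial [l] * x))"
      unfolding q_central l con_letter by (simp add: cls_def q_smult q_add iota_letter)
    finally show ?case by (simp add: l iota_letter)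
  next
    case (add x y)
    then show ?case by (simp add: distrib_left flip: q_add cls_add)
  next
    case (scale c x)
    then show ?case by (simp flip: q_smult cls_scale)
  qed (simp add: cls_def)
  then show ?thesis by (simp add: cls_def V_mode_q)
qed

text \<open>A general letter is a Laurent polynomial plus a multiple of the central element. By
  additivity single modes and the central element suffice, and their actions on classes of words are
  known.\<close>

lemma q_letter_range: "q (monomial [u] * iota z) \<in> range cls"
proof -
  have add: "q (monomial [u + v] * iota z) \<in> range cls"
    if "q (monomial [u] * iota z) \<in> range cls" "q (monomial [v] * iota z) \<in> range cls" for u v
  proof -
    have "q (monomial [u + v] * iota z) = q (monomial [u] * iota z) \<oplus>\<^bsub>VA\<^esub> q (monomial [v] * iota z)"
      using q_cong_nn_right[OF nn_letter_add] by (simp add: q_add distrib_right)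
    then show ?thesis using that by (auto simp: cls_add)
  qed
  have mode: "q (monomial [hmode h n] * iota z) \<in> range cls" for h n
  proof (cases "0 \<le> n")
    case True
    then show ?thesis using V_mode_pos[of h "nat n" z] by (simp add: cls_def V_mode_q image_iff) metis
  next
    case False
    then have "n = - int (nat (- n - 1)) - 1" by simp
    then show ?thesis using V_mode_neg[of h "nat (- n - 1)" z] by (simp add: cls_def V_mode_q image_iff) metis
  qed
  have zero: "q (monomial [0] * iota z) \<in> range cls"
    using q_cong_nn_right[OF nn_letter_zero, of "iota z"] cls_zero q_zero by simp
  have "q (monomial [(\<Sum>k\<in>A. Poly_Mapping.single k (f k), 0)] * iota z) \<in> range cls" for A and f :: "int \<Rightarrow> 'h"
  proof (induction A rule: infinite_finite_induct)
    case (insert k A)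
    then show ?case using add[OF mode[of "f k" k] insert.IH] by (simp add: hmode_def)
  qed (use zero in \<open>simp_all add: zero_prod_def\<close>)
  then have "q (monomial [(fst u, 0)] * iota z) \<in> range cls"
    by (subst poly_mapping_expand)
  moreover have "q (monomial [hcentral (snd u)] * iota z) \<in> range cls"
    using q_cong_nn_right[OF nn_central, of "snd u" "iota z"] q_central[of z]
    by (simp add: cls_scale flip: q_smult)
  ultimately show ?thesis using add[of "(fst u, 0)" "hcentral (snd u)"] by (simp add: hcentral_def)
qed

lemma carrier_VA_cls: "carrier VA = range cls"
proof -
  have "q x \<in> range cls" for x
  proof (induction x rule: free_alg_letter_induct)
    case zero
    then show ?case using cls_zero q_zero by auto
  next
    case one
    then show ?case using cls_one V_vac_q by (metis rangeI)
  next
    case (letter l x)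
    then obtain z where "q x = q (iota z)" by (auto simp: cls_def)
    then have "q (monomial [l] * x) = q (monomial [l] * iota z)" by (rule q_cong_left)
    then show ?case by (simp add: q_letter_range)
  next
    case (add x y)
    then show ?case by (auto simp: cls_add simp flip: q_add)
  next
    case (scale c x)
    then show ?case by (auto simp: cls_scale simp flip: q_smult)
  qed
  then show ?thesis by (auto simp: carrier_VA cls_def)
qed

subsection \<open>Normal forms\<close>

definition basis :: "'h set" where
  "basis = (SOME B. finite B \<and> independent B \<and> span B = UNIV)"

lemma basis: "finite basis" "independent basis" "span basis = UNIV"
proof -
  have "\<exists>B. finite B \<and> independent B \<and> span B = UNIV" using finite_basis by blast
  from someI_ex[OF this] show "finite basis" "independent basis" "span basis = UNIV"
    by (simp_all add: basis_def)
qed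

definition coef :: "'h \<Rightarrow> 'h \<Rightarrow> complex" where
  "coef h b = representation basis h b"

lemma coef_add: "coef (g + h) b = coef g b + coef h b"
  unfolding coef_def by (subst representation_add[OF basis(2)]) (simp_all add: basis)

lemma coef_scale: "coef (scale c h) b = c * coef h b"
  unfolding coef_def by (subst representation_scale[OF basis(2)]) (simp_all add: basis)

lemma coef_sum: "(\<Sum>b\<in>basis. scale (coef h b) b) = h"
  unfolding coef_def by (rule sum_representation_eq) (simp_all add: basis)

lemma coef_basis: "g \<in> basis \<Longrightarrow> coef g b = (if b = g then 1 else 0)"
  unfolding coef_def by (simp add: representation_basis[OF basis(2)])

text \<open>The letter \<open>(h, m)\<close> with \<open>h\<close> expanded in the basis. Unlike
  \<open>monomial [(h, m)]\<close> it is linear in \<open>h\<close>.\<close>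

definition lam :: "'h \<Rightarrow> nat \<Rightarrow> ('h \<times> nat) free_alg" where
  "lam h m = (\<Sum>b\<in>basis. coef h b *\<^sub>F monomial [(b, m)])"

lemma lam_add: "lam (g + h) m = lam g m + lam h m"
  by (simp add: lam_def coef_add fscale_add_left sum.distrib)

lemma lam_scale: "lam (scale c h) m = c *\<^sub>F lam h m"
  by (simp add: lam_def coef_scale fscale_sum_right)

lemma lam_basis: "g \<in> basis \<Longrightarrow> lam g m = monomial [(g, m)]"
proof -
  assume g: "g \<in> basis"
  have "lam g m = (\<Sum>b\<in>basis. if b = g then monomial [(g, m)] else 0)"
    unfolding lam_def by (intro sum.cong refl) (simp add: coef_basis[OF g])
  then show ?thesis using g basis(1) by simp
qed

lemma con_add_left: "con (g + h) i x = con g i x + con h i x"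
proof (induction x rule: free_alg_letter_induct)
  case (letter l x)
  then show ?case by (cases l) (simp add: con_letter form_add fscale_add_left algebra_simps)
next
  case (scale c x)
  then show ?case by (simp add: fscale_add_right)
qed simp_all

lemma con_scale_left: "con (scale c h) i x = c *\<^sub>F con h i x"
proof (induction x rule: free_alg_letter_induct)
  case (letter l x)
  then show ?case by (cases l) (simp add: con_letter form_scale fscale_diff_right)
next
  case (scale d x)
  then show ?case by (simp add: mult.commute)
qed (simp_all add: fscale_add_right)

lemma con_sum_left: "con h i x = (\<Sum>b\<in>basis. coef h b *\<^sub>F con b i x)"
proof -
  have zero: "con 0 i x = 0" using con_scale_left[of 0 0 i x] by simp
  have "con (\<Sum>b\<in>A. scale (coef h b) b) i x = (\<Sum>b\<in>A. coef h b *\<^sub>F con b i x)" for A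
    by (induction A rule: infinite_finite_induct) (simp_all add: zero con_add_left con_scale_left)
  from this[of basis] show ?thesis by (simp add: coef_sum)
qed

lemma form_sum_right: "form h g = (\<Sum>b\<in>basis. coef g b * form h b)"
proof -
  have zero: "form 0 h = 0" using form_scale[of 0 0 h] by simp
  have "form (\<Sum>b\<in>A. scale (coef g b) b) h = (\<Sum>b\<in>A. coef g b * form b h)" for A
    by (induction A rule: infinite_finite_induct) (simp_all add: zero form_add form_scale)
  from this[of basis] show ?thesis by (simp add: coef_sum form_sym)
qed

lemma con_lam: "con h i (lam g j * x) = (if j = i then form h g else 0) *\<^sub>F x - lam g j * con h i x"
proof -
  have "con h i (lam g j * x) = (\<Sum>b\<in>basis. coef g b *\<^sub>F con h i (monomial [(b, j)] * x))"
    by (simp add: lam_def sum_distrib_right)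
  also have "\<dots> = (\<Sum>b\<in>basis. (coef g b * (if j = i then form h b else 0)) *\<^sub>F x) - lam g j * con h i x"
    by (simp add: con_letter fscale_diff_right sum_subtractf lam_def sum_distrib_right)
  also have "(\<Sum>b\<in>basis. (coef g b * (if j = i then form h b else 0)) *\<^sub>F x) =
      (if j = i then form h g else 0) *\<^sub>F x"
    by (simp add: form_sum_right[of h g] flip: fscale_sum_left)
  finally show ?thesis .
qed

section \<open>A representation of N on the free algebra\<close>

text \<open>Negative modes multiply by \<open>lam\<close> and not by the letter itself, because the
  relations of the tensor algebra require linearity in \<open>h\<close>.\<close>

definition act_mode :: "'h \<Rightarrow> int \<Rightarrow> ('h \<times> nat) free_alg \<Rightarrow> ('h \<times> nat) free_alg" where
  "act_mode h n x = (if n < 0 then lam h (nat (- n - 1)) * x else con h (nat n) x)"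

lemma act_mode_add: "act_mode (g + h) n x = act_mode g n x + act_mode h n x"
  by (simp add: act_mode_def lam_add con_add_left distrib_right)

lemma act_mode_scale: "act_mode (scale c h) n x = c *\<^sub>F act_mode h n x"
  by (simp add: act_mode_def lam_scale con_scale_left)

lemma act_mode_zero: "act_mode 0 n x = 0"
  using act_mode_scale[of 0 0 n x] by simp

lemma flin_act_mode: "flin (act_mode h n)"
  by (simp add: flin_def act_mode_def distrib_left)

definition act_letter :: "'h hhat \<Rightarrow> ('h \<times> nat) free_alg \<Rightarrow> ('h \<times> nat) free_alg" where
  "act_letter u x =
     (\<Sum>n\<in>Poly_Mapping.keys (fst u). act_mode (Poly_Mapping.lookup (fst u) n) n x) + snd u *\<^sub>F x"

lemma flin_act_letter: "flin (act_letter u)"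
  unfolding act_letter_def
  by (intro flin_plus flin_sum_fun flin_act_mode flin_scale_fun flin_ident)

lemma act_letter_superset:
  assumes "finite A" "Poly_Mapping.keys (fst u) \<subseteq> A"
  shows "act_letter u x = (\<Sum>n\<in>A. act_mode (Poly_Mapping.lookup (fst u) n) n x) + snd u *\<^sub>F x"
  unfolding act_letter_def using assms
  by (intro arg_cong2[where f = "(+)"] refl sum.mono_neutral_left) (auto simp: in_keys_iff act_mode_zero)

lemma act_letter_add: "act_letter (u + v) x = act_letter u x + act_letter v x"
proof -
  let ?A = "Poly_Mapping.keys (fst u) \<union> Poly_Mapping.keys (fst v)"
  show ?thesis
    using act_letter_superset[of ?A u x] act_letter_superset[of ?A v x]
      act_letter_superset[of ?A "u + v" x] keys_add[of "fst u" "fst v"]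
    by (simp add: lookup_add act_mode_add sum.distrib fscale_add_left)
qed

lemma lookup_map_scale:
  "Poly_Mapping.lookup (Poly_Mapping.map (scale c) f) n = scale c (Poly_Mapping.lookup f n)"
  by (simp add: Poly_Mapping.map.rep_eq when_def)

lemma act_letter_scale: "act_letter (hhat_scale scale c u) x = c *\<^sub>F act_letter u x"
proof -
  have "Poly_Mapping.keys (fst (hhat_scale scale c u)) \<subseteq> Poly_Mapping.keys (fst u)"
    by (auto simp: hhat_scale_def in_keys_iff lookup_map_scale)
  then show ?thesis
    using act_letter_superset[of "Poly_Mapping.keys (fst u)" "hhat_scale scale c u" x]
      act_letter_superset[of "Poly_Mapping.keys (fst u)" u x]
    by (simp add: hhat_scale_def lookup_map_scale act_mode_scale fscale_add_right fscale_sum_right)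
qed

lemma act_letter_hmode: "act_letter (hmode h n) x = act_mode h n x"
  using act_letter_superset[of "{n}" "hmode h n" x] by (simp add: hmode_def)

lemma act_letter_hcentral: "act_letter (hcentral c) x = c *\<^sub>F x"
  by (simp add: act_letter_def hcentral_def)

definition act :: "'h hhat free_alg \<Rightarrow> ('h \<times> nat) free_alg \<Rightarrow> ('h \<times> nat) free_alg" where
  "act p x = lin_ext (\<lambda>us. foldr act_letter us x) p"

lemma act_monomial: "act (monomial us) x = foldr act_letter us x"
  by (simp add: act_def)

lemma flin_act_left: "flin (\<lambda>p. act p x)"
  unfolding act_def by (rule flin_lin_ext)

lemma flin_act_right: "flin (act p)"
proof -
  have "flin (foldr act_letter us)" for us
  proof (induction us)
    case Nil
    then show ?case by (simp add: flin_def)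
  next
    case (Cons u us)
    then show ?case using flin_compose[OF flin_act_letter Cons, of u] by (simp add: comp_def)
  qed
  then show ?thesis unfolding act_def lin_ext_def by (intro flin_sum_fun flin_scale_fun)
qed

lemmas act_simps [simp] =
  flin_add[OF flin_act_left] flin_scale[OF flin_act_left] flin_zero[OF flin_act_left]
  flin_minus[OF flin_act_left] flin_diff[OF flin_act_left] flin_sum[OF flin_act_left]
  flin_add[OF flin_act_right] flin_scale[OF flin_act_right] flin_zero[OF flin_act_right]
  flin_minus[OF flin_act_right] flin_diff[OF flin_act_right] flin_sum[OF flin_act_right]

lemma act_one [simp]: "act 1 x = x"
  using act_monomial[of "[]"] by simp

lemma act_mult: "act (p * r) x = act p (act r x)"
proof (induction p rule: free_alg_induct)
  case (monomial us)
  show ?case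
    by (rule flin_eqI[where f = "\<lambda>r. act (monomial us * r) x" and g = "\<lambda>r. act (monomial us) (act r x)"])
       (simp add: flin_def distrib_left, simp add: flin_def, simp add: act_monomial)
qed (simp_all add: distrib_right)

lemma act_single [simp]: "act (monomial [u]) x = act_letter u x"
  by (simp add: act_monomial)

lemma act_scalar: "act (scalar_elt c) x = c *\<^sub>F x"
  using flin_scale[OF flin_act_left, of c 1 x] by (simp add: fscale_def del: act_simps)

text \<open>The kernel of the representation. Being a two-sided ideal, it contains an ideal as soon
  as it contains its generators.\<close>

definition annihilator :: "'h hhat free_alg set" where
  "annihilator = {p. \<forall>x. act p x = 0}"

lemma annihilator_ideal: "ideal annihilator FA"
proof (rule idealI[OF ring_free_algebra])
  interpret FA: ring FA by (rule ring_free_algebra)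
  show "subgroup annihilator (add_monoid FA)"
    by (rule FA.add.subgroupI) (auto simp: annihilator_def a_inv_def[symmetric] intro: exI[of _ 0])
qed (auto simp: annihilator_def act_mult)

lemma tensor_ideal_annihilator: "tensor_ideal (hhat_scale scale) \<subseteq> annihilator"
  unfolding tensor_ideal_def
  by (rule ring.genideal_minimal[OF ring_free_algebra annihilator_ideal])
     (intro Un_least subsetI; elim CollectE exE conjE;
      simp add: annihilator_def act_letter_add act_letter_scale act_mult act_scalar)

lemma act_anticommute:
  assumes "0 \<le> m" "n \<le> -1"
  shows "act_mode a m (act_mode b n x) + act_mode b n (act_mode a m x) =
    (if m + n + 1 = 0 then form a b else 0) *\<^sub>F x"
proof -
  have "nat (- n - 1) = nat m \<longleftrightarrow> m + n + 1 = 0" using assms by auto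
  then show ?thesis using assms by (simp add: act_mode_def con_lam)
qed

text \<open>\<open>N_ideal\<close> lives in the tensor algebra, so it is compared with the image of
  the annihilator, an ideal of that quotient. \<open>act_eq_of_nn\<close> returns to the free
  algebra because \<open>tensor_ideal\<close> itself acts by 0.\<close>

lemma N_ideal_annihilator: "N_ideal scale form \<subseteq> tt ` annihilator"
proof -
  have "tt = (+>\<^bsub>FA\<^esub>) (tensor_ideal (hhat_scale scale))"
    by (simp add: to_tensor_def fun_eq_iff)
  then have "ideal (tt ` annihilator) TA"
    using ring.ring_ideal_imp_quot_ideal[OF ring_free_algebra tensor_ideal_ideal annihilator_ideal]
    by (simp add: tensor_algebra_def)
  then show ?thesis unfolding N_ideal_def Let_def
  proof (rule TA.genideal_minimal, safe)
    fix a b :: 'h and m n :: int assume mn: "0 \<le> m" "n \<le> -1"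
    let ?c = "if m + n + 1 = 0 then form a b else 0"
    have "monomial [hmode a m] * monomial [hmode b n] + monomial [hmode b n] * monomial [hmode a m]
        - monomial [hcentral ?c] \<in> annihilator"
      using act_anticommute[OF mn, of a b]
      by (simp add: annihilator_def act_mult act_letter_hmode act_letter_hcentral del: monomial_mult)
    then show "tt (monomial [hmode a m]) \<otimes>\<^bsub>TA\<^esub> tt (monomial [hmode b n]) \<oplus>\<^bsub>TA\<^esub>
        tt (monomial [hmode b n]) \<otimes>\<^bsub>TA\<^esub> tt (monomial [hmode a m]) \<ominus>\<^bsub>TA\<^esub>
        tt (monomial [hcentral ?c]) \<in> tt ` annihilator"
      unfolding tt_simps[symmetric] tt_diff[symmetric] by (rule imageI)
  next
    fix a :: 'h and k :: int
    have "monomial [hmode a k] * monomial [hcentral 1] - monomial [hcentral 1] * monomial [hmode a k] \<in> annihilator"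
      by (simp add: annihilator_def act_mult act_letter_hcentral del: monomial_mult)
    then show "tt (monomial [hmode a k]) \<otimes>\<^bsub>TA\<^esub> tt (monomial [hcentral 1]) \<ominus>\<^bsub>TA\<^esub>
        tt (monomial [hcentral 1]) \<otimes>\<^bsub>TA\<^esub> tt (monomial [hmode a k]) \<in> tt ` annihilator"
      unfolding tt_simps[symmetric] tt_diff[symmetric] by (rule imageI)
  qed
qed

lemma act_vacuum:
  "set us \<subseteq> nonneg_letters \<Longrightarrow> act (monomial us) 1 = vac_character us *\<^sub>F 1"
proof (induction us)
  case Nil
  then show ?case by (simp add: vac_character_def)
next
  case (Cons u us)
  have "act_letter u 1 = snd u *\<^sub>F 1"
    using Cons.prems by (auto simp: act_letter_def act_mode_def nonneg_letters_def intro!: sum.neutral)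
  moreover have "foldr act_letter us 1 = vac_character us *\<^sub>F 1"
    using Cons by (simp add: act_monomial)
  ultimately show ?case
    by (simp add: act_monomial vac_character_def flin_scale[OF flin_act_letter] mult.commute)
qed

lemma act_eq_of_nn: "nn x = nn y \<Longrightarrow> act x v = act y v"
proof -
  assume "nn x = nn y"
  then obtain j where j: "tt (x - y) = tt j" "j \<in> annihilator"
    using N_ideal_annihilator by (auto simp: nn_eq_iff)
  then have "x - y - j \<in> annihilator"
    using tensor_ideal_annihilator by (auto simp: tt_eq_iff)
  with j(2) show ?thesis by (auto simp: annihilator_def)
qed

text \<open>The generators of \<open>Vrel\<close> kill the vector 1, so applying the representation
  to 1 descends to V. This is what prevents unexpected identifications of words in V.\<close>

lemma act_eq_of_q: "q x = q y \<Longrightarrow> act x 1 = act y 1"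
proof -
  assume "q x = q y"
  then have "nn (x - y) \<in> Vrel" by (simp add: q_eq_iff)
  then have "\<exists>z. nn (x - y) = nn z \<and> act z 1 = 0"
  proof (induction rule: Vrel_induct)
    case (gen x us)
    then show ?case by (simp add: act_mult act_vacuum act_scalar)
  qed simp_all
  then obtain z where "nn (x - y) = nn z" "act z 1 = 0" by blast
  then have "act (x - y) 1 = 0" using act_eq_of_nn by metis
  then show ?thesis by simp
qed

definition nf :: "('h \<times> nat) free_alg \<Rightarrow> ('h \<times> nat) free_alg" where
  "nf x = act (iota x) 1"

text \<open>The normal form as a function on V; by \<open>act_eq_of_q\<close> the choice of the
  preimage does not matter.\<close>

definition nu :: "'h vspace \<Rightarrow> ('h \<times> nat) free_alg" where
  "nu v = act (SOME p. q p = v) 1"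

lemma nu_q: "nu (q p) = act p 1"
  unfolding nu_def by (rule act_eq_of_q, rule someI) (rule refl)

lemma nu_cls: "nu (cls x) = nf x"
  by (simp add: cls_def nf_def nu_q)

lemma flin_nf: "flin nf"
  by (simp add: flin_def nf_def)

lemmas nf_simps [simp] =
  flin_add[OF flin_nf] flin_scale[OF flin_nf] flin_zero[OF flin_nf]
  flin_minus[OF flin_nf] flin_diff[OF flin_nf] flin_sum[OF flin_nf]

lemma nf_one [simp]: "nf 1 = 1"
  by (simp add: nf_def)

lemma nf_letter: "nf (monomial [(h, m)] * x) = lam h m * nf x"
  by (simp add: nf_def iota_letter act_mult act_letter_hmode act_mode_def)

lemma nf_cong: "cls x = cls y \<Longrightarrow> nf x = nf y"
  by (metis nu_cls)

end

subsection \<open>Normal ordering\<close>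

text \<open>Give position \<open>i\<close> the key \<open>i\<close> if its mode is negative and
  \<open>length ns + i\<close> otherwise. Both lists are strictly increasing in this key and have
  the same entries, so they coincide.\<close>

lemma normal_perm_list:
  assumes "is_normal_perm ns \<sigma>"
  shows "map \<sigma> [0..<length ns] =
    filter (\<lambda>i. ns ! i < 0) [0..<length ns] @ filter (\<lambda>i. \<not> ns ! i < 0) [0..<length ns]"
proof -
  let ?r = "length ns"
  let ?key = "\<lambda>i. if ns ! i < 0 then i else ?r + i"
  let ?L = "filter (\<lambda>i. ns ! i < 0) [0..<?r] @ filter (\<lambda>i. \<not> ns ! i < 0) [0..<?r]"
  have p: "\<sigma> permutes {..<?r}" using assms by (simp add: is_normal_perm_def)
  have set: "set (map \<sigma> [0..<?r]) = {..<?r}" using permutes_image[OF p] by (simp add: lessThan_atLeast0)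
  have setL: "set ?L = {..<?r}" by auto
  have lt: "?key (\<sigma> i) < ?key (\<sigma> j)" if "i < j" "j < ?r" for i j
  proof -
    have "\<sigma> i < ?r" "\<sigma> j < ?r" using that permutes_in_image[OF p] by auto
    moreover have "\<not> (ns ! \<sigma> i \<ge> 0 \<and> ns ! \<sigma> j < 0)" "(ns ! \<sigma> i < 0 \<longleftrightarrow> ns ! \<sigma> j < 0) \<Longrightarrow> \<sigma> i < \<sigma> j"
      using assms that by (auto simp: is_normal_perm_def)
    ultimately show ?thesis by (auto simp: not_less)
  qed
  have s1: "sorted_wrt (<) (map ?key (map \<sigma> [0..<?r]))"
    using lt by (auto simp: sorted_wrt_iff_nth_less)
  have "sorted_wrt (<) [0..<?r]" by simp
  then have "sorted_wrt (\<lambda>i j. ?key i < ?key j) (filter (\<lambda>i. ns ! i < 0) [0..<?r])"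
    "sorted_wrt (\<lambda>i j. ?key i < ?key j) (filter (\<lambda>i. \<not> ns ! i < 0) [0..<?r])"
    by (auto intro!: sorted_wrt_mono_rel[OF _ sorted_wrt_filter[of "(<)"]])
  then have s2: "sorted_wrt (<) (map ?key ?L)"
    by (auto simp: sorted_wrt_append sorted_wrt_map)
  show ?thesis
  proof (rule map_sorted_distinct_set_unique[of ?key])
    show "inj_on ?key (set (map \<sigma> [0..<?r]) \<union> set ?L)"
      unfolding set setL by (auto simp: inj_on_def split: if_splits)
  qed (use s1 s2 set setL in \<open>simp_all add: strict_sorted_iff\<close>)
qed

lemma normal_perm_unique:
  assumes "is_normal_perm ns \<sigma>" "is_normal_perm ns \<tau>"
  shows "\<sigma> = \<tau>"
proof
  fix i
  have p: "\<sigma> permutes {..<length ns}" "\<tau> permutes {..<length ns}"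
    using assms by (simp_all add: is_normal_perm_def)
  show "\<sigma> i = \<tau> i"
  proof (cases "i < length ns")
    case True
    have "map \<sigma> [0..<length ns] = map \<tau> [0..<length ns]"
      by (rule trans[OF normal_perm_list[OF assms(1)] normal_perm_list[OF assms(2), symmetric]])
    then have "map \<sigma> [0..<length ns] ! i = map \<tau> [0..<length ns] ! i" by (rule arg_cong)
    then show ?thesis using True by simp
  next
    case False
    then show ?thesis using p by (simp add: permutes_not_in)
  qed
qed

lemma normal_perm_eq: "is_normal_perm ns \<sigma> \<Longrightarrow> normal_perm ns = \<sigma>"
  unfolding normal_perm_def using normal_perm_unique by blast

section \<open>The normal ordering permutation, one mode at a time\<close>

definition lift_perm :: "(nat \<Rightarrow> nat) \<Rightarrow> nat \<Rightarrow> nat" where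
  "lift_perm \<sigma> i = (case i of 0 \<Rightarrow> 0 | Suc j \<Rightarrow> Suc (\<sigma> j))"

text \<open>A nonnegative mode put in front of a list has to pass its \<open>k\<close> negative
  modes: place \<open>k\<close> of the ordered product then takes entry 0. This cycle of length
  \<open>k + 1\<close> has sign \<open>(-1)^k\<close>.\<close>

definition front_cycle :: "nat \<Rightarrow> nat \<Rightarrow> nat" where
  "front_cycle k i = (if i < k then Suc i else if i = k then 0 else i)"

lemma lift_perm:
  assumes "\<sigma> permutes {..<r}"
  shows "lift_perm \<sigma> permutes {..<Suc r}" "sign (lift_perm \<sigma>) = sign \<sigma>"
proof -
  have im: "Suc ` {..<r} = {1..<Suc r}" by (simp add: image_Suc_lessThan atLeastLessThanSuc_atLeastAtMost)
  have eq: "lift_perm \<sigma> = map_permutation {..<r} Suc \<sigma>"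
  proof
    fix i
    show "lift_perm \<sigma> i = map_permutation {..<r} Suc \<sigma> i"
    proof (cases "i \<in> Suc ` {..<r}")
      case True
      then obtain j where "i = Suc j" "j < r" by auto
      then show ?thesis using assms by (simp add: lift_perm_def map_permutation_apply)
    next
      case False
      then have "map_permutation {..<r} Suc \<sigma> i = i"
        by (simp add: map_permutation_def restrict_id_def)
      moreover have "lift_perm \<sigma> i = i"
        using False permutes_not_in[OF assms] by (cases i) (auto simp: lift_perm_def image_iff)
      ultimately show ?thesis by simp
    qed
  qed
  have "map_permutation {..<r} Suc \<sigma> permutes {1..<Suc r}"
    by (rule map_permutation_permutes[OF _ assms]) (simp_all add: bij_betw_def im)
  then show "lift_perm \<sigma> permutes {..<Suc r}"
    unfolding eq by (rule permutes_subset) auto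
  show "sign (lift_perm \<sigma>) = sign \<sigma>"
    unfolding eq by (rule sign_map_permutation[OF _ assms]) auto
qed

lemma front_cycle: "front_cycle k permutes {..k} \<and> sign (front_cycle k) = (-1) ^ k"
proof (induction k)
  case 0
  have "front_cycle 0 = id" by (auto simp: front_cycle_def fun_eq_iff)
  then show ?case by (simp only: permutes_id sign_id power_0)
next
  case (Suc k)
  have eq: "front_cycle (Suc k) = front_cycle k \<circ> Transposition.transpose k (Suc k)"
    by (auto simp: front_cycle_def fun_eq_iff Transposition.transpose_def)
  have p: "front_cycle k permutes {..Suc k}" using Suc by (auto intro: permutes_subset)
  have t: "Transposition.transpose k (Suc k) permutes {..Suc k}" by (rule permutes_swap_id) auto
  have "sign (front_cycle (Suc k)) = sign (front_cycle k) * sign (Transposition.transpose k (Suc k))"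
    unfolding eq using p t by (intro sign_compose) (auto intro: permutes_imp_permutation[of "{..Suc k}"])
  then have "sign (front_cycle (Suc k)) = (-1) ^ Suc k" using Suc by (simp add: sign_swap_id)
  moreover have "front_cycle (Suc k) permutes {..Suc k}"
    unfolding eq by (rule permutes_compose[OF t p])
  ultimately show ?case by blast
qed

lemma is_normal_perm_Cons_neg:
  assumes "is_normal_perm ns \<sigma>" "n < 0"
  shows "is_normal_perm (n # ns) (lift_perm \<sigma>)"
proof -
  have p: "\<sigma> permutes {..<length ns}" using assms by (simp add: is_normal_perm_def)
  show ?thesis
    unfolding is_normal_perm_def
  proof (intro conjI allI impI)
    show "lift_perm \<sigma> permutes {..<length (n # ns)}" using lift_perm[OF p] by simp
    fix j i assume ij: "j < length (n # ns)" "i < j"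
    then obtain j' where j: "j = Suc j'" by (cases j) auto
    show "\<not> (0 \<le> (n # ns) ! lift_perm \<sigma> i \<and> (n # ns) ! lift_perm \<sigma> j < 0)"
      using assms ij by (cases i) (auto simp: lift_perm_def j is_normal_perm_def)
    assume "((n # ns) ! lift_perm \<sigma> i < 0) = ((n # ns) ! lift_perm \<sigma> j < 0)"
    then show "lift_perm \<sigma> i < lift_perm \<sigma> j"
      using assms ij by (cases i) (auto simp: lift_perm_def j is_normal_perm_def)
  qed
qed

lemma normal_perm_neg_iff:
  assumes "is_normal_perm ns \<sigma>" "i < length ns"
  shows "ns ! \<sigma> i < 0 \<longleftrightarrow> i < length (filter (\<lambda>n. n < 0) ns)"
proof -
  let ?P = "\<lambda>i. ns ! i < 0"
  have len: "length (filter ?P [0..<length ns]) = length (filter (\<lambda>n. n < 0) ns)"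
  proof -
    have "filter (\<lambda>n. n < 0) ns = filter (\<lambda>n. n < 0) (map ((!) ns) [0..<length ns])"
      by (simp only: map_nth)
    also have "\<dots> = map ((!) ns) (filter ?P [0..<length ns])" by (simp add: filter_map comp_def)
    finally show ?thesis by simp
  qed
  have "\<sigma> i = map \<sigma> [0..<length ns] ! i" using assms(2) by simp
  also have "\<dots> = (filter ?P [0..<length ns] @ filter (\<lambda>i. \<not> ?P i) [0..<length ns]) ! i"
    by (simp only: normal_perm_list[OF assms(1)])
  finally have s: "\<sigma> i = (filter ?P [0..<length ns] @ filter (\<lambda>i. \<not> ?P i) [0..<length ns]) ! i" .
  show ?thesis
  proof (cases "i < length (filter ?P [0..<length ns])")
    case True
    then have "\<sigma> i \<in> set (filter ?P [0..<length ns])"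
      using s by (simp only: nth_append if_True) (rule nth_mem)
    then show ?thesis using True len by simp
  next
    case False
    have "length (filter ?P [0..<length ns]) + length (filter (\<lambda>i. \<not> ?P i) [0..<length ns]) = length ns"
      by (simp add: sum_length_filter_compl)
    then have "i - length (filter ?P [0..<length ns]) < length (filter (\<lambda>i. \<not> ?P i) [0..<length ns])"
      using False assms(2) by linarith
    then have "\<sigma> i \<in> set (filter (\<lambda>i. \<not> ?P i) [0..<length ns])"
      using s False by (simp only: nth_append if_False) (rule nth_mem)
    then show ?thesis using False len by simp
  qed
qed

lemma is_normal_perm_Cons_nonneg:
  assumes "is_normal_perm ns \<sigma>" "0 \<le> n"
  shows "is_normal_perm (n # ns) (lift_perm \<sigma> \<circ> front_cycle (length (filter (\<lambda>n. n < 0) ns)))"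
proof -
  let ?k = "length (filter (\<lambda>n. n < 0) ns)"
  let ?\<tau> = "lift_perm \<sigma> \<circ> front_cycle ?k"
  have p: "\<sigma> permutes {..<length ns}" using assms by (simp add: is_normal_perm_def)
  have k: "?k \<le> length ns" by simp
  have lt: "?\<tau> i = Suc (\<sigma> i)" if "i < ?k" for i
    using that by (simp add: front_cycle_def lift_perm_def)
  have eq: "?\<tau> ?k = 0" by (simp add: front_cycle_def lift_perm_def)
  have gt: "?\<tau> (Suc i) = Suc (\<sigma> i)" if "?k \<le> i" for i
    using that by (simp add: front_cycle_def lift_perm_def)
  have neg: "(n # ns) ! ?\<tau> i < 0 \<longleftrightarrow> i < ?k" if "i < Suc (length ns)" for i
  proof -
    consider "i < ?k" | "i = ?k" | "?k < i" by linarith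
    then show ?thesis
    proof cases
      case 1
      then show ?thesis using normal_perm_neg_iff[OF assms(1), of i] lt[OF 1] k by simp
    next
      case 2
      then show ?thesis using eq assms(2) by simp
    next
      case 3
      then obtain i' where 3: "i = Suc i'" "?k \<le> i'" by (cases i) auto
      then show ?thesis using normal_perm_neg_iff[OF assms(1), of i'] gt[OF 3(2)] that by simp
    qed
  qed
  have ord: "\<sigma> i < \<sigma> j" if "i < j" "j < length ns" "ns ! \<sigma> i < 0 \<longleftrightarrow> ns ! \<sigma> j < 0" for i j
    using assms(1) that by (auto simp: is_normal_perm_def)
  show ?thesis
    unfolding is_normal_perm_def
  proof (intro conjI allI impI)
    have "front_cycle ?k permutes {..<Suc (length ns)}"
      by (rule permutes_subset[OF conjunct1[OF front_cycle]]) (auto simp: less_Suc_eq_le intro: order_trans[OF _ length_filter_le])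
    then show "?\<tau> permutes {..<length (n # ns)}"
      using permutes_compose lift_perm(1)[OF p] by auto
    fix j i assume ij: "j < length (n # ns)" "i < j"
    then have ij': "i < Suc (length ns)" "j < Suc (length ns)" by auto
    show "\<not> (0 \<le> (n # ns) ! ?\<tau> i \<and> (n # ns) ! ?\<tau> j < 0)"
      using neg[OF ij'(1)] neg[OF ij'(2)] ij(2) by linarith
    assume "((n # ns) ! ?\<tau> i < 0) = ((n # ns) ! ?\<tau> j < 0)"
    then have same: "i < ?k \<longleftrightarrow> j < ?k" using neg[OF ij'(1)] neg[OF ij'(2)] by simp
    show "?\<tau> i < ?\<tau> j"
    proof (cases "j < ?k")
      case True
      then have len: "j < length ns" using k by linarith
      then have "i < length ns" using ij(2) by linarith
      then have "ns ! \<sigma> i < 0 \<longleftrightarrow> ns ! \<sigma> j < 0"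
        using same len normal_perm_neg_iff[OF assms(1)] by simp
      then have "\<sigma> i < \<sigma> j" by (rule ord[OF ij(2) len])
      then show ?thesis using True same by (simp only: lt Suc_less_eq)
    next
      case False
      then obtain j' where j: "j = Suc j'" "?k \<le> j'" using ij(2) same
        by (cases j) auto
      show ?thesis
      proof (cases "i = ?k")
        case True
        then show ?thesis by (simp only: j gt[OF j(2)] eq zero_less_Suc)
      next
        case ne: False
        then obtain i' where i: "i = Suc i'" "?k \<le> i'" using False same
          by (cases i) auto
        have "\<sigma> i' < \<sigma> j'" using i j ij
          by (intro ord) (simp_all add: normal_perm_neg_iff[OF assms(1)])
        then show ?thesis by (simp only: i(1) j(1) gt[OF i(2)] gt[OF j(2)] Suc_less_eq)
      qed
    qed
  qed
qed

lemma is_normal_perm_ex: "\<exists>\<sigma>. is_normal_perm ns \<sigma>"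
proof (induction ns)
  case Nil
  have "is_normal_perm [] id" by (simp add: is_normal_perm_def permutes_id)
  then show ?case by blast
next
  case (Cons n ns)
  then obtain \<sigma> where "is_normal_perm ns \<sigma>" by blast
  then show ?case
    using is_normal_perm_Cons_neg[of ns \<sigma> n] is_normal_perm_Cons_nonneg[of ns \<sigma> n]
    by (cases "n < 0") (blast, force)
qed

lemma is_normal_perm_normal_perm: "is_normal_perm ns (normal_perm ns)"
proof -
  obtain \<sigma> where "is_normal_perm ns \<sigma>" using is_normal_perm_ex by blast
  then show ?thesis by (simp add: normal_perm_eq)
qed

lemma normal_perm_permutes: "normal_perm ns permutes {..<length ns}"
  using is_normal_perm_normal_perm[of ns] by (simp add: is_normal_perm_def)

lemma sign_normal_perm_Nil: "sign (normal_perm []) = 1"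
proof -
  have "is_normal_perm [] id" by (simp add: is_normal_perm_def permutes_id)
  then show ?thesis by (simp add: normal_perm_eq)
qed

lemma sign_normal_perm_neg: "n < 0 \<Longrightarrow> sign (normal_perm (n # ns)) = sign (normal_perm ns)"
  using normal_perm_eq[OF is_normal_perm_Cons_neg[OF is_normal_perm_normal_perm]]
    lift_perm(2)[OF normal_perm_permutes] by simp

lemma sign_normal_perm_nonneg:
  assumes "0 \<le> n"
  shows "sign (normal_perm (n # ns)) = (-1) ^ length (filter (\<lambda>n. n < 0) ns) * sign (normal_perm ns)"
proof -
  let ?k = "length (filter (\<lambda>n. n < 0) ns)"
  have "permutation (lift_perm (normal_perm ns))"
    by (rule permutes_imp_permutation[OF _ lift_perm(1)[OF normal_perm_permutes]]) simp
  moreover have "permutation (front_cycle ?k)"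
    by (rule permutes_imp_permutation[of "{..?k}"]) (simp_all add: front_cycle)
  ultimately show ?thesis
    unfolding normal_perm_eq[OF is_normal_perm_Cons_nonneg[OF is_normal_perm_normal_perm assms]]
    by (simp add: sign_compose lift_perm(2)[OF normal_perm_permutes] front_cycle)
qed

lemma map_nth_normal_perm:
  assumes "length hs = length ns"
  shows "map (\<lambda>i. (hs ! normal_perm ns i, ns ! normal_perm ns i)) [0..<length ns] =
    filter (\<lambda>(h, n). n < 0) (zip hs ns) @ filter (\<lambda>(h, n). \<not> n < 0) (zip hs ns)"
proof -
  let ?z = "\<lambda>i. (hs ! i, ns ! i)"
  have z: "map ?z [0..<length ns] = zip hs ns"
    using assms by (intro nth_equalityI) simp_all
  have f: "map ?z (filter (\<lambda>i. P (ns ! i)) [0..<length ns]) = filter (\<lambda>(h, n). P n) (zip hs ns)" for P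
    unfolding z[symmetric] by (simp add: filter_map comp_def)
  have "map (\<lambda>i. (hs ! normal_perm ns i, ns ! normal_perm ns i)) [0..<length ns] =
    map ?z (map (normal_perm ns) [0..<length ns])" by simp
  also have "\<dots> = map ?z (filter (\<lambda>i. ns ! i < 0) [0..<length ns]) @
      map ?z (filter (\<lambda>i. \<not> ns ! i < 0) [0..<length ns])"
    by (simp only: normal_perm_list[OF is_normal_perm_normal_perm] map_append)
  finally show ?thesis by (simp only: f[of "\<lambda>n. n < 0"] f[of "\<lambda>n. \<not> n < 0"])
qed

section \<open>Normally ordered products on words\<close>

context contraction
begin

definition mode :: "'h \<times> int \<Rightarrow> ('h \<times> nat) free_alg \<Rightarrow> ('h \<times> nat) free_alg" where
  "mode = (\<lambda>(h, n) x. if n < 0 then monomial [(h, nat (- n - 1))] * x else con h (nat n) x)"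

lemma flin_mode: "flin (mode l)"
  by (cases l) (simp add: mode_def flin_def distrib_left)

lemma flin_foldr_mode: "flin (foldr mode ls)"
proof (induction ls)
  case Nil
  then show ?case by (simp add: flin_def)
next
  case (Cons l ls)
  then show ?case using flin_compose[OF flin_mode Cons, of l] by (simp add: comp_def)
qed

text \<open>The order of the factors is given by filtering, justified by
  \<open>map_nth_normal_perm\<close>; the permutation survives only in the sign.\<close>

definition NP :: "('h \<times> int) list \<Rightarrow> ('h \<times> nat) free_alg \<Rightarrow> ('h \<times> nat) free_alg" where
  "NP ls x = of_int (sign (normal_perm (map snd ls))) *\<^sub>F
     foldr mode (filter (\<lambda>(h, n). n < 0) ls @ filter (\<lambda>(h, n). \<not> n < 0) ls) x"

lemma NP_Nil: "NP [] x = x"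
  by (simp add: NP_def sign_normal_perm_Nil)

lemma NP_Cons_neg: "n < 0 \<Longrightarrow> NP ((h, n) # ls) x = mode (h, n) (NP ls x)"
  by (simp add: NP_def sign_normal_perm_neg flin_scale[OF flin_mode])

lemma foldr_mode_anticommute:
  assumes "0 \<le> n" "\<forall>l\<in>set ls. 0 \<le> snd l"
  shows "mode (h, n) (foldr mode ls x) = (-1) ^ length ls *\<^sub>F foldr mode ls (mode (h, n) x)"
  using assms(2)
proof (induction ls)
  case (Cons l ls)
  obtain g k where l: "l = (g, k)" by (cases l)
  then have "mode (h, n) (mode l y) = - mode l (mode (h, n) y)" for y
    using assms(1) Cons.prems by (simp add: mode_def) (rule con_con)
  then show ?case using Cons by (simp add: flin_scale[OF flin_mode] fscale_minus_left)
qed simp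

text \<open>The permutation sign accounts for passing the negative modes,
  \<open>foldr_mode_anticommute\<close> for passing the nonnegative ones. Together the sign depends
  only on the length of \<open>ls\<close>, as the recursion \<open>Yw\<close> requires.\<close>

lemma NP_Cons_nonneg:
  assumes "0 \<le> n"
  shows "NP ((h, n) # ls) x = (-1) ^ length ls *\<^sub>F NP ls (mode (h, n) x)"
proof -
  let ?neg = "filter (\<lambda>(h, n). n < 0) ls" and ?pos = "filter (\<lambda>(h, n). \<not> n < (0::int)) ls"
  let ?k = "length ?neg"
  have c: "(\<lambda>n. n < 0) \<circ> snd = (\<lambda>(h, n). n < (0::int))" by auto
  have k: "length (filter (\<lambda>n. n < 0) (map snd ls)) = ?k"
    by (simp only: filter_map length_map c)
  have len: "length ls = ?k + length ?pos"
    using sum_length_filter_compl[of "\<lambda>(h, n). n < 0" ls] by (simp add: case_prod_unfold)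
  have "NP ((h, n) # ls) x = of_int (sign (normal_perm (map snd ((h, n) # ls)))) *\<^sub>F
      foldr mode ?neg (mode (h, n) (foldr mode ?pos x))"
    using assms by (simp add: NP_def)
  also have "sign (normal_perm (map snd ((h, n) # ls))) = (-1) ^ ?k * sign (normal_perm (map snd ls))"
    using sign_normal_perm_nonneg[OF assms, of "map snd ls"] by (simp only: list.map snd_conv k)
  also have "mode (h, n) (foldr mode ?pos x) = (-1) ^ length ?pos *\<^sub>F foldr mode ?pos (mode (h, n) x)"
    by (rule foldr_mode_anticommute[OF assms]) auto
  also have "of_int ((-1) ^ ?k * sign (normal_perm (map snd ls))) *\<^sub>F
      foldr mode ?neg ((-1) ^ length ?pos *\<^sub>F foldr mode ?pos (mode (h, n) x)) =
      (-1) ^ (?k + length ?pos) *\<^sub>F NP ls (mode (h, n) x)"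
    unfolding flin_scale[OF flin_foldr_mode] NP_def foldr_append comp_apply fscale_fscale power_add
    by (simp add: mult_ac)
  finally show ?thesis unfolding len .
qed

text \<open>Extended by 0 to index lists of the wrong length or degree, so that the sum can run over
  all lists.\<close>

definition series_term :: "('h \<times> nat) list \<Rightarrow> int \<Rightarrow> ('h \<times> nat) free_alg \<Rightarrow> int list \<Rightarrow> ('h \<times> nat) free_alg" where
  "series_term hms k x ns =
     (if length ns = length hms \<and> (\<Sum>i<length hms. - (ns ! i) - int (snd (hms ! i)) - 1) = k
      then (\<Prod>i<length hms. of_int (- (ns ! i) - 1) gchoose snd (hms ! i)) *\<^sub>F
             NP (zip (map fst hms) ns) x
      else 0)"

lemma series_term_Nil: "series_term [] k x ns = (if ns = [] \<and> k = 0 then x else 0)"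
  by (auto simp: series_term_def NP_Nil)

lemma series_term_Cons_Nil: "series_term (l # hms) k x [] = 0"
  by (simp add: series_term_def)

lemma flin_NP: "flin (NP ls)"
  unfolding NP_def by (intro flin_scale_fun flin_foldr_mode)

lemma series_term_zero: "series_term hms k 0 ns = 0"
  by (simp add: series_term_def flin_zero[OF flin_NP])

lemma series_term_Cons:
  "series_term ((h, m) # hms) k x (n # ns) = (of_int (- n - 1) gchoose m) *\<^sub>F
     (if n < 0 then mode (h, n) (series_term hms (k + n + int m + 1) x ns)
      else (-1) ^ length hms *\<^sub>F series_term hms (k + n + int m + 1) (mode (h, n) x) ns)"
proof -
  let ?r = "length hms"
  have deg: "(\<Sum>i<Suc ?r. - ((n # ns) ! i) - int (snd (((h, m) # hms) ! i)) - 1) = k \<longleftrightarrow>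
      (\<Sum>i<?r. - (ns ! i) - int (snd (hms ! i)) - 1) = k + n + int m + 1"
    by (simp only: sum.lessThan_Suc_shift) auto
  have prod: "(\<Prod>i<Suc ?r. of_int (- ((n # ns) ! i) - 1) gchoose snd (((h, m) # hms) ! i) :: complex) =
      (of_int (- n - 1) gchoose m) * (\<Prod>i<?r. of_int (- (ns ! i) - 1) gchoose snd (hms ! i))"
    by (simp only: prod.lessThan_Suc_shift) simp
  show ?thesis
    by (cases "n < 0")
       (simp_all add: series_term_def deg prod NP_Cons_neg NP_Cons_nonneg flin_scale[OF flin_mode]
          flin_zero[OF flin_mode] mult_ac
          del: sum.lessThan_Suc prod.lessThan_Suc of_int_minus of_int_diff)
qed

lemma wt_in_mode: "wt_in S x \<Longrightarrow> wt_in {s. s + (2 * n + 1) \<in> S} (mode (h, n) x)"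
proof (cases "n < 0")
  case True
  assume "wt_in S x"
  from wt_in_letter[OF this, of "nat (- n - 1)" h] show ?thesis
    using True by (auto simp: mode_def algebra_simps intro: wt_in_mono)
next
  case False
  assume "wt_in S x"
  from wt_in_con[OF this, of "nat n" h] show ?thesis
    using False by (simp add: mode_def)
qed

lemma wt_in_series_term:
  "wt_in {..K} x \<Longrightarrow> wt_in {..K + double_weight hms + 2 * k} (series_term hms k x ns)"
proof (induction hms arbitrary: k x ns K)
  case Nil
  then show ?case by (simp add: series_term_Nil)
next
  case (Cons l hms)
  obtain h m where l: "l = (h, m)" by (cases l)
  show ?case
  proof (cases ns)
    case Nil
    then show ?thesis by (simp add: series_term_Cons_Nil)
  next
    case (Cons n ns')
    have 1: "wt_in {..K + double_weight (l # hms) + 2 * k}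
        (mode (h, n) (series_term hms (k + n + int m + 1) x ns'))"
      by (rule wt_in_mono[OF wt_in_mode[OF Cons.IH[OF Cons.prems, of "k + n + int m + 1" ns']]])
         (auto simp: l)
    have "wt_in {..K - (2 * n + 1)} (mode (h, n) x)"
      by (rule wt_in_mono[OF wt_in_mode[OF Cons.prems]]) auto
    then have 2: "wt_in {..K + double_weight (l # hms) + 2 * k}
        (series_term hms (k + n + int m + 1) (mode (h, n) x) ns')"
      by (intro wt_in_mono[OF Cons.IH]) (auto simp: l)
    show ?thesis unfolding Cons l series_term_Cons
      using 1 2 by (auto simp: l intro!: wt_in_scale)
  qed
qed

lemma flin_Sum_any:
  assumes "flin f" "finite {i. g i \<noteq> 0}"
  shows "f (Sum_any g) = Sum_any (\<lambda>i. f (g i))"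
proof -
  have "Sum_any (\<lambda>i. f (g i)) = (\<Sum>i\<in>{i. g i \<noteq> 0}. f (g i))"
    using assms by (intro Sum_any.expand_superset) (auto simp: flin_zero)
  then show ?thesis using assms by (simp add: Sum_any.expand_set flin_sum)
qed

lemma Sum_any_lists:
  fixes f :: "'a list \<Rightarrow> 'b::comm_monoid_add"
  assumes "f [] = 0" "finite R" "\<And>n ns. n \<notin> R \<Longrightarrow> f (n # ns) = 0"
    and fin: "\<And>n. n \<in> R \<Longrightarrow> finite {ns. f (n # ns) \<noteq> 0}"
  shows "finite {ns. f ns \<noteq> 0}" "Sum_any f = (\<Sum>n\<in>R. Sum_any (\<lambda>ns. f (n # ns)))"
proof -
  let ?S = "\<lambda>n. (#) n ` {ns. f (n # ns) \<noteq> 0}"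
  have eq: "{ns. f ns \<noteq> 0} = (\<Union>n\<in>R. ?S n)"
  proof (intro equalityI subsetI)
    fix ns assume "ns \<in> {ns. f ns \<noteq> 0}"
    then show "ns \<in> (\<Union>n\<in>R. ?S n)" using assms(1,3) by (cases ns) auto
  qed auto
  then show "finite {ns. f ns \<noteq> 0}" using assms(2) fin by simp
  have "Sum_any f = (\<Sum>n\<in>R. \<Sum>ns\<in>?S n. f ns)"
    unfolding Sum_any.expand_set eq using assms(2) fin by (intro sum.UNION_disjoint) auto
  also have "\<dots> = (\<Sum>n\<in>R. Sum_any (\<lambda>ns. f (n # ns)))"
  proof (rule sum.cong[OF refl])
    fix n
    show "(\<Sum>ns\<in>?S n. f ns) = Sum_any (\<lambda>ns. f (n # ns))"
      unfolding Sum_any.expand_set by (simp add: sum.reindex)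
  qed
  finally show "Sum_any f = (\<Sum>n\<in>R. Sum_any (\<lambda>ns. f (n # ns)))" .
qed

text \<open>The bridge from the normally ordered series to the recursion \<open>Yw\<close>:
  splitting off the first index separates the creation part from the contractions.\<close>

lemma Sum_any_series_term:
  "finite {ns. series_term hms k x ns \<noteq> 0} \<and> Sum_any (series_term hms k x) = Yw hms k x"
proof (induction hms arbitrary: k x)
  case Nil
  have "series_term [] k x = (\<lambda>ns. (if k = 0 then x else 0) when ns = [])"
    by (auto simp: series_term_Nil when_def)
  moreover have "finite {ns. series_term [] k x ns \<noteq> 0}"
    by (rule finite_subset[of _ "{[]}"]) (auto simp: series_term_Nil)
  ultimately show ?case by simp
next
  case (Cons l hms)
  obtain h m where l: "l = (h, m)" by (cases l)
  obtain K where K: "wt_in {..K} x" using wt_in_bound[of x] by blast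
  obtain N where N: "K + double_weight hms + 2 * k < 2 * int N" "K \<le> 2 * int N" "0 < N"
    using ex_nat_large by blast
  let ?f = "series_term ((h, m) # hms) k x"
  \<comment> \<open>The relevant first indices. In \<open>?A\<close> the mode \<open>-i-1\<close>
    has coefficient \<open>i gchoose m\<close>, which is 0 for \<open>i < m\<close>; the remaining
    \<open>N\<close> values are the creation terms \<open>i = k + m\<close>. \<open>?B\<close> holds
    the contractions.\<close>
  let ?A = "(\<lambda>i. - int i - 1) ` {..<N + m}" and ?B = "int ` {..<N}"
  have fin: "finite {ns. ?f (n # ns) \<noteq> 0}" for n
  proof -
    have "{ns. ?f (n # ns) \<noteq> 0} \<subseteq> {ns. series_term hms (k + n + int m + 1) x ns \<noteq> 0} \<union>
        {ns. series_term hms (k + n + int m + 1) (mode (h, n) x) ns \<noteq> 0}"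
      by (auto simp: series_term_Cons flin_zero[OF flin_mode] split: if_splits)
    then show ?thesis using Cons finite_subset by blast
  qed
  have out: "?f (n # ns) = 0" if n: "n \<notin> ?A \<union> ?B" for n ns
  proof (cases "n < 0")
    case True
    have "n + int N + int m < 0"
    proof (rule ccontr)
      assume "\<not> n + int N + int m < 0"
      then have "n = - int (nat (- n - 1)) - 1 \<and> nat (- n - 1) < N + m" using True by auto
      then show False using n by blast
    qed
    then have "series_term hms (k + n + int m + 1) x ns = 0"
      using N(1) by (intro wt_in_neg[OF wt_in_series_term[OF K]]) simp
    then show ?thesis using True by (simp add: series_term_Cons flin_zero[OF flin_mode])
  next
    case False
    have "int N \<le> n"
    proof (rule ccontr)
      assume "\<not> int N \<le> n"
      then have "n = int (nat n) \<and> nat n < N" using False by auto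
      then show False using n by blast
    qed
    then have "con h (nat n) x = 0" using N(2) by (intro con_eq_0[OF K]) simp
    then show ?thesis using False by (simp add: series_term_Cons mode_def series_term_zero)
  qed
  have AB: "finite (?A \<union> ?B)" by simp
  have L1: "finite {ns. ?f ns \<noteq> 0}"
    by (rule Sum_any_lists(1)[where R = "?A \<union> ?B"]) (rule series_term_Cons_Nil, rule AB, erule out, rule fin)
  have L2: "Sum_any ?f = (\<Sum>n\<in>?A \<union> ?B. Sum_any (\<lambda>ns. ?f (n # ns)))"
    by (rule Sum_any_lists(2)[where R = "?A \<union> ?B"]) (rule series_term_Cons_Nil, rule AB, erule out, rule fin)
  have neg: "Sum_any (\<lambda>ns. ?f ((- int i - 1) # ns)) =
      (of_nat i gchoose m) *\<^sub>F (monomial [(h, i)] * Yw hms (k - int i + int m) x)" for i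
  proof -
    have "(\<lambda>ns. ?f ((- int i - 1) # ns)) = (\<lambda>ns. (of_nat i gchoose m) *\<^sub>F
        (monomial [(h, i)] * series_term hms (k - int i + int m) x ns))"
      by (rule ext) (simp add: series_term_Cons mode_def algebra_simps)
    then have "Sum_any (\<lambda>ns. ?f ((- int i - 1) # ns)) = Sum_any (\<lambda>ns. (of_nat i gchoose m) *\<^sub>F
        (monomial [(h, i)] * series_term hms (k - int i + int m) x ns))" by (rule arg_cong)
    also have "\<dots> = (of_nat i gchoose m) *\<^sub>F
        (monomial [(h, i)] * Sum_any (series_term hms (k - int i + int m) x))"
      by (rule flin_Sum_any[symmetric, OF flin_scale_fun[OF flin_mult_left[OF flin_ident]]])
         (rule conjunct1[OF Cons])
    finally show ?thesis by (simp only: conjunct2[OF Cons])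
  qed
  have nonneg: "Sum_any (\<lambda>ns. ?f (int i # ns)) =
      (cminus m i * (-1) ^ length hms) *\<^sub>F Yw hms (k + int i + int m + 1) (con h i x)" for i
  proof -
    have "(\<lambda>ns. ?f (int i # ns)) = (\<lambda>ns. (cminus m i * (-1) ^ length hms) *\<^sub>F
        series_term hms (k + int i + int m + 1) (con h i x) ns)"
      by (rule ext) (simp add: series_term_Cons mode_def cminus_def)
    then have "Sum_any (\<lambda>ns. ?f (int i # ns)) = Sum_any (\<lambda>ns. (cminus m i * (-1) ^ length hms) *\<^sub>F
        series_term hms (k + int i + int m + 1) (con h i x) ns)" by (rule arg_cong)
    also have "\<dots> = (cminus m i * (-1) ^ length hms) *\<^sub>F
        Sum_any (series_term hms (k + int i + int m + 1) (con h i x))"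
      by (rule flin_Sum_any[symmetric, OF flin_scale_fun[OF flin_ident]]) (rule conjunct1[OF Cons])
    finally show ?thesis by (simp only: conjunct2[OF Cons])
  qed
  have "(\<Sum>n\<in>?A. Sum_any (\<lambda>ns. ?f (n # ns))) =
      (\<Sum>i<N + m. Sum_any (\<lambda>ns. ?f ((- int i - 1) # ns)))"
    by (rule sum.reindex_cong[of "\<lambda>i. - int i - 1"]) (simp_all add: inj_on_def)
  also have "\<dots> = (\<Sum>i<N + m. (of_nat i gchoose m) *\<^sub>F (monomial [(h, i)] * Yw hms (k - int i + int m) x))"
    by (simp only: neg)
  also have "\<dots> = (\<Sum>i\<in>{m..<N + m}. (of_nat i gchoose m) *\<^sub>F (monomial [(h, i)] * Yw hms (k - int i + int m) x))"
    by (rule sum.mono_neutral_right) (auto simp: binomial_eq_0 simp flip: binomial_gbinomial)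
  also have "\<dots> = (\<Sum>i<N. cplus m i *\<^sub>F (monomial [(h, i + m)] * Yw hms (k - int i) x))"
    using sum.shift_bounds_nat_ivl[of "\<lambda>i. (of_nat i gchoose m) *\<^sub>F (monomial [(h, i)] * Yw hms (k - int i + int m) x)" 0 m N]
    by (simp add: lessThan_atLeast0 cplus_def binomial_gbinomial)
  finally have A: "(\<Sum>n\<in>?A. Sum_any (\<lambda>ns. ?f (n # ns))) =
      (\<Sum>i<N. cplus m i *\<^sub>F (monomial [(h, i + m)] * Yw hms (k - int i) x))" .
  have B: "(\<Sum>n\<in>?B. Sum_any (\<lambda>ns. ?f (n # ns))) =
      (-1) ^ length hms *\<^sub>F (\<Sum>i<N. cminus m i *\<^sub>F Yw hms (k + int i + int m + 1) (con h i x))"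
  proof -
    have "(\<Sum>n\<in>?B. Sum_any (\<lambda>ns. ?f (n # ns))) = (\<Sum>i<N. Sum_any (\<lambda>ns. ?f (int i # ns)))"
      by (rule sum.reindex_cong[of int]) (simp_all add: inj_on_def)
    also have "\<dots> = (\<Sum>i<N. ((-1) ^ length hms * cminus m i) *\<^sub>F Yw hms (k + int i + int m + 1) (con h i x))"
      by (simp only: nonneg mult.commute)
    finally show ?thesis by (simp only: fscale_sum_right fscale_fscale)
  qed
  have "?A \<inter> ?B = {}" by auto
  then have U: "(\<Sum>n\<in>?A \<union> ?B. Sum_any (\<lambda>ns. ?f (n # ns))) =
      (\<Sum>n\<in>?A. Sum_any (\<lambda>ns. ?f (n # ns))) + (\<Sum>n\<in>?B. Sum_any (\<lambda>ns. ?f (n # ns)))"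
    by (intro sum.union_disjoint) simp_all
  have "Sum_any ?f = (\<Sum>n\<in>?A. Sum_any (\<lambda>ns. ?f (n # ns))) + (\<Sum>n\<in>?B. Sum_any (\<lambda>ns. ?f (n # ns)))"
    by (rule trans[OF L2 U])
  also have "\<dots> = Yw ((h, m) # hms) k x"
    unfolding A B by (rule Yw_Cons[OF K N(1,2), symmetric])
  finally show ?case using L1 by (simp add: l del: Yw.simps)
qed

end

section \<open>Vertex operators on classes\<close>

context polarized_space
begin

lemma V_mode_cls: "V_mode scale form h n (cls x) = cls (mode (h, n) x)"
proof (cases "n < 0")
  case True
  then have "n = - int (nat (- n - 1)) - 1" by simp
  then show ?thesis using V_mode_neg[of h "nat (- n - 1)" x] True by (simp add: mode_def)
next
  case False
  then show ?thesis using V_mode_pos[of h "nat n" x] by (simp add: mode_def)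
qed

lemma foldr_V_mode:
  "foldr (\<lambda>i. V_mode scale form (f i) (g i)) is (cls x) = cls (foldr mode (map (\<lambda>i. (f i, g i)) is) x)"
  by (induction "is") (simp_all add: V_mode_cls)

lemma normal_product_cls:
  assumes "length hs = length ns"
  shows "normal_product scale form hs ns (cls x) = cls (NP (zip hs ns) x)"
  unfolding normal_product_def Let_def foldr_V_mode map_nth_normal_perm[OF assms] cls_scale NP_def
  using assms by simp

text \<open>\<open>cls\<close> may kill nonzero terms, so the support in V can be smaller than that
  of \<open>g\<close>; the terms in between contribute the class 0.\<close>

lemma finsum_pi_support:
  assumes "finite {i. g i \<noteq> 0}" "\<And>i. i \<in> A \<longleftrightarrow> cls (g i) \<noteq> \<zero>\<^bsub>VA\<^esub>"
  shows "(\<Oplus>\<^bsub>VA\<^esub>i\<in>A. cls (g i)) = cls (Sum_any g)"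
proof -
  have A: "A \<subseteq> {i. g i \<noteq> 0}" using assms(2) by (auto simp: cls_zero)
  have "cls (\<Sum>i\<in>{i. g i \<noteq> 0} - A. g i) = \<zero>\<^bsub>VA\<^esub>"
    unfolding cls_sum[symmetric] using assms(2) by (intro VA.add.finprod_one_eqI) auto
  then have "cls (Sum_any g) = cls (\<Sum>i\<in>A. g i)"
    unfolding Sum_any.expand_set sum.subset_diff[OF A assms(1)] cls_add[symmetric]
    by (simp add: cls_add cls_zero)
  then show ?thesis by (simp add: cls_sum)
qed

lemma normal_series_cls: "normal_series scale form hms k (cls x) = cls (Yw hms k x)"
proof -
  let ?r = "length hms"
  let ?D = "\<lambda>ns. length ns = ?r \<and> (\<Sum>i<?r. - (ns ! i) - int (snd (hms ! i)) - 1) = k"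
  define t where "t ns = (\<Prod>i<?r. of_int (- (ns ! i) - 1) gchoose snd (hms ! i)) \<odot>\<^bsub>VA\<^esub>
      normal_product scale form (map fst hms) ns (cls x)" for ns
  have t: "t ns = cls (series_term hms k x ns)" if "?D ns" for ns
    using that by (simp add: t_def normal_product_cls cls_scale series_term_def)
  have "normal_series scale form hms k (cls x) =
      (\<Oplus>\<^bsub>VA\<^esub>ns\<in>{ns. length ns = ?r \<and> (\<Sum>i<?r. - (ns ! i) - int (snd (hms ! i)) - 1) = k \<and>
        t ns \<noteq> \<zero>\<^bsub>VA\<^esub>}. t ns)"
    by (simp add: normal_series_def Let_def t_def)
  also have "\<dots> = (\<Oplus>\<^bsub>VA\<^esub>ns\<in>{ns. cls (series_term hms k x ns) \<noteq> \<zero>\<^bsub>VA\<^esub>}. cls (series_term hms k x ns))"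
  proof (rule VA.finsum_cong')
    show "{ns. length ns = ?r \<and> (\<Sum>i<?r. - (ns ! i) - int (snd (hms ! i)) - 1) = k \<and> t ns \<noteq> \<zero>\<^bsub>VA\<^esub>} =
        {ns. cls (series_term hms k x ns) \<noteq> \<zero>\<^bsub>VA\<^esub>}"
      using t by (auto simp: series_term_def cls_zero)
    show "t ns = cls (series_term hms k x ns)" if "ns \<in> {ns. cls (series_term hms k x ns) \<noteq> \<zero>\<^bsub>VA\<^esub>}" for ns
      using that by (intro t) (auto simp: series_term_def cls_zero split: if_splits)
  qed simp
  also have "\<dots> = cls (Sum_any (series_term hms k x))"
    by (rule finsum_pi_support) (use Sum_any_series_term in auto)
  finally show ?thesis using Sum_any_series_term[of hms k x] by simp
qed

text \<open>Classes of words span V, so linearity in the first argument and the prescribed values on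
  words leave no freedom on the carrier.\<close>

lemma vertex_map_cls:
  assumes Y: "is_vertex_map scale form Y"
  shows "Y (cls u) n (cls v) = cls (Y0 u n v)"
proof (induction u rule: free_alg_induct)
  case zero
  have "Y (0 \<odot>\<^bsub>VA\<^esub> cls 0) n (cls v) = 0 \<odot>\<^bsub>VA\<^esub> Y (cls 0) n (cls v)"
    using Y by (simp add: is_vertex_map_def Let_def)
  moreover have "Y (cls 0) n (cls v) \<in> range cls"
    using Y by (simp add: is_vertex_map_def Let_def flip: carrier_VA_cls)
  ultimately show ?case by (auto simp: cls_scale)
next
  case (monomial us)
  have "Y (V_word scale form us) n (cls v) = normal_series scale form us n (cls v)"
    using Y by (simp add: is_vertex_map_def Let_def)
  then show ?case by (simp add: V_word_cls normal_series_cls Y0_monomial)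
next
  case (add x y)
  have "Y (cls x \<oplus>\<^bsub>VA\<^esub> cls y) n (cls v) = Y (cls x) n (cls v) \<oplus>\<^bsub>VA\<^esub> Y (cls y) n (cls v)"
    using Y by (simp add: is_vertex_map_def Let_def)
  then show ?case using add by (simp add: cls_add)
next
  case (scale c x)
  have "Y (c \<odot>\<^bsub>VA\<^esub> cls x) n (cls v) = c \<odot>\<^bsub>VA\<^esub> Y (cls x) n (cls v)"
    using Y by (simp add: is_vertex_map_def Let_def)
  then show ?case using scale by (simp add: cls_scale)
qed

subsection \<open>Existence of the vertex operator map\<close>

lemma hmode_add: "hmode (g + h) n = hmode g n + hmode h n"
  by (simp add: hmode_def single_add)

lemma hmode_scale: "hmode (scale c h) n = hhat_scale scale c (hmode h n)"
  by (simp add: hmode_def hhat_scale_def map_scale_single)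

lemma cls_lam: "cls (lam h m * y) = cls (monomial [(h, m)] * y)"
proof -
  let ?n = "- int m - 1"
  have "nn (monomial [hmode (\<Sum>b\<in>A. scale (coef h b) b) ?n]) =
      nn (\<Sum>b\<in>A. coef h b *\<^sub>F monomial [hmode b ?n])" for A
  proof (induction A rule: infinite_finite_induct)
    case (insert b A)
    have "nn (monomial [hmode (scale (coef h b) b) ?n]) = nn (coef h b *\<^sub>F monomial [hmode b ?n])"
      unfolding hmode_scale by (rule nn_letter_scale)
    with insert show ?case by (simp add: hmode_add nn_letter_add nn_simps(1))
  qed (use nn_letter_zero in \<open>simp_all add: hmode_def zero_prod_def\<close>)
  from this[of basis] have "nn (monomial [hmode h ?n]) = nn (\<Sum>b\<in>basis. coef h b *\<^sub>F monomial [hmode b ?n])"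
    by (simp add: coef_sum)
  from q_cong_nn_right[OF this, of "iota y"]
  have "q (monomial [hmode h ?n] * iota y) = q (\<Sum>b\<in>basis. coef h b *\<^sub>F (monomial [hmode b ?n] * iota y))"
    by (simp add: sum_distrib_right)
  then show ?thesis
    by (simp add: cls_def lam_def sum_distrib_right iota_letter)
qed

lemma cls_nf: "cls (nf x) = cls x"
proof (induction x rule: free_alg_letter_induct)
  case (letter l x)
  obtain h m where l: "l = (h, m)" by (cases l)
  show ?case unfolding l nf_letter cls_lam V_mode_neg[symmetric] letter ..
next
  case (add x y)
  then show ?case by (simp flip: cls_add)
next
  case (scale c x)
  then show ?case by (simp flip: cls_scale)
qed simp_all

text \<open>The normal form is computed from the class, and it is itself a representative of that
  class. Equality in V thus becomes an equation in the free algebra.\<close>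

lemma cls_eq_iff: "cls x = cls y \<longleftrightarrow> nf x = nf y"
proof
  assume "nf x = nf y"
  then have "cls (nf x) = cls (nf y)" by (rule arg_cong)
  then show "cls x = cls y" by (simp only: cls_nf)
qed (rule nf_cong)

lemma nf_con: "nf (con h i x) = con h i (nf x)"
proof (induction x rule: free_alg_letter_induct)
  case (letter l x)
  obtain g j where l: "l = (g, j)" by (cases l)
  show ?case by (simp add: l con_letter nf_letter con_lam letter)
qed simp_all

lemma par_lam: "par (lam h m * y) = - (lam h m * par y)"
  by (simp add: lam_def sum_distrib_right fscale_minus_right sum_negf)

lemma nf_par: "nf (par x) = par (nf x)"
proof (induction x rule: free_alg_letter_induct)
  case (letter l x)
  then show ?case by (cases l) (simp add: nf_letter par_lam)
qed simp_all

text \<open>In \<open>Y0_letter\<close> the second argument enters through contractions and through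
  the inner operator; the former commute with \<open>nf\<close>, the latter is covered by
  induction.\<close>

lemma nf_Y0_right: "nf v = nf v' \<Longrightarrow> nf (Y0 u n v) = nf (Y0 u n v')"
proof (induction u arbitrary: n v v' rule: free_alg_par_induct)
  case one
  then show ?case by (simp add: Y0_one)
next
  case (letter l x)
  obtain h m where l: "l = (h, m)" by (cases l)
  obtain A where A: "wt_in {..A} x" using wt_in_bound[of x] by blast
  obtain K1 where K1: "wt_in {..K1} v" using wt_in_bound[of v] by blast
  obtain K2 where K2: "wt_in {..K2} v'" using wt_in_bound[of v'] by blast
  define K where "K = max K1 K2"
  have K: "wt_in {..K} v" "wt_in {..K} v'"
    by (rule wt_in_mono[OF K1], simp add: K_def, rule wt_in_mono[OF K2], simp add: K_def)
  obtain N where N: "A + K + 2 * n < 2 * int N" "K \<le> 2 * int N" "0 < N"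
    using ex_nat_large by blast
  have "nf (con h i v) = nf (con h i v')" for i using letter(3) by (simp add: nf_con)
  note IH = letter(1)[OF letter(3)] letter(2)[OF this]
  show ?case unfolding l Y0_letter[OF A K(1) N(1,2)] Y0_letter[OF A K(2) N(1,2)]
    by (simp only: nf_simps nf_letter IH)
next
  case (add x y)
  show ?case using add.IH[OF add.prems] by (simp only: Y0_simps nf_simps)
next
  case (scale c x)
  show ?case using scale.IH[OF scale.prems] by (simp only: Y0_simps nf_simps)
qed simp

text \<open>\<open>nf\<close> spreads the first letter over the basis. After a further
  \<open>nf\<close> its creation part enters through \<open>lam\<close> and the rest through
  \<open>con\<close>, both linear in \<open>h\<close>, so the sum over the basis can be collected
  again.\<close>

lemma nf_Y0_left: "nf (Y0 (nf u) n v) = nf (Y0 u n v)"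
proof (induction u arbitrary: n v rule: free_alg_par_induct)
  case (letter l x)
  obtain h m where l: "l = (h, m)" by (cases l)
  obtain A1 where A1: "wt_in {..A1} x" using wt_in_bound[of x] by blast
  obtain A2 where A2: "wt_in {..A2} (nf x)" using wt_in_bound[of "nf x"] by blast
  define A where "A = max A1 A2"
  have A: "wt_in {..A} x" "wt_in {..A} (nf x)"
    by (rule wt_in_mono[OF A1], simp add: A_def, rule wt_in_mono[OF A2], simp add: A_def)
  obtain K where K: "wt_in {..K} v" using wt_in_bound[of v] by blast
  obtain N where N: "A + K + 2 * n < 2 * int N" "K \<le> 2 * int N" "0 < N"
    using ex_nat_large by blast
  have IH: "nf (Y0 (nf x) c w) = nf (Y0 x c w)" "nf (Y0 (par (nf x)) c w) = nf (Y0 (par x) c w)" for c w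
    using letter(1)[of c w] letter(2)[of c w] by (simp_all only: nf_par)
  have "nf (Y0 (nf (monomial [l] * x)) n v) =
      (\<Sum>b\<in>basis. coef h b *\<^sub>F nf (Y0 (monomial [(b, m)] * nf x) n v))"
    by (simp add: l nf_letter lam_def sum_distrib_right)
  also have "\<dots> = (\<Sum>b\<in>basis. coef h b *\<^sub>F
      ((\<Sum>k<N. cplus m k *\<^sub>F (lam b (k + m) * nf (Y0 x (n - int k) v))) +
       (\<Sum>i<N. cminus m i *\<^sub>F nf (Y0 (par x) (n + int i + int m + 1) (con b i v)))))"
    unfolding Y0_letter[OF A(2) K N(1,2)] by (simp only: nf_simps nf_letter IH)
  also have "\<dots> = (\<Sum>b\<in>basis. \<Sum>k<N. coef h b *\<^sub>F cplus m k *\<^sub>F (lam b (k + m) * nf (Y0 x (n - int k) v))) +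
      (\<Sum>b\<in>basis. \<Sum>i<N. coef h b *\<^sub>F cminus m i *\<^sub>F nf (Y0 (par x) (n + int i + int m + 1) (con b i v)))"
    by (simp only: fscale_add_right fscale_sum_right sum.distrib)
  also have "(\<Sum>b\<in>basis. \<Sum>k<N. coef h b *\<^sub>F cplus m k *\<^sub>F (lam b (k + m) * nf (Y0 x (n - int k) v))) =
      (\<Sum>k<N. cplus m k *\<^sub>F (lam h (k + m) * nf (Y0 x (n - int k) v)))"
    by (subst sum.swap) (simp add: lam_basis lam_def[of h] sum_distrib_right fscale_sum_right mult.commute)
  also have "(\<Sum>b\<in>basis. \<Sum>i<N. coef h b *\<^sub>F cminus m i *\<^sub>F nf (Y0 (par x) (n + int i + int m + 1) (con b i v))) =
      (\<Sum>i<N. cminus m i *\<^sub>F nf (Y0 (par x) (n + int i + int m + 1) (con h i v)))"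
    by (subst sum.swap) (simp add: con_sum_left[of h] fscale_sum_right mult.commute)
  also have "(\<Sum>k<N. cplus m k *\<^sub>F (lam h (k + m) * nf (Y0 x (n - int k) v))) +
      (\<Sum>i<N. cminus m i *\<^sub>F nf (Y0 (par x) (n + int i + int m + 1) (con h i v))) = nf (Y0 (monomial [l] * x) n v)"
    unfolding l Y0_letter[OF A(1) K N(1,2)] by (simp only: nf_simps nf_letter)
  finally show ?case .
qed simp_all

definition vertex_map :: "'h vspace \<Rightarrow> int \<Rightarrow> 'h vspace \<Rightarrow> 'h vspace" where
  "vertex_map u n v = cls (Y0 (nu u) n (nu v))"

lemma vertex_map_on_cls: "vertex_map (cls u) n (cls v) = cls (Y0 u n v)"
proof -
  have "nf (nf v) = nf v" unfolding cls_eq_iff[symmetric] by (rule cls_nf)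
  then have "nf (Y0 (nf u) n (nf v)) = nf (Y0 u n v)"
    by (rule trans[OF nf_Y0_right nf_Y0_left])
  then show ?thesis by (simp add: vertex_map_def nu_cls cls_eq_iff)
qed

lemma is_vertex_map_vertex_map: "is_vertex_map scale form vertex_map"
proof -
  have "\<exists>n0. \<forall>n<n0. vertex_map (cls u) n (cls v) = \<zero>\<^bsub>VA\<^esub>" for u v
  proof -
    obtain B where "\<forall>n<B. Y0 u n v = 0" using Y0_truncated by blast
    then show ?thesis by (intro exI[of _ B]) (simp add: vertex_map_on_cls cls_zero)
  qed
  then show ?thesis
    unfolding is_vertex_map_def Let_def carrier_VA_cls
    by (auto simp: vertex_map_on_cls cls_add cls_scale V_word_cls normal_series_cls Y0_monomial)
qed

subsection \<open>The grading\<close>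

lemma generate_zero: "\<zero>\<^bsub>VA\<^esub> \<in> generate (add_monoid VA) S"
  using generate.one[of "add_monoid VA" S] by simp

lemma V_grading_cls: "V_grading scale form k = cls ` {x. wt_in {k} x}"
proof (intro equalityI subsetI)
  fix z assume "z \<in> V_grading scale form k"
  then show "z \<in> cls ` {x. wt_in {k} x}" unfolding V_grading_def
  proof induction
    case one
    then show ?case using cls_zero by (auto intro!: image_eqI[of _ _ 0])
  next
    case (incl z)
    then show ?case by (auto simp: V_word_cls cls_scale wt_in_scale wt_in_monomial intro!: imageI)
  next
    case (inv z)
    then obtain c us where z: "z = cls (c *\<^sub>F monomial us)" and us: "double_weight us = k"
      by (auto simp: V_word_cls cls_scale)
    have "inv\<^bsub>add_monoid VA\<^esub> z = cls ((- c) *\<^sub>F monomial us)"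
      using cls_uminus[of "c *\<^sub>F monomial us"] by (simp add: z a_inv_def fscale_minus_left)
    then show ?case using us by (auto simp: wt_in_scale wt_in_monomial)
  next
    case (eng z1 z2)
    then show ?case by (auto simp: cls_add intro!: imageI wt_in_add)
  qed
next
  fix z assume "z \<in> cls ` {x. wt_in {k} x}"
  then obtain x where z: "z = cls x" and x: "wt_in {k} x" by blast
  have "cls (\<Sum>l\<in>A. Poly_Mapping.lookup x l *\<^sub>F monomial (letters l)) \<in> V_grading scale form k"
    if "A \<subseteq> Poly_Mapping.keys x" for A
    using that
  proof (induction A rule: infinite_finite_induct)
    case (insert l A)
    then have "double_weight (letters l) = k" using x by (auto simp: wt_in_def)
    then have "cls (Poly_Mapping.lookup x l *\<^sub>F monomial (letters l)) \<in> V_grading scale form k"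
      unfolding V_grading_def cls_scale[symmetric] V_word_cls[symmetric] by (intro generate.incl) blast
    moreover have "cls (\<Sum>l\<in>A. Poly_Mapping.lookup x l *\<^sub>F monomial (letters l)) \<in> V_grading scale form k"
      using insert by simp
    ultimately have "cls (Poly_Mapping.lookup x l *\<^sub>F monomial (letters l)) \<otimes>\<^bsub>add_monoid VA\<^esub>
        cls (\<Sum>l\<in>A. Poly_Mapping.lookup x l *\<^sub>F monomial (letters l)) \<in> V_grading scale form k"
      unfolding V_grading_def by (rule generate.eng)
    then show ?case using insert by (simp add: cls_add)
  qed (simp_all add: V_grading_def generate_zero flip: cls_zero)
  from this[OF order_refl] show "z \<in> V_grading scale form k"
    unfolding z by (subst free_alg_expand)
qed

definition wcomp :: "int \<Rightarrow> ('h \<times> nat) free_alg \<Rightarrow> ('h \<times> nat) free_alg" where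
  "wcomp k = lin_ext (\<lambda>us. if double_weight us = k then monomial us else 0)"

definition wop :: "('h \<times> nat) free_alg \<Rightarrow> ('h \<times> nat) free_alg" where
  "wop = lin_ext (\<lambda>us. (of_int (double_weight us) / 2) *\<^sub>F monomial us)"

lemma flin_wcomp: "flin (wcomp k)"
  by (simp add: wcomp_def flin_lin_ext)

lemma flin_wop: "flin wop"
  by (simp add: wop_def flin_lin_ext)

lemmas wcomp_simps [simp] =
  flin_add[OF flin_wcomp] flin_scale[OF flin_wcomp] flin_zero[OF flin_wcomp] flin_sum[OF flin_wcomp]

lemmas wop_simps [simp] =
  flin_add[OF flin_wop] flin_scale[OF flin_wop] flin_zero[OF flin_wop]

lemma wt_in_wcomp: "wt_in {k} (wcomp k x)"
  by (induction x rule: free_alg_induct)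
     (auto simp: wt_in_add wt_in_scale wt_in_monomial wcomp_def)

lemma wcomp_homogeneous: "wt_in {k} x \<Longrightarrow> wcomp j x = (if j = k then x else 0)"
  by (induction rule: wt_in_induct) (auto simp: wcomp_def)

lemma wop_homogeneous: "wt_in {k} x \<Longrightarrow> wop x = (of_int k / 2) *\<^sub>F x"
  by (induction rule: wt_in_induct) (auto simp: wop_def fscale_add_right mult.commute)

lemma wt_components: "\<exists>K. finite K \<and> (\<forall>k. k \<notin> K \<longrightarrow> wcomp k x = 0) \<and> x = (\<Sum>k\<in>K. wcomp k x)"
proof -
  define K where "K = (\<lambda>l. double_weight (letters l)) ` Poly_Mapping.keys x"
  have x: "wt_in K x" by (auto simp: wt_in_def K_def)
  have "finite K" by (simp add: K_def)
  moreover have "k \<notin> K \<longrightarrow> wcomp k x = 0" for k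
    using x by (induction rule: wt_in_induct) (auto simp: wcomp_def)
  moreover have "(\<Sum>k\<in>K. wcomp k x) = x"
    using x
  proof (induction rule: wt_in_induct)
    case (monomial us)
    then show ?case using \<open>finite K\<close> by (simp add: wcomp_def)
  qed (simp_all add: sum.distrib flip: fscale_sum_right)
  ultimately show ?thesis by (intro exI[of _ K]) simp
qed

lemma wt_in_lam: "wt_in S x \<Longrightarrow> wt_in {s. s - (2 * int m + 1) \<in> S} (lam h m * x)"
  unfolding lam_def sum_distrib_right mult_fscale_left
  by (intro wt_in_sum wt_in_scale wt_in_letter)

text \<open>\<open>lam h m\<close> keeps the index \<open>m\<close> of the letter and changes only
  the vector. This makes the weight well defined on V.\<close>

lemma wt_in_nf: "wt_in S x \<Longrightarrow> wt_in S (nf x)"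
proof -
  have w: "wt_in {double_weight us} (nf (monomial us))" for us
  proof (induction us)
    case Nil
    show ?case using wt_in_monomial[of "{0}" "[] :: ('h \<times> nat) list"] by simp
  next
    case (Cons l us)
    obtain h m where l: "l = (h, m)" by (cases l)
    have "nf (monomial (l # us)) = lam h m * nf (monomial us)"
      using nf_letter[of h m "monomial us"] by (simp add: l)
    then show ?case
      by (simp only:, intro wt_in_mono[OF wt_in_lam[OF Cons]]) (auto simp: l)
  qed
  show "wt_in S x \<Longrightarrow> ?thesis"
    by (induction rule: wt_in_induct) (auto intro: wt_in_add wt_in_scale wt_in_mono[OF w])
qed

lemma wop_nf: "wop (nf x) = nf (wop x)"
proof (induction x rule: free_alg_induct)
  case (monomial us)
  have "wt_in {double_weight us} (monomial us)" by (simp add: wt_in_monomial)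
  then show ?case by (simp add: wop_homogeneous[OF wt_in_nf] wop_homogeneous)
qed simp_all

lemma decomposition_cls: "is_decomposition VA (V_grading scale form) (cls x) (\<lambda>k. cls (wcomp k (nf x)))"
  unfolding is_decomposition_def
proof (intro conjI allI)
  from wt_components[of "nf x"] obtain K where K: "finite K"
    "\<forall>k. k \<notin> K \<longrightarrow> wcomp k (nf x) = 0" "nf x = (\<Sum>k\<in>K. wcomp k (nf x))"
    by (elim exE conjE)
  have fin: "finite {k. wcomp k (nf x) \<noteq> 0}"
    by (rule finite_subset[OF _ K(1)]) (use K(2) in auto)
  show "cls (wcomp k (nf x)) \<in> V_grading scale form k" for k
    unfolding V_grading_cls using wt_in_wcomp by blast
  show "finite {k. cls (wcomp k (nf x)) \<noteq> \<zero>\<^bsub>VA\<^esub>}"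
    by (rule finite_subset[OF _ fin]) (auto simp: cls_zero)
  have "Sum_any (\<lambda>k. wcomp k (nf x)) = (\<Sum>k\<in>K. wcomp k (nf x))"
    using K(1,2) by (intro Sum_any.expand_superset) auto
  then have "Sum_any (\<lambda>k. wcomp k (nf x)) = nf x" by (simp only: K(3)[symmetric])
  moreover have "(\<Oplus>\<^bsub>VA\<^esub>k\<in>{k. cls (wcomp k (nf x)) \<noteq> \<zero>\<^bsub>VA\<^esub>}. cls (wcomp k (nf x))) =
      cls (Sum_any (\<lambda>k. wcomp k (nf x)))"
    by (rule finsum_pi_support[OF fin]) simp
  ultimately show "cls x = (\<Oplus>\<^bsub>VA\<^esub>k\<in>{k. cls (wcomp k (nf x)) \<noteq> \<zero>\<^bsub>VA\<^esub>}. cls (wcomp k (nf x)))"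
    by (simp add: cls_nf)
qed

text \<open>After applying \<open>nf\<close> the summands become homogeneous elements of the free
  algebra, where projection to weight \<open>j\<close> recovers the summand
  \<open>f j\<close>.\<close>

lemma decomposition_unique:
  assumes "is_decomposition VA (V_grading scale form) (cls x) f"
  shows "f = (\<lambda>k. cls (wcomp k (nf x)))"
proof
  fix j
  let ?A = "{k. f k \<noteq> \<zero>\<^bsub>VA\<^esub>}"
  have gr: "\<forall>k. \<exists>y. f k = cls y \<and> wt_in {k} y"
    using assms unfolding is_decomposition_def V_grading_cls by blast
  have fin: "finite ?A" and x: "cls x = (\<Oplus>\<^bsub>VA\<^esub>k\<in>?A. f k)"
    using assms by (simp_all add: is_decomposition_def)
  from choice[OF gr] obtain y where y: "\<forall>k. f k = cls (y k) \<and> wt_in {k} (y k)" by blast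
  have yw: "wt_in {k} (y k)" for k using y by blast
  have "f = (\<lambda>k. cls (y k))" using y by (intro ext) blast
  then have "(\<Oplus>\<^bsub>VA\<^esub>k\<in>?A. f k) = (\<Oplus>\<^bsub>VA\<^esub>k\<in>?A. cls (y k))"
    by (rule arg_cong[where f = "\<lambda>g. finsum VA g ?A"])
  then have "cls x = cls (\<Sum>k\<in>?A. y k)" unfolding x cls_sum .
  then have "nf x = (\<Sum>k\<in>?A. nf (y k))" by (simp add: cls_eq_iff)
  then have "wcomp j (nf x) = (\<Sum>k\<in>?A. wcomp j (nf (y k)))" by simp
  also have "\<dots> = (\<Sum>k\<in>?A. if j = k then nf (y j) else 0)"
    by (intro sum.cong refl) (simp add: wcomp_homogeneous[OF wt_in_nf[OF yw]])
  also have "\<dots> = (if f j \<noteq> \<zero>\<^bsub>VA\<^esub> then nf (y j) else 0)" using fin by simp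
  finally show "f j = cls (wcomp j (nf x))" using y by (auto simp: cls_nf cls_zero)
qed

lemma weight_operator_cls: "weight_operator VA (V_grading scale form) (cls x) = cls (wop x)"
proof -
  let ?f = "\<lambda>k. cls (wcomp k (nf x))"
  have the: "(THE f. is_decomposition VA (V_grading scale form) (cls x) f) = ?f"
    using decomposition_cls decomposition_unique by (rule the_equality)
  from wt_components[of "nf x"] obtain K where K: "finite K"
    "\<forall>k. k \<notin> K \<longrightarrow> wcomp k (nf x) = 0" "nf x = (\<Sum>k\<in>K. wcomp k (nf x))"
    by (elim exE conjE)
  let ?A = "{k. ?f k \<noteq> \<zero>\<^bsub>VA\<^esub>}"
  have A: "?A \<subseteq> K" using K(2) by (auto simp: cls_zero)
  have "weight_operator VA (V_grading scale form) (cls x) = cls (\<Sum>k\<in>?A. (of_int k / 2) *\<^sub>F wcomp k (nf x))"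
    unfolding weight_operator_def the Let_def cls_scale cls_sum ..
  also have "\<dots> = (\<Oplus>\<^bsub>VA\<^esub>k\<in>?A. (of_int k / 2) \<odot>\<^bsub>VA\<^esub> ?f k)"
    by (simp only: cls_sum cls_scale)
  also have "\<dots> = (\<Oplus>\<^bsub>VA\<^esub>k\<in>K. (of_int k / 2) \<odot>\<^bsub>VA\<^esub> ?f k)"
    by (rule VA.add.finprod_mono_neutral_cong_left[OF K(1) A]) (simp add: VA.smult_r_null, simp, simp add: cls_scale)
  also have "\<dots> = cls (\<Sum>k\<in>K. (of_int k / 2) *\<^sub>F wcomp k (nf x))"
    by (simp only: cls_sum cls_scale)
  also have "(\<Sum>k\<in>K. (of_int k / 2) *\<^sub>F wcomp k (nf x)) = (\<Sum>k\<in>K. wop (wcomp k (nf x)))"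
    by (simp only: wop_homogeneous[OF wt_in_wcomp])
  also have "\<dots> = wop (\<Sum>k\<in>K. wcomp k (nf x))"
    by (rule flin_sum[OF flin_wop, symmetric])
  also have "\<dots> = wop (nf x)" by (rule arg_cong[OF K(3)[symmetric]])
  finally show ?thesis by (simp add: wop_nf cls_nf)
qed

text \<open>For words the coefficient of \<open>x^n\<close> is homogeneous, of weight
  \<open>n\<close> plus the weights of both words. Both sides are bilinear, so words
  suffice.\<close>

lemma wop_Y0: "wop (Y0 u n v) - Y0 u n (wop v) = of_int n *\<^sub>F Y0 u n v + Y0 (wop u) n v"
proof -
  have words: "wop (Y0 (monomial us) n (monomial vs)) - Y0 (monomial us) n (wop (monomial vs)) =
      of_int n *\<^sub>F Y0 (monomial us) n (monomial vs) + Y0 (wop (monomial us)) n (monomial vs)" for us vs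
  proof -
    let ?y = "Y0 (monomial us) n (monomial vs)"
    have u: "wop (monomial us) = (of_int (double_weight us) / 2) *\<^sub>F monomial us" for us :: "('h \<times> nat) list"
      by (simp add: wop_def)
    have "wt_in {double_weight us + double_weight vs + 2 * n} ?y"
      unfolding Y0_monomial
      by (rule wt_in_mono[OF wt_in_Yw[of "{double_weight vs}"]]) (auto simp: wt_in_monomial)
    from wop_homogeneous[OF this] have "wop ?y - Y0 (monomial us) n (wop (monomial vs)) =
        (of_int (double_weight us + double_weight vs + 2 * n) / 2) *\<^sub>F ?y - (of_int (double_weight vs) / 2) *\<^sub>F ?y"
      by (simp only: u Y0_simps)
    also have "\<dots> = (of_int (double_weight us + double_weight vs + 2 * n) / 2 - of_int (double_weight vs) / 2) *\<^sub>F ?y"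
      by (rule poly_mapping_eqI) (simp only: lookup_minus lookup_fscale left_diff_distrib)
    also have "of_int (double_weight us + double_weight vs + 2 * n) / 2 - of_int (double_weight vs) / 2 =
        (of_int n + of_int (double_weight us) / 2 :: complex)"
      by (simp add: add_divide_distrib)
    finally show ?thesis by (simp only: u Y0_simps fscale_add_left)
  qed
  have 1: "flin (\<lambda>v. wop (Y0 u n v) - Y0 u n (wop v))" for u
    by (rule flin_minus_fun[OF flin_compose[OF flin_wop flin_Y0_right] flin_compose[OF flin_Y0_right flin_wop]])
  have 2: "flin (\<lambda>v. of_int n *\<^sub>F Y0 u n v + Y0 (wop u) n v)" for u
    by (rule flin_plus[OF flin_scale_fun[OF flin_Y0_right] flin_Y0_right])
  have 3: "flin (\<lambda>u. wop (Y0 u n v) - Y0 u n (wop v))"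
    by (rule flin_minus_fun[OF flin_compose[OF flin_wop flin_Y0_left] flin_Y0_left])
  have 4: "flin (\<lambda>u. of_int n *\<^sub>F Y0 u n v + Y0 (wop u) n v)"
    by (rule flin_plus[OF flin_scale_fun[OF flin_Y0_left] flin_compose[OF flin_Y0_left flin_wop]])
  have "wop (Y0 (monomial us) n v) - Y0 (monomial us) n (wop v) =
      of_int n *\<^sub>F Y0 (monomial us) n v + Y0 (wop (monomial us)) n v" for us
    using flin_eqI[OF 1[of "monomial us"] 2[of "monomial us"] words[of us]] .
  from flin_eqI[OF 3 4 this] show ?thesis .
qed

subsection \<open>The vertex algebra\<close>

lemma times_binomial_power_cls:
  assumes "\<And>a b. F a b = cls (G a b)"
  shows "times_binomial_power VA p F a b = cls (tbp p G a b)"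
  by (simp add: times_binomial_power_def assms cls_scale cls_sum tbp_def)

lemma translated_product_cls:
  assumes Y: "\<And>u n v. Y (cls u) n (cls v) = cls (Y0 u n v)"
  shows "translated_product VA Y (cls u) (cls v) (cls w) a b = cls (Lf u v w a b)"
proof -
  let ?g = "\<lambda>j. (of_int (a + int j) gchoose j) *\<^sub>F Y0 u (a + int j) (Y0 v (b - int j) w)"
  obtain B where B: "\<forall>b<B. Y0 v b w = 0" using Y0_truncated by blast
  have "{j. ?g j \<noteq> 0} \<subseteq> {..nat (b - B)}"
  proof
    fix j assume "j \<in> {j. ?g j \<noteq> 0}"
    then have "\<not> b - int j < B" using B by auto
    then show "j \<in> {..nat (b - B)}" by simp
  qed
  then have fin: "finite {j. ?g j \<noteq> 0}" by (rule finite_subset) simp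
  show ?thesis
    unfolding translated_product_def Let_def Y cls_scale Lf_def Tr_def
    by (rule finsum_pi_support[OF fin]) simp
qed

lemma V_grading_submodule: "submodule (V_grading scale form k) complex_field VA"
  unfolding V_grading_cls
proof (rule VA.submoduleI)
  show "cls ` {x. wt_in {k} x} \<subseteq> carrier VA" by auto
  show "\<zero>\<^bsub>VA\<^esub> \<in> cls ` {x. wt_in {k} x}" unfolding cls_zero by (rule imageI) simp
next
  fix a assume "a \<in> cls ` {x. wt_in {k} x}"
  then obtain x where x: "a = cls x" "wt_in {k} x" by blast
  show "\<ominus>\<^bsub>VA\<^esub> a \<in> cls ` {x. wt_in {k} x}"
    unfolding x(1) cls_uminus using wt_in_diff[OF wt_in_zero x(2)] by (intro imageI) simp
next
  fix a b assume "a \<in> cls ` {x. wt_in {k} x}" "b \<in> cls ` {x. wt_in {k} x}"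
  then obtain x y where "a = cls x" "wt_in {k} x" "b = cls y" "wt_in {k} y" by blast
  then show "a \<oplus>\<^bsub>VA\<^esub> b \<in> cls ` {x. wt_in {k} x}"
    using wt_in_add[of "{k}" x y] by (auto simp: cls_add)
next
  fix c a assume "a \<in> cls ` {x. wt_in {k} x}"
  then obtain x where x: "a = cls x" "wt_in {k} x" by blast
  show "c \<odot>\<^bsub>VA\<^esub> a \<in> cls ` {x. wt_in {k} x}"
    unfolding x(1) cls_scale using wt_in_scale[OF x(2)] by (intro imageI) simp
qed

lemma V_grading_neg:
  assumes "k < 0"
  shows "V_grading scale form k = {\<zero>\<^bsub>VA\<^esub>}"
proof -
  have "x = 0" if "wt_in {k} x" for x
    by (rule wt_in_neg[OF wt_in_mono[OF that] assms]) simp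
  then have 0: "Collect (wt_in {k}) = {0}" by auto
  show ?thesis unfolding V_grading_cls cls_zero 0 by simp
qed

lemma vertex_map_associative:
  assumes Y: "\<And>u n v. Y (cls u) n (cls v) = cls (Y0 u n v)"
  shows "\<exists>p. \<forall>u2\<in>carrier VA. \<forall>a b.
     times_binomial_power VA p (translated_product VA Y (cls u) u2 (cls w)) a b =
     times_binomial_power VA p (iterate_product Y (cls u) u2 (cls w)) a b"
proof -
  obtain p where p: "\<forall>v. tbp p (Lf u v w) = tbp p (Rf u v w)" using weak_associativity_words by blast
  have "times_binomial_power VA p (translated_product VA Y (cls u) (cls v) (cls w)) a b =
      times_binomial_power VA p (iterate_product Y (cls u) (cls v) (cls w)) a b" for v a b
  proof -
    have "times_binomial_power VA p (translated_product VA Y (cls u) (cls v) (cls w)) a b =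
        cls (tbp p (Lf u v w) a b)"
      by (rule times_binomial_power_cls) (rule translated_product_cls[of Y, OF Y])
    moreover have "times_binomial_power VA p (iterate_product Y (cls u) (cls v) (cls w)) a b =
        cls (tbp p (Rf u v w) a b)"
      by (rule times_binomial_power_cls) (simp only: iterate_product_def Y Rf_def)
    ultimately show ?thesis by (simp only: p)
  qed
  then show ?thesis unfolding carrier_VA_cls by blast
qed

lemma mosva_V:
  assumes "is_vertex_map scale form Y"
  shows "mosva VA (V_grading scale form) Y (V_vac scale form)"
proof -
  note Y = vertex_map_cls[OF assms]
  have ex: "\<exists>x. v = cls x" if "v \<in> carrier VA" for v
    using that by (auto simp: carrier_VA_cls)
  show ?thesis
  proof (rule mosva.intro[OF module_VA mosva_axioms.intro])
    fix k
    show "submodule (V_grading scale form k) complex_field VA" by (rule V_grading_submodule)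
  next
    show "\<exists>K. \<forall>k<K. V_grading scale form k = {\<zero>\<^bsub>VA\<^esub>}" using V_grading_neg by blast
    show "V_vac scale form \<in> carrier VA" by (simp add: cls_one)
  next
    fix v assume "v \<in> carrier VA"
    then obtain x where v: "v = cls x" using ex by blast
    show "\<exists>!f. is_decomposition VA (V_grading scale form) v f"
      unfolding v by (rule ex1I, rule decomposition_cls, rule decomposition_unique)
    show "Y (V_vac scale form) n v = (if n = 0 then v else \<zero>\<^bsub>VA\<^esub>)" for n
      by (simp add: v cls_one Y Y0_one cls_zero)
    show "Y v n (V_vac scale form) = \<zero>\<^bsub>VA\<^esub>" if "n < 0" for n
      using that by (simp add: v cls_one Y Y0_vacuum_neg cls_zero)
    show "Y v 0 (V_vac scale form) = v"
      by (simp add: v cls_one Y Y0_vacuum_0)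
  next
    fix u v n assume "u \<in> carrier VA" "v \<in> carrier VA"
    from this[THEN ex] obtain x y where u: "u = cls x" and v: "v = cls y" by blast
    show "Y u n v \<in> carrier VA" by (simp add: u v Y)
    show "Y (c \<odot>\<^bsub>VA\<^esub> u) n v = c \<odot>\<^bsub>VA\<^esub> Y u n v" for c
      by (simp add: u v Y cls_scale)
    show "Y u n (c \<odot>\<^bsub>VA\<^esub> v) = c \<odot>\<^bsub>VA\<^esub> Y u n v" for c
      by (simp add: u v Y cls_scale)
    show "weight_operator VA (V_grading scale form) (Y u n v) \<ominus>\<^bsub>VA\<^esub>
          Y u n (weight_operator VA (V_grading scale form) v) =
        of_int n \<odot>\<^bsub>VA\<^esub> Y u n v \<oplus>\<^bsub>VA\<^esub> Y (weight_operator VA (V_grading scale form) u) n v"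
      by (simp only: u v Y weight_operator_cls cls_diff cls_scale cls_add wop_Y0)
    show "of_int (n + 1) \<odot>\<^bsub>VA\<^esub> Y u (n + 1) v = Y (Y u 1 (V_vac scale form)) n v"
      by (simp only: u v cls_one Y Y0_vacuum_1 Y0_Dd cls_scale)
    show "of_int (n + 1) \<odot>\<^bsub>VA\<^esub> Y u (n + 1) v =
        Y (Y u n v) 1 (V_vac scale form) \<ominus>\<^bsub>VA\<^esub> Y u n (Y v 1 (V_vac scale form))"
      by (simp only: u v cls_one Y Y0_vacuum_1 Dd_Y0 cls_scale cls_diff add_diff_cancel_left')
    show "\<exists>p. \<forall>u2\<in>carrier VA. \<forall>a b.
        times_binomial_power VA p (translated_product VA Y u u2 v) a b =
        times_binomial_power VA p (iterate_product Y u u2 v) a b"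
      unfolding u v by (rule vertex_map_associative[of Y, OF Y])
  next
    fix u u' v n assume "u \<in> carrier VA" "u' \<in> carrier VA" "v \<in> carrier VA"
    from this[THEN ex] obtain x x' y where u: "u = cls x" "u' = cls x'" and v: "v = cls y" by blast
    show "Y (u \<oplus>\<^bsub>VA\<^esub> u') n v = Y u n v \<oplus>\<^bsub>VA\<^esub> Y u' n v"
      by (simp add: u v Y cls_add)
    show "Y v n (u \<oplus>\<^bsub>VA\<^esub> u') = Y v n u \<oplus>\<^bsub>VA\<^esub> Y v n u'"
      by (simp add: u v Y cls_add)
  qed
qed

end

text \<open>A vertex map is constrained only on the carrier of V and is arbitrary elsewhere.
  Therefore the axioms are proved for every such map, next to the existence of one.\<close>

theorem theorem3p15:
  fixes scale :: "complex \<Rightarrow> 'h::ab_group_add \<Rightarrow> 'h"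
    and form :: "'h \<Rightarrow> 'h \<Rightarrow> complex"
    and \<pp> \<qq> :: "'h set"
    and M :: nat
  assumes "polarized_space scale form \<pp> \<qq> M"
  shows "(\<exists>Y. is_vertex_map scale form Y) \<and>
         (\<forall>Y. is_vertex_map scale form Y \<longrightarrow>
            mosva (V_module scale form) (V_grading scale form) Y (V_vac scale form))"
proof -
  interpret polarized_space scale form \<pp> \<qq> M by (rule assms)
  show ?thesis
  proof (intro conjI allI impI)
    show "\<exists>Y. is_vertex_map scale form Y" by (rule exI, rule is_vertex_map_vertex_map)
  qed (rule mosva_V)
qed

end
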